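(* Let $h\ge 2$ be an integer and let $G=G(n,r(n),h)$ be an $h$-layered random geometric graph on $n$ vertices with radius $r(n)$. If $$r(n)\ge b\left(\frac{\log n}{n^{h-1}}\right)^{1/(2h)}$$ for a constant $b>\left(\frac{2^{2+3(h-1)}}{\pi^3}\right)^{1/(2h)}$, then with high probability $G$ is rainbow connected. Moreover, if $$r(n)\le c\left(\frac{\log n}{n^{h-1}}\right)^{1/(2h)}$$ for a constant $c<\frac{2}{3\pi}\left(\frac{1}{2\pi}\right)^{h-1}$, then with high probability $G$ is not rainbow connected.
   Context: A multilayered random geometric graph $G(n,r(n),h)$ is the edge-colored multigraph on a vertex set $V$ with $|V|=n$ obtained as follows: for each layer $k\in\{1,\dots,h\}$ and each vertex $v\in V$, a position $b_k(v)\in[0,1]^2$ is chosen uniformly at random, all these choices being independent. For each $k$ and each pair of distinct vertices $u,v$, there is an edge $uv$ of color $k$ if and only if the Euclidean distance between $b_k(u)$ and $b_k(v)$ is at most $r(n)$. Thus the color-$k$ edges form a random geometric graph (the $k$-th layer), and the layers are independent. A path is rainbow if its edges have pairwise distinct colors; the multigraph is rainbow connected if every pair of distinct vertices is joined by a rainbow path. "With high probability" means with probability tending to $1$ as $n\to\infty$. Here $\log$ denotes the natural logarithm. *)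

theory Defs
  imports "HOL-Probability.Probability"
begin

text \<open>Positions: b (k, v) is the position of vertex v (v < n) in layer k (1 \<le> k \<le> h),
  a point of the unit square [0,1]^2, modelled as real \<times> real (Euclidean distance via dist).\<close>

definition rgg_space :: "nat \<Rightarrow> nat \<Rightarrow> (nat \<times> nat \<Rightarrow> real \<times> real) measure" where
  "rgg_space n h = PiM ({1..h} \<times> {..<n}) (\<lambda>_. uniform_measure lborel ({0..1} \<times> {0..1}))"

definition rainbow_path ::
  "nat \<Rightarrow> nat \<Rightarrow> real \<Rightarrow> (nat \<times> nat \<Rightarrow> real \<times> real) \<Rightarrow> nat list \<Rightarrow> nat list \<Rightarrow> bool" where
  "rainbow_path n h r b vs cs \<longleftrightarrow>
     length vs = length cs + 1 \<and> distinct vs \<and> set vs \<subseteq> {..<n} \<and>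
     distinct cs \<and> set cs \<subseteq> {1..h} \<and>
     (\<forall>i < length cs. dist (b (cs ! i, vs ! i)) (b (cs ! i, vs ! Suc i)) \<le> r)"

definition rainbow_connected ::
  "nat \<Rightarrow> nat \<Rightarrow> real \<Rightarrow> (nat \<times> nat \<Rightarrow> real \<times> real) \<Rightarrow> bool" where
  "rainbow_connected n h r b \<longleftrightarrow>
     (\<forall>u < n. \<forall>v < n. u \<noteq> v \<longrightarrow>
        (\<exists>vs cs. rainbow_path n h r b vs cs \<and> hd vs = u \<and> last vs = v))"

end

theory Submission
  imports Defs "HOL-Real_Asymp.Real_Asymp"
begin

text \<open>
  Explore the graph from a vertex \<open>u\<close>, one colour at a time. The positions in different layers are
  independent, so the set reached with colours \<open>1, \<dots>, k\<close> is independent of layer \<open>k + 1\<close>, and repeated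
  vertices are harmless because a rainbow walk contains a rainbow path.

  Connectivity for \<open>h \<ge> 3\<close>: with \<open>x = n r\<^sup>2\<close>, which exceeds a power of \<open>n\<close>, Chernoff bounds show that
  after \<open>k < h\<close> steps at least a constant times \<open>x ^ k\<close> vertices are reached, up to a failure
  probability \<open>exp (- \<delta> x)\<close>. Here the neighbourhood of a reached set is bounded below by the area of the
  cells of side about \<open>r / sqrt 2\<close> that it occupies. A target \<open>v\<close> then avoids all reached vertices in layer \<open>h\<close> with probability at most
  \<open>n powr - \<gamma>\<close>, and \<open>\<gamma> > 2\<close> even if \<open>u\<close> and \<open>v\<close> lie in corners; a union bound over pairs concludes.
  For \<open>h = 2\<close> a corner position is too costly for this. Instead the possible midpoints are split in two
  halves, one for each order of the colours; each order fails with probability \<open>o(1 / n)\<close>, because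
  being near a corner is itself unlikely.

  Disconnectedness: fix \<open>u = 0\<close> and a set \<open>W\<close> of about \<open>n powr (1 / (4 h))\<close> vertices. With high
  probability no two vertices of \<open>W\<close> are joined by fewer than \<open>h\<close> colours, so a vertex of \<open>W\<close> that is
  reached from \<open>u\<close> is adjacent, in some colour \<open>c\<close>, to a vertex outside \<open>W\<close> reached without \<open>c\<close>. The
  latter vertices are only \<open>O(x ^ (h - 1))\<close> many, and their positions in layer \<open>c\<close> are independent of
  which vertices they are, so they leave a share \<open>n powr - E\<close> of the cells of side about \<open>3 r\<close> empty.
  A vertex of \<open>W\<close> in the middle of an empty cell in every layer cannot be reached, and \<open>E\<close> is so
  small that such a vertex exists.
\<close>

section \<open>Powers of a probability space\<close>

context prob_space
begin

lemma prob_space_power: "prob_space (PiM I (\<lambda>_. M))"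
  by (rule prob_space_PiM) (rule prob_space_axioms)

lemma measure_merge_le:
  fixes J K :: "'i set"
  assumes fin: "finite J" "finite K" and disj: "J \<inter> K = {}"
    and E: "{\<omega> \<in> space (PiM (J \<union> K) (\<lambda>_. M)). \<phi> \<omega>} \<in> sets (PiM (J \<union> K) (\<lambda>_. M))"
    and C: "{x \<in> space (PiM J (\<lambda>_. M)). \<psi> x} \<in> sets (PiM J (\<lambda>_. M))"
    and imp: "\<And>x y. x \<in> space (PiM J (\<lambda>_. M)) \<Longrightarrow> y \<in> space (PiM K (\<lambda>_. M)) \<Longrightarrow>
                \<phi> (merge J K (x, y)) \<Longrightarrow> \<psi> x"
    and inner: "\<And>x. x \<in> space (PiM J (\<lambda>_. M)) \<Longrightarrow> \<psi> x \<Longrightarrow>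
        \<P>(y in PiM K (\<lambda>_. M). \<phi> (merge J K (x, y))) \<le> q"
    and q: "0 \<le> q"
  shows "\<P>(\<omega> in PiM (J \<union> K) (\<lambda>_. M). \<phi> \<omega>)
           \<le> q * \<P>(x in PiM J (\<lambda>_. M). \<psi> x)"
proof -
  interpret P: product_prob_space "\<lambda>_::'i. M" by unfold_locales
  interpret JK: prob_space "PiM (J \<union> K) (\<lambda>_. M)" by (rule prob_space_power)
  interpret J: prob_space "PiM J (\<lambda>_. M)" by (rule prob_space_power)
  interpret K: prob_space "PiM K (\<lambda>_. M)" by (rule prob_space_power)
  let ?E = "{\<omega> \<in> space (PiM (J \<union> K) (\<lambda>_. M)). \<phi> \<omega>}"
  let ?C = "{x \<in> space (PiM J (\<lambda>_. M)). \<psi> x}"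
  have le: "emeasure (PiM K (\<lambda>_. M)) ((\<lambda>y. merge J K (x, y)) -` ?E \<inter> space (PiM K (\<lambda>_. M)))
      \<le> ennreal q * indicator ?C x" if x: "x \<in> space (PiM J (\<lambda>_. M))" for x
  proof -
    have eq: "(\<lambda>y. merge J K (x, y)) -` ?E \<inter> space (PiM K (\<lambda>_. M))
        = {y \<in> space (PiM K (\<lambda>_. M)). \<phi> (merge J K (x, y))}"
      using x by (auto simp: space_PiM PiE_def extensional_def merge_def)
    show ?thesis
    proof (cases "\<psi> x")
      case True
      then show ?thesis using inner[OF x True] x unfolding eq
        by (simp add: K.emeasure_eq_measure ennreal_leI)
    next
      case False
      then have emp: "{y \<in> space (PiM K (\<lambda>_. M)). \<phi> (merge J K (x, y))} = {}"
        using imp[OF x] by auto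
      show ?thesis unfolding eq emp by simp
    qed
  qed
  have "emeasure (PiM (J \<union> K) (\<lambda>_. M)) ?E =
     (\<integral>\<^sup>+x. emeasure (PiM K (\<lambda>_. M)) ((\<lambda>y. merge J K (x, y)) -` ?E \<inter> space (PiM K (\<lambda>_. M))) \<partial>PiM J (\<lambda>_. M))"
    by (rule P.emeasure_fold_integral[OF disj fin E])
  also have "\<dots> \<le> (\<integral>\<^sup>+x. ennreal q * indicator ?C x \<partial>PiM J (\<lambda>_. M))"
    by (rule nn_integral_mono) (rule le)
  also have "\<dots> = ennreal q * emeasure (PiM J (\<lambda>_. M)) ?C"
    by (rule nn_integral_cmult_indicator[OF C])
  also have "\<dots> = ennreal (q * measure (PiM J (\<lambda>_. M)) ?C)"
    using q by (simp add: J.emeasure_eq_measure ennreal_mult)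
  finally show ?thesis
    using q by (simp add: JK.emeasure_eq_measure)
qed

lemma nn_integral_prod_coords:
  fixes I :: "'i set"
  assumes I: "finite I" and T: "T \<subseteq> I" and f: "\<And>i. i \<in> T \<Longrightarrow> f i \<in> borel_measurable M"
  shows "(\<integral>\<^sup>+ \<omega>. (\<Prod>i\<in>T. f i (\<omega> i)) \<partial>PiM I (\<lambda>_. M)) = (\<Prod>i\<in>T. integral\<^sup>N M (f i))"
proof -
  interpret P: product_prob_space "\<lambda>_::'i. M" by unfold_locales
  let ?g = "\<lambda>i. if i \<in> T then f i else (\<lambda>_. 1)"
  have "(\<integral>\<^sup>+ \<omega>. (\<Prod>i\<in>I. ?g i (\<omega> i)) \<partial>PiM I (\<lambda>_. M)) = (\<Prod>i\<in>I. integral\<^sup>N M (?g i))"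
    by (rule P.product_nn_integral_prod) (use I f in auto)
  moreover have "(\<Prod>i\<in>I. ?g i (\<omega> i)) = (\<Prod>i\<in>T. f i (\<omega> i))" for \<omega>
    by (rule prod.mono_neutral_cong_right) (use I T in auto)
  moreover have "(\<Prod>i\<in>I. integral\<^sup>N M (?g i)) = (\<Prod>i\<in>T. integral\<^sup>N M (f i))"
    by (rule prod.mono_neutral_cong_right) (use I T in \<open>auto simp: emeasure_space_1\<close>)
  ultimately show ?thesis by simp
qed

lemma measure_coords:
  fixes I :: "'i set"
  assumes I: "finite I" and T: "T \<subseteq> I" and A: "\<And>i. i \<in> T \<Longrightarrow> A i \<in> sets M"
  shows "\<P>(\<omega> in PiM I (\<lambda>_. M). \<forall>i\<in>T. \<omega> i \<in> A i) = (\<Prod>i\<in>T. prob (A i))"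
proof -
  interpret I: prob_space "PiM I (\<lambda>_. M)" by (rule prob_space_power)
  have fT: "finite T" using I T finite_subset by blast
  have meas: "{\<omega> \<in> space (PiM I (\<lambda>_. M)). \<forall>i\<in>T. \<omega> i \<in> A i} \<in> sets (PiM I (\<lambda>_. M))"
    using fT
  proof (intro sets.sets_Collect_finite_All)
    fix i assume "i \<in> T"
    then show "{\<omega> \<in> space (PiM I (\<lambda>_. M)). \<omega> i \<in> A i} \<in> sets (PiM I (\<lambda>_. M))"
      using measurable_sets[OF measurable_component_singleton[of i I "\<lambda>_. M"] A[of i]] T
      by (auto simp: vimage_def Int_def conj_commute)
  qed
  have "emeasure (PiM I (\<lambda>_. M)) {\<omega> \<in> space (PiM I (\<lambda>_. M)). \<forall>i\<in>T. \<omega> i \<in> A i} =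
    (\<integral>\<^sup>+ \<omega>. indicator {\<omega> \<in> space (PiM I (\<lambda>_. M)). \<forall>i\<in>T. \<omega> i \<in> A i} \<omega> \<partial>PiM I (\<lambda>_. M))"
    using meas by simp
  also have "\<dots> = (\<integral>\<^sup>+ \<omega>. (\<Prod>i\<in>T. indicator (A i) (\<omega> i)) \<partial>PiM I (\<lambda>_. M))"
    by (rule nn_integral_cong) (use fT in \<open>auto simp: indicator_def prod_zero_iff intro!: prod.neutral\<close>)
  also have "\<dots> = (\<Prod>i\<in>T. integral\<^sup>N M (indicator (A i)))"
    by (rule nn_integral_prod_coords[OF I T]) (use A in auto)
  also have "\<dots> = (\<Prod>i\<in>T. ennreal (prob (A i)))"
    using A by (intro prod.cong) (auto simp: emeasure_eq_measure)
  also have "\<dots> = ennreal (\<Prod>i\<in>T. prob (A i))"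
    by (rule prod_ennreal) simp
  finally show ?thesis
    by (simp add: I.emeasure_eq_measure prod_nonneg)
qed

lemma count_measurable:
  fixes I :: "'i set"
  assumes T: "finite T" "T \<subseteq> I" and A: "\<And>i. i \<in> T \<Longrightarrow> A i \<in> sets M"
  shows "(\<lambda>\<omega>. real (card {i \<in> T. \<omega> i \<in> A i})) \<in> borel_measurable (PiM I (\<lambda>_. M))"
proof -
  have "real (card {i \<in> T. \<omega> i \<in> A i}) = (\<Sum>i\<in>T. indicator (A i) (\<omega> i))" for \<omega>
    using T(1) by (simp add: indicator_def sum.If_cases Int_def)
  moreover have "(\<lambda>\<omega>. \<Sum>i\<in>T. indicator (A i) (\<omega> i) :: real) \<in> borel_measurable (PiM I (\<lambda>_. M))"
    using T A by (intro borel_measurable_sum) (auto intro!: measurable_compose[OF measurable_component_singleton])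
  ultimately show ?thesis by simp
qed

lemma nn_integral_power_count:
  fixes I :: "'i set"
  assumes I: "finite I" and T: "T \<subseteq> I" and A: "\<And>i. i \<in> T \<Longrightarrow> A i \<in> sets M" and z: "0 \<le> z"
  shows "(\<integral>\<^sup>+ \<omega>. ennreal (z ^ card {i \<in> T. \<omega> i \<in> A i}) \<partial>PiM I (\<lambda>_. M))
          = ennreal (\<Prod>i\<in>T. 1 + prob (A i) * (z - 1))"
proof -
  have fT: "finite T" using I T finite_subset by blast
  have "ennreal (z ^ card {i \<in> T. \<omega> i \<in> A i}) = (\<Prod>i\<in>T. ennreal (if \<omega> i \<in> A i then z else 1))" for \<omega>
  proof -
    have "(\<Prod>i\<in>T. ennreal (if \<omega> i \<in> A i then z else 1)) = ennreal (\<Prod>i\<in>T. if \<omega> i \<in> A i then z else 1)"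
      by (rule prod_ennreal) (use z in auto)
    also have "(\<Prod>i\<in>T. if \<omega> i \<in> A i then z else 1) = z ^ card {i \<in> T. \<omega> i \<in> A i}"
      using fT by (simp add: prod.If_cases Int_def)
    finally show ?thesis by simp
  qed
  then have "(\<integral>\<^sup>+ \<omega>. ennreal (z ^ card {i \<in> T. \<omega> i \<in> A i}) \<partial>PiM I (\<lambda>_. M)) =
     (\<integral>\<^sup>+ \<omega>. (\<Prod>i\<in>T. (\<lambda>x. ennreal (if x \<in> A i then z else 1)) (\<omega> i)) \<partial>PiM I (\<lambda>_. M))"
    by simp
  also have "\<dots> = (\<Prod>i\<in>T. \<integral>\<^sup>+x. ennreal (if x \<in> A i then z else 1) \<partial>M)"
    by (rule nn_integral_prod_coords[OF I T]) (use A in measurable)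
  also have "\<dots> = (\<Prod>i\<in>T. ennreal (1 + prob (A i) * (z - 1)))"
  proof (rule prod.cong[OF refl])
    fix i assume i: "i \<in> T"
    have "(\<integral>\<^sup>+x. ennreal (if x \<in> A i then z else 1) \<partial>M)
        = (\<integral>\<^sup>+x. ennreal z * indicator (A i) x + indicator (space M - A i) x \<partial>M)"
      using z by (intro nn_integral_cong) (auto simp: indicator_def)
    also have "\<dots> = ennreal z * emeasure M (A i) + emeasure M (space M - A i)"
      using A[OF i] by (subst nn_integral_add) (auto simp: nn_integral_cmult_indicator)
    also have "\<dots> = ennreal (z * prob (A i) + (1 - prob (A i)))"
      using A[OF i] z by (simp add: emeasure_eq_measure prob_compl ennreal_mult[symmetric] ennreal_plus[symmetric] del: ennreal_plus)
    finally show "(\<integral>\<^sup>+x. ennreal (if x \<in> A i then z else 1) \<partial>M) = ennreal (1 + prob (A i) * (z - 1))"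
      by (simp add: algebra_simps)
  qed
  also have "\<dots> = ennreal (\<Prod>i\<in>T. 1 + prob (A i) * (z - 1))"
  proof (rule prod_ennreal)
    fix i assume "i \<in> T"
    have "prob (A i) * (1 - z) \<le> 1 * 1" if "z \<le> 1" using that z by (intro mult_mono) auto
    moreover have "0 \<le> prob (A i) * (z - 1)" if "1 \<le> z" using that by simp
    ultimately show "0 \<le> 1 + prob (A i) * (z - 1)"
      by (cases "z \<le> 1") (auto simp: algebra_simps)
  qed
  finally show ?thesis .
qed

lemma chernoff:
  fixes I :: "'i set"
  assumes I: "finite I" and T: "T \<subseteq> I" and A: "\<And>i. i \<in> T \<Longrightarrow> A i \<in> sets M"
    and p: "\<And>i. i \<in> T \<Longrightarrow> prob (A i) * (exp t - 1) \<le> p * (exp t - 1)"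
  shows "\<P>(\<omega> in PiM I (\<lambda>_. M). t * a \<le> t * real (card {i \<in> T. \<omega> i \<in> A i}))
           \<le> exp (- (t * a)) * exp (real (card T) * p * (exp t - 1))"
proof -
  interpret I: prob_space "PiM I (\<lambda>_. M)" by (rule prob_space_power)
  have fT: "finite T" using I T finite_subset by blast
  note [measurable] = count_measurable[OF fT T A]
  let ?X = "\<lambda>\<omega>. card {i \<in> T. \<omega> i \<in> A i}"
  let ?E = "{\<omega> \<in> space (PiM I (\<lambda>_. M)). t * a \<le> t * real (?X \<omega>)}"
  have E: "?E \<in> sets (PiM I (\<lambda>_. M))" by measurable
  have "emeasure (PiM I (\<lambda>_. M)) ?E = (\<integral>\<^sup>+ \<omega>. indicator ?E \<omega> \<partial>PiM I (\<lambda>_. M))"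
    using E by simp
  also have "\<dots> \<le> (\<integral>\<^sup>+ \<omega>. ennreal (exp (- (t * a))) * ennreal (exp t ^ ?X \<omega>) \<partial>PiM I (\<lambda>_. M))"
  proof (rule nn_integral_mono)
    fix \<omega>
    have "1 \<le> exp (- (t * a)) * exp t ^ ?X \<omega>" if "t * a \<le> t * real (?X \<omega>)"
      using that by (simp add: exp_of_nat_mult[symmetric] exp_add[symmetric] mult.commute)
    then show "indicator ?E \<omega> \<le> ennreal (exp (- (t * a))) * ennreal (exp t ^ ?X \<omega>)"
      by (auto simp: indicator_def ennreal_mult[symmetric] simp del: ennreal_1 simp flip: ennreal_1)
  qed
  also have "\<dots> = ennreal (exp (- (t * a))) * ennreal (\<Prod>i\<in>T. 1 + prob (A i) * (exp t - 1))"
    using nn_integral_power_count[where z = "exp t", OF I T A]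
  proof (subst nn_integral_cmult)
    have "(\<lambda>\<omega>. ennreal (exp (t * real (?X \<omega>)))) \<in> borel_measurable (PiM I (\<lambda>_. M))" by measurable
    then show "(\<lambda>\<omega>. ennreal (exp t ^ ?X \<omega>)) \<in> borel_measurable (PiM I (\<lambda>_. M))"
      by (simp add: exp_of_nat_mult[symmetric] mult.commute)
  qed simp
  also have "\<dots> \<le> ennreal (exp (- (t * a))) * ennreal (\<Prod>i\<in>T. exp (p * (exp t - 1)))"
  proof (intro mult_left_mono ennreal_leI prod_mono conjI)
    fix i assume i: "i \<in> T"
    have "0 \<le> (1 - prob (A i)) + prob (A i) * exp t" by simp
    then show "0 \<le> 1 + prob (A i) * (exp t - 1)" by (simp add: algebra_simps)
    show "1 + prob (A i) * (exp t - 1) \<le> exp (p * (exp t - 1))"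
      using exp_ge_add_one_self[of "p * (exp t - 1)"] p[OF i] by linarith
  qed simp
  also have "\<dots> = ennreal (exp (- (t * a)) * exp (real (card T) * p * (exp t - 1)))"
    by (simp add: ennreal_mult exp_of_nat_mult[symmetric] algebra_simps)
  finally show ?thesis by (simp add: I.emeasure_eq_measure)
qed

corollary chernoff_lower:
  fixes I :: "'i set"
  assumes I: "finite I" and T: "T \<subseteq> I" and A: "\<And>i. i \<in> T \<Longrightarrow> A i \<in> sets M"
    and p: "\<And>i. i \<in> T \<Longrightarrow> p \<le> prob (A i)" and t: "0 \<le> t"
  shows "\<P>(\<omega> in PiM I (\<lambda>_. M). real (card {i \<in> T. \<omega> i \<in> A i}) \<le> a)
           \<le> exp (t * a) * exp (- (real (card T) * p * (1 - exp (- t))))"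
proof -
  interpret I: prob_space "PiM I (\<lambda>_. M)" by (rule prob_space_power)
  note [measurable] = count_measurable[OF finite_subset[OF T I] T A]
  have "I.prob {\<omega> \<in> space (PiM I (\<lambda>_. M)). real (card {i \<in> T. \<omega> i \<in> A i}) \<le> a}
    \<le> I.prob {\<omega> \<in> space (PiM I (\<lambda>_. M)). - t * a \<le> - t * real (card {i \<in> T. \<omega> i \<in> A i})}"
    by (rule I.finite_measure_mono) (use t in \<open>auto intro: mult_left_mono\<close>, measurable)
  also have "\<dots> \<le> exp (- (- t * a)) * exp (real (card T) * p * (exp (- t) - 1))"
    by (rule chernoff[OF I T A]) (use p t in \<open>auto intro!: mult_right_mono_neg\<close>)
  finally show ?thesis by (simp add: algebra_simps)
qed

corollary chernoff_upper:
  fixes I :: "'i set"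
  assumes I: "finite I" and T: "T \<subseteq> I" and A: "\<And>i. i \<in> T \<Longrightarrow> A i \<in> sets M"
    and p: "\<And>i. i \<in> T \<Longrightarrow> prob (A i) \<le> p" and t: "0 \<le> t"
  shows "\<P>(\<omega> in PiM I (\<lambda>_. M). a \<le> real (card {i \<in> T. \<omega> i \<in> A i}))
           \<le> exp (- (t * a)) * exp (real (card T) * p * (exp t - 1))"
proof -
  interpret I: prob_space "PiM I (\<lambda>_. M)" by (rule prob_space_power)
  note [measurable] = count_measurable[OF finite_subset[OF T I] T A]
  have "I.prob {\<omega> \<in> space (PiM I (\<lambda>_. M)). a \<le> real (card {i \<in> T. \<omega> i \<in> A i})}
    \<le> I.prob {\<omega> \<in> space (PiM I (\<lambda>_. M)). t * a \<le> t * real (card {i \<in> T. \<omega> i \<in> A i})}"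
    by (rule I.finite_measure_mono) (use t in \<open>auto intro: mult_left_mono\<close>, measurable)
  also have "\<dots> \<le> exp (- (t * a)) * exp (real (card T) * p * (exp t - 1))"
    by (rule chernoff[OF I T A]) (use p t in \<open>auto intro!: mult_right_mono\<close>)
  finally show ?thesis .
qed

lemma measure_blocks:
  fixes I :: "'i set" and L :: "'j \<Rightarrow> 'i set"
  assumes I: "finite I" and T: "finite T" and L: "\<And>j. j \<in> T \<Longrightarrow> L j \<subseteq> I"
    and disj: "disjoint_family_on L T"
    and dep: "\<And>j \<omega>. j \<in> T \<Longrightarrow> \<omega> \<in> space (PiM I (\<lambda>_. M)) \<Longrightarrow> \<phi> j (restrict \<omega> (L j)) = \<phi> j \<omega>"
    and meas: "\<And>j. j \<in> T \<Longrightarrow> {\<eta> \<in> space (PiM (L j) (\<lambda>_. M)). \<phi> j \<eta>} \<in> sets (PiM (L j) (\<lambda>_. M))"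
  shows "\<P>(\<omega> in PiM I (\<lambda>_. M). \<forall>j\<in>T. \<phi> j \<omega>)
       = (\<Prod>j\<in>T. \<P>(\<omega> in PiM I (\<lambda>_. M). \<phi> j \<omega>))"
proof (cases "T = {} \<or> I = {}")
  case True
  interpret I: prob_space "PiM I (\<lambda>_. M)" by (rule prob_space_power)
  show ?thesis
  proof (cases "T = {}")
    case True
    then show ?thesis using I.prob_space by simp
  next
    case False
    then have "I = {}" using True by auto
    have sp: "space (PiM I (\<lambda>_. M)) = {\<lambda>_. undefined}" using \<open>I = {}\<close> by (simp add: space_PiM_empty)
    have one: "measure (PiM I (\<lambda>_. M)) {\<lambda>_. undefined} = 1" using I.prob_space unfolding sp .
    have "{\<omega> \<in> {\<lambda>_. undefined}. P \<omega>} = (if P (\<lambda>_. undefined) then {\<lambda>_. undefined} else {})" for P :: "('i \<Rightarrow> 'a) \<Rightarrow> bool" by auto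
    then show ?thesis unfolding sp using one T by (auto simp: prod_zero_iff)
  qed
next
  case False
  then have ne: "T \<noteq> {}" "I \<noteq> {}" by auto
  interpret I: prob_space "PiM I (\<lambda>_. M)" by (rule prob_space_power)
  have "I.indep_vars (\<lambda>_. M) (\<lambda>i \<omega>. \<omega> i) I"
  proof (subst I.indep_vars_iff_distr_eq_PiM'[OF ne(2)])
    show "distr (PiM I (\<lambda>_. M)) (PiM I (\<lambda>_. M)) (\<lambda>x. \<lambda>i\<in>I. x i) = PiM I (\<lambda>i. distr (PiM I (\<lambda>_. M)) M (\<lambda>\<omega>. \<omega> i))"
    proof -
      interpret P: product_prob_space "\<lambda>_::'i. M" by unfold_locales
      have "distr (PiM I (\<lambda>_. M)) (PiM I (\<lambda>_. M)) (\<lambda>x. \<lambda>i\<in>I. x i) = distr (PiM I (\<lambda>_. M)) (PiM I (\<lambda>_. M)) (\<lambda>x. x)"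
        by (rule distr_cong) (auto simp: space_PiM PiE_def extensional_restrict)
      also have "\<dots> = PiM I (\<lambda>_. M)" by (rule distr_id)
      also have "\<dots> = PiM I (\<lambda>i. distr (PiM I (\<lambda>_. M)) M (\<lambda>\<omega>. \<omega> i))"
        by (rule PiM_cong) (auto simp: P.PiM_component)
      finally show ?thesis .
    qed
  qed auto
  then have "I.indep_vars (\<lambda>j. PiM (L j) (\<lambda>_. M)) (\<lambda>j \<omega>. restrict (\<lambda>i. \<omega> i) (L j)) T"
    by (rule I.indep_vars_restrict) (use L disj in auto)
  then have prob_eq: "I.prob (\<Inter>j\<in>T. (\<lambda>\<omega>. restrict (\<lambda>i. \<omega> i) (L j)) -` {\<eta> \<in> space (PiM (L j) (\<lambda>_. M)). \<phi> j \<eta>} \<inter> space (PiM I (\<lambda>_. M)))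
      = (\<Prod>j\<in>T. I.prob ((\<lambda>\<omega>. restrict (\<lambda>i. \<omega> i) (L j)) -` {\<eta> \<in> space (PiM (L j) (\<lambda>_. M)). \<phi> j \<eta>} \<inter> space (PiM I (\<lambda>_. M))))"
    (is "I.prob (\<Inter>j\<in>T. ?P j) = (\<Prod>j\<in>T. I.prob (?P j))")
    by (rule I.indep_varsD) (use ne T meas in auto)
  have P: "?P j = {\<omega> \<in> space (PiM I (\<lambda>_. M)). \<phi> j \<omega>}" if "j \<in> T" for j
    using L[OF that] dep[OF that] by (auto simp: space_PiM PiE_def)
  have "(\<Inter>j\<in>T. ?P j) = (\<Inter>j\<in>T. {\<omega> \<in> space (PiM I (\<lambda>_. M)). \<phi> j \<omega>})"
    by (rule INF_cong) (auto simp only: P)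
  also have "\<dots> = {\<omega> \<in> space (PiM I (\<lambda>_. M)). \<forall>j\<in>T. \<phi> j \<omega>}"
    using ne by auto
  finally have inter: "(\<Inter>j\<in>T. ?P j) = {\<omega> \<in> space (PiM I (\<lambda>_. M)). \<forall>j\<in>T. \<phi> j \<omega>}" .
  have "(\<Prod>j\<in>T. I.prob (?P j)) = (\<Prod>j\<in>T. I.prob {\<omega> \<in> space (PiM I (\<lambda>_. M)). \<phi> j \<omega>})"
    by (rule prod.cong) (simp_all only: P)
  then show ?thesis using prob_eq unfolding inter by (rule trans[rotated])
qed

end

section \<open>The uniform distribution on the square\<close>

definition unif_square :: "(real \<times> real) measure" where
  "unif_square = uniform_measure lborel ({0..1} \<times> {0..1})"

abbreviation square :: "(real \<times> real) set" where
  "square \<equiv> {0..1} \<times> {0..1}"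

lemma measure_lborel_Times:
  assumes "A \<in> sets borel" "B \<in> sets borel"
  shows "measure lborel (A \<times> B :: (real \<times> real) set) = measure lborel A * measure lborel B"
proof -
  have "emeasure lborel (A \<times> B) = emeasure lborel A * emeasure lborel B"
    using assms by (simp add: lborel_prod[symmetric] lborel.emeasure_pair_measure_Times)
  then show ?thesis by (simp add: measure_def enn2real_mult)
qed

lemma emeasure_square: "emeasure lborel square = 1"
proof -
  have "emeasure lborel square = emeasure lborel {0..1::real} * emeasure lborel {0..1::real}"
    by (simp only: lborel_prod[symmetric]) (rule lborel.emeasure_pair_measure_Times, auto)
  then show ?thesis by simp
qed

lemma sets_unif_square [measurable_cong, simp]: "sets unif_square = sets borel"
  by (simp add: unif_square_def)

lemma space_unif_square [simp]: "space unif_square = UNIV"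
  by (simp add: unif_square_def)

lemma square_borel [measurable]: "square \<in> sets borel"
  by (simp add: borel_closed closed_Times)

interpretation unif: prob_space unif_square
  unfolding unif_square_def by (rule prob_space_uniform_measure) (simp_all add: emeasure_square)

lemma measure_unif_square:
  assumes "A \<in> sets borel"
  shows "measure unif_square A = measure lborel (square \<inter> A)"
  using assms unfolding unif_square_def by (subst measure_uniform_measure) (auto simp: emeasure_square measure_def)

lemma measure_square: "measure unif_square square = 1"
  by (subst measure_unif_square) (auto simp: measure_def emeasure_square)

lemma measure_unif_square_Times:
  assumes "A \<in> sets borel" "B \<in> sets borel" "A \<subseteq> {0..1}" "B \<subseteq> {0..1}"
  shows "measure unif_square (A \<times> B) = measure lborel A * measure lborel B"
proof -
  have "A \<times> B \<in> sets borel" using assms by (auto simp flip: borel_prod)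
  moreover have "square \<inter> (A \<times> B) = A \<times> B" using assms by auto
  ultimately show ?thesis using assms by (simp add: measure_unif_square measure_lborel_Times)
qed

lemma borel_measurable_fst_real [measurable]: "fst \<in> borel_measurable (borel :: (real \<times> real) measure)"
  by (intro borel_measurable_continuous_onI continuous_on_fst continuous_on_id)

lemma borel_measurable_snd_real [measurable]: "snd \<in> borel_measurable (borel :: (real \<times> real) measure)"
  by (intro borel_measurable_continuous_onI continuous_on_snd continuous_on_id)

lemma half_plane_borel [simp]:
  fixes c s :: real
  shows "{y :: real \<times> real. c \<le> s * fst y} \<in> sets borel" "{y :: real \<times> real. c \<le> s * snd y} \<in> sets borel"
  by measurable

lemma cball_subset_Times:
  fixes x :: "real \<times> real"
  shows "cball x r \<subseteq> {fst x - r..fst x + r} \<times> {snd x - r..snd x + r}"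
proof
  fix y assume "y \<in> cball x r"
  then have "dist x y \<le> r" by simp
  then have "dist (fst x) (fst y) \<le> r" "dist (snd x) (snd y) \<le> r"
    using dist_fst_le[of x y] dist_snd_le[of x y] by linarith+
  then show "y \<in> {fst x - r..fst x + r} \<times> {snd x - r..snd x + r}"
    by (cases y) (auto simp: dist_real_def)
qed

lemma measure_cball_le:
  assumes "0 \<le> r"
  shows "measure unif_square (cball x r) \<le> 4 * r\<^sup>2"
proof -
  let ?B = "{fst x - r..fst x + r} \<times> {snd x - r..snd x + r}"
  have b: "?B \<in> sets borel" by (simp add: borel_closed closed_Times)
  have "measure unif_square (cball x r) = measure lborel (square \<inter> cball x r)"
    by (rule measure_unif_square) simp
  also have "\<dots> \<le> measure lborel ?B"
  proof (rule measure_mono_fmeasurable)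
    show "square \<inter> cball x r \<subseteq> ?B" using cball_subset_Times[of x r] by auto
    show "?B \<in> fmeasurable lborel"
    proof -
      have "?B = cbox (fst x - r, snd x - r) (fst x + r, snd x + r)"
        by (simp only: cbox_Pair_eq box_real)
      then show ?thesis
        using b emeasure_lborel_cbox_finite[of "(fst x - r, snd x - r)" "(fst x + r, snd x + r)"]
        by (simp only: fmeasurable_def mem_Collect_eq sets_lborel simp_thms)
    qed
  qed auto
  also have "\<dots> = 4 * r\<^sup>2"
    using assms by (subst measure_lborel_Times) (auto simp: power2_eq_square)
  finally show ?thesis .
qed

definition flip_fst :: "real \<Rightarrow> real \<times> real \<Rightarrow> real \<times> real" where
  "flip_fst a p = (2 * a - fst p, snd p)"

definition flip_snd :: "real \<Rightarrow> real \<times> real \<Rightarrow> real \<times> real" where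
  "flip_snd b p = (fst p, 2 * b - snd p)"

lemma distr_flip:
  fixes t :: "real \<times> real" and c :: "real \<times> real \<Rightarrow> real"
  assumes "\<And>j. j \<in> Basis \<Longrightarrow> \<bar>c j\<bar> = 1"
    and T: "\<And>x. T x = t + (\<Sum>j\<in>Basis. (c j * (x \<bullet> j)) *\<^sub>R j)"
  shows "distr lborel borel T = lborel"
proof -
  have "T = (\<lambda>x. t + (\<Sum>j\<in>Basis. (c j * (x \<bullet> j)) *\<^sub>R j))" using T by auto
  moreover have "lborel = density (distr lborel borel (\<lambda>x. t + (\<Sum>j\<in>Basis. (c j * (x \<bullet> j)) *\<^sub>R j))) (\<lambda>_. (\<Prod>j\<in>Basis. \<bar>c j\<bar>))"
    by (rule lborel_affine_euclidean) (use assms in force)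
  moreover have "(\<Prod>j\<in>(Basis::(real\<times>real) set). \<bar>c j\<bar>) = 1" using assms by simp
  ultimately show ?thesis by (simp add: density_1)
qed

lemma distr_flip_fst: "distr lborel borel (flip_fst a) = lborel"
  by (rule distr_flip[where c = "\<lambda>j. if j = (1, 0) then - 1 else 1" and t = "(2 * a, 0)"])
     (auto simp: flip_fst_def Basis_prod_def inner_Pair_0 sum.union_disjoint)

lemma distr_flip_snd: "distr lborel borel (flip_snd a) = lborel"
  by (rule distr_flip[where c = "\<lambda>j. if j = (0, 1) then - 1 else 1" and t = "(0, 2 * a)"])
     (auto simp: flip_snd_def Basis_prod_def inner_Pair_0 sum.union_disjoint)

lemma half_measure_le:
  fixes A B :: "(real \<times> real) set"
  assumes T: "distr lborel borel T = lborel" "T \<in> borel_measurable borel"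
    and A: "A \<in> fmeasurable lborel" and B: "B \<in> sets borel" "B \<subseteq> A"
    and cov: "A \<subseteq> B \<union> T -` B"
  shows "measure lborel A \<le> 2 * measure lborel B"
proof -
  have Bf: "B \<in> fmeasurable lborel" using A B by (intro fmeasurableI2[OF A]) auto
  have eq: "emeasure lborel (T -` B) = emeasure lborel B"
    using emeasure_distr[of T lborel borel B] T B by simp
  have "T -` B \<in> sets borel" using measurable_sets[OF T(2) B(1)] by simp
  then have TBf: "T -` B \<in> fmeasurable lborel" using Bf eq by (auto simp: fmeasurable_def)
  have "measure lborel A \<le> measure lborel (B \<union> T -` B)"
    by (rule measure_mono_fmeasurable[OF cov]) (use A Bf TBf in \<open>auto intro: fmeasurable.Un fmeasurableD\<close>)
  also have "\<dots> \<le> measure lborel B + measure lborel (T -` B)"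
    using Bf TBf by (intro measure_Un_le) auto
  also have "measure lborel (T -` B) = measure lborel B" using eq by (simp add: measure_def)
  finally show ?thesis by simp
qed

lemma flip_measurable [measurable]:
  "flip_fst a \<in> borel_measurable borel" "flip_snd a \<in> borel_measurable borel"
  unfolding flip_fst_def flip_snd_def by (auto simp flip: borel_prod)

lemma dist_flip:
  "dist x (flip_fst (fst x) y) = dist x y" "dist x (flip_snd (snd x) y) = dist x y"
  by (auto simp: flip_fst_def flip_snd_def dist_prod_def dist_real_def power2_eq_square algebra_simps)

lemma measure_disc: "0 \<le> r \<Longrightarrow> measure lborel (cball (x :: real \<times> real) r) = pi * r\<^sup>2"
  using content_cball[of r x] unit_ball_vol_2 by (simp add: power2_eq_square)

lemma cball_fmeasurable: "cball (x :: real \<times> real) r \<in> fmeasurable lborel"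
  using emeasure_lborel_cball_finite[of x r] by (auto simp: fmeasurable_def less_top)

definition corner :: "real \<Rightarrow> real \<times> real \<Rightarrow> bool" where
  "corner r x \<longleftrightarrow> fst x \<notin> {r..1 - r} \<and> snd x \<notin> {r..1 - r}"

lemma half_disc:
  fixes x :: "real \<times> real"
  assumes "0 \<le> r"
  shows "pi * r\<^sup>2 / 2 \<le> measure lborel (cball x r \<inter> {y. s * fst x \<le> s * fst y})"
    and "pi * r\<^sup>2 / 2 \<le> measure lborel (cball x r \<inter> {y. s * snd x \<le> s * snd y})"
proof -
  have "measure lborel (cball x r) \<le> 2 * measure lborel (cball x r \<inter> {y. s * fst x \<le> s * fst y})"
  proof (rule half_measure_le[OF distr_flip_fst[of "fst x"]])
    show "cball x r \<subseteq> cball x r \<inter> {y. s * fst x \<le> s * fst y} \<union> flip_fst (fst x) -` (cball x r \<inter> {y. s * fst x \<le> s * fst y})"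
      by (auto simp: dist_flip) (auto simp: flip_fst_def algebra_simps)
  qed (auto simp: cball_fmeasurable)
  then show "pi * r\<^sup>2 / 2 \<le> measure lborel (cball x r \<inter> {y. s * fst x \<le> s * fst y})"
    using assms by (simp add: measure_disc)
  have "measure lborel (cball x r) \<le> 2 * measure lborel (cball x r \<inter> {y. s * snd x \<le> s * snd y})"
  proof (rule half_measure_le[OF distr_flip_snd[of "snd x"]])
    show "cball x r \<subseteq> cball x r \<inter> {y. s * snd x \<le> s * snd y} \<union> flip_snd (snd x) -` (cball x r \<inter> {y. s * snd x \<le> s * snd y})"
      by (auto simp: dist_flip) (auto simp: flip_snd_def algebra_simps)
  qed (auto simp: cball_fmeasurable)
  then show "pi * r\<^sup>2 / 2 \<le> measure lborel (cball x r \<inter> {y. s * snd x \<le> s * snd y})"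
    using assms by (simp add: measure_disc)
qed

lemma measure_cball_ge:
  fixes x :: "real \<times> real"
  assumes "A \<subseteq> square \<inter> cball x r" "A \<in> sets borel"
  shows "measure lborel A \<le> measure unif_square (cball x r)"
proof -
  have "measure lborel A \<le> measure lborel (square \<inter> cball x r)"
    by (rule measure_mono_fmeasurable) (use assms fmeasurable_Int_fmeasurable[OF cball_fmeasurable[of x r], of square] in \<open>auto simp: Int_commute\<close>)
  then show ?thesis by (simp add: measure_unif_square)
qed

lemma measure_cball_quarter:
  fixes x :: "real \<times> real"
  assumes r: "0 \<le> r" "r \<le> 1 / 2" and x: "x \<in> square"
  shows "pi * r\<^sup>2 / 4 \<le> measure unif_square (cball x r)"
proof -
  define s where "s = (if fst x \<le> 1 / 2 then 1 else - 1 :: real)"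
  define t where "t = (if snd x \<le> 1 / 2 then 1 else - 1 :: real)"
  let ?H = "cball x r \<inter> {y. s * fst y \<ge> s * fst x}"
  let ?Q = "?H \<inter> {y. t * snd y \<ge> t * snd x}"
  have "pi * r\<^sup>2 / 2 \<le> measure lborel ?H"
    by (rule half_disc[OF r(1)])
  moreover have "measure lborel ?H \<le> 2 * measure lborel ?Q"
  proof (rule half_measure_le[OF distr_flip_snd[of "snd x"]])
    show "?H \<subseteq> ?Q \<union> flip_snd (snd x) -` ?Q"
      by (auto simp: dist_flip) (auto simp: flip_snd_def t_def split: if_splits)
    show "?H \<in> fmeasurable lborel"
      by (intro fmeasurable_Int_fmeasurable cball_fmeasurable) auto
  qed auto
  moreover have "measure lborel ?Q \<le> measure unif_square (cball x r)"
  proof (rule measure_cball_ge)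
    show "?Q \<subseteq> square \<inter> cball x r"
    proof
      fix y assume y: "y \<in> ?Q"
      then have "y \<in> {fst x - r..fst x + r} \<times> {snd x - r..snd x + r}" using cball_subset_Times by blast
      then show "y \<in> square \<inter> cball x r"
        using y x r by (cases y; cases x) (auto simp: s_def t_def split: if_splits)
    qed
  qed auto
  ultimately show ?thesis by simp
qed

lemma measure_cball_half:
  fixes x :: "real \<times> real"
  assumes r: "0 \<le> r" "r \<le> 1 / 2" and x: "x \<in> square" and nc: "\<not> corner r x"
  shows "pi * r\<^sup>2 / 2 \<le> measure unif_square (cball x r)"
proof -
  have *: "measure lborel A \<le> measure unif_square (cball x r)" if "A = cball x r \<inter> B"
    "\<And>y. y \<in> B \<Longrightarrow> y \<in> {fst x - r..fst x + r} \<times> {snd x - r..snd x + r} \<Longrightarrow> y \<in> square" "A \<in> sets borel" for A B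
    by (rule measure_cball_ge) (use that cball_subset_Times[of x r] in auto)
  consider "fst x \<in> {r..1-r}" "snd x \<le> 1/2" | "fst x \<in> {r..1-r}" "snd x \<ge> 1/2"
    | "snd x \<in> {r..1-r}" "fst x \<le> 1/2" | "snd x \<in> {r..1-r}" "fst x \<ge> 1/2"
    using nc unfolding corner_def by linarith
  then show ?thesis
  proof cases
    case 1
    have "measure lborel (cball x r \<inter> {y. 1 * snd x \<le> 1 * snd y}) \<le> measure unif_square (cball x r)"
      by (rule *[OF refl]) (use 1 x r in \<open>auto simp: mem_Times_iff\<close>)
    then show ?thesis using half_disc(2)[OF r(1), of x "1"] by linarith
  next
    case 2
    have "measure lborel (cball x r \<inter> {y. - 1 * snd x \<le> - 1 * snd y}) \<le> measure unif_square (cball x r)"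
      by (rule *[OF refl]) (use 2 x r in \<open>auto simp: mem_Times_iff\<close>)
    then show ?thesis using half_disc(2)[OF r(1), of x "- 1"] by linarith
  next
    case 3
    have "measure lborel (cball x r \<inter> {y. 1 * fst x \<le> 1 * fst y}) \<le> measure unif_square (cball x r)"
      by (rule *[OF refl]) (use 3 x r in \<open>auto simp: mem_Times_iff\<close>)
    then show ?thesis using half_disc(1)[OF r(1), of x "1"] by linarith
  next
    case 4
    have "measure lborel (cball x r \<inter> {y. - 1 * fst x \<le> - 1 * fst y}) \<le> measure unif_square (cball x r)"
      by (rule *[OF refl]) (use 4 x r in \<open>auto simp: mem_Times_iff\<close>)
    then show ?thesis using half_disc(1)[OF r(1), of x "- 1"] by linarith
  qed
qed

lemma corner_measurable [measurable]: "{x. corner r x} \<in> sets borel"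
  unfolding corner_def by measurable

lemma measure_corner:
  assumes r: "0 \<le> r" "r \<le> 1 / 2"
  shows "measure unif_square {x. corner r x} \<le> 4 * r\<^sup>2"
proof -
  let ?S = "{0..<r} \<union> {1 - r<..1}"
  have m: "measure lborel ?S \<le> 2 * r"
    using measure_Un_le[of "{0..<r}" lborel "{1 - r<..1}"] r by simp
  have "measure unif_square {x. corner r x} = measure lborel (square \<inter> {x. corner r x})"
    by (rule measure_unif_square) measurable
  also have "square \<inter> {x. corner r x} = ?S \<times> ?S"
    using r by (auto simp: corner_def)
  also have "measure lborel (?S \<times> ?S) = measure lborel ?S * measure lborel ?S"
    by (rule measure_lborel_Times) auto
  also have "\<dots> \<le> (2 * r) * (2 * r)"
    using m r by (intro mult_mono) auto
  finally show ?thesis by (simp add: power2_eq_square)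
qed

definition grid1 :: "nat \<Rightarrow> real \<Rightarrow> nat" where
  "grid1 k t = min (k - 1) (nat \<lfloor>real k * t\<rfloor>)"

definition grid :: "nat \<Rightarrow> real \<times> real \<Rightarrow> nat \<times> nat" where
  "grid k x = (grid1 k (fst x), grid1 k (snd x))"

lemma grid1_bounds:
  assumes "0 < k" "t \<in> {0..1}"
  shows "grid1 k t < k" "real (grid1 k t) \<le> real k * t" "real k * t \<le> real (grid1 k t) + 1"
proof -
  show "grid1 k t < k" using assms by (simp add: grid1_def)
  have nn: "0 \<le> real k * t" using assms by simp
  have fl: "real (nat \<lfloor>real k * t\<rfloor>) = of_int \<lfloor>real k * t\<rfloor>" using nn by simp
  show "real (grid1 k t) \<le> real k * t"
    unfolding grid1_def using fl of_int_floor_le[of "real k * t"] by (simp add: min_def) linarith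
  show "real k * t \<le> real (grid1 k t) + 1"
  proof (cases "nat \<lfloor>real k * t\<rfloor> \<le> k - 1")
    case True
    then show ?thesis unfolding grid1_def using fl real_of_int_floor_add_one_gt[of "real k * t"] by simp
  next
    case False
    then have "grid1 k t = k - 1" by (simp add: grid1_def)
    moreover have "real k * t \<le> real k * 1" using assms by (intro mult_left_mono) auto
    ultimately show ?thesis using assms(1) by simp
  qed
qed

lemma grid1_eqI:
  assumes "real i < real k * t" "real k * t < real i + 1" "i < k"
  shows "grid1 k t = i"
proof -
  have "\<lfloor>real k * t\<rfloor> = int i" using assms by (intro floor_unique) auto
  then show ?thesis using assms by (simp add: grid1_def)
qed

lemma grid_mem: "0 < k \<Longrightarrow> grid k x \<in> {..<k} \<times> {..<k}"
  by (auto simp: grid_def grid1_def)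

lemma grid_measurable: "{x. grid k x = c} \<in> sets borel"
proof -
  have [measurable]: "Measurable.pred borel (\<lambda>t. grid1 k t = i)" for i
    unfolding grid1_def by measurable
  have "Measurable.pred borel (\<lambda>x :: real \<times> real. grid1 k (fst x) = fst c \<and> grid1 k (snd x) = snd c)"
    by measurable
  then show ?thesis unfolding grid_def prod_eq_iff by (simp add: pred_def)
qed

lemma grid_measurable_set: "{x. grid k x \<in> F} \<in> sets borel"
proof -
  have "{x. grid k x \<in> F} = (\<Union>c\<in>F. {x. grid k x = c})" by auto
  then show ?thesis using grid_measurable[of k] by (auto intro: sets.countable_UN'')
qed

lemma grid1_measurable: "{t \<in> {0..1}. grid1 k t = i} \<in> sets borel" "{t. 0 \<le> t \<and> t \<le> 1 \<and> grid1 k t = i} \<in> sets borel"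
  unfolding grid1_def by measurable

lemma measure_grid1:
  assumes "0 < k" "i < k"
  shows "measure lborel {t \<in> {0..1}. grid1 k t = i} = 1 / real k"
proof -
  let ?a = "real i / real k" and ?b = "(real i + 1) / real k"
  have meas: "{t \<in> {0..1}. grid1 k t = i} \<in> sets borel"
    unfolding grid1_def by measurable
  have b1: "?b \<le> 1" using assms by (simp add: field_simps)
  have "{t \<in> {0..1}. grid1 k t = i} \<subseteq> {?a..?b}"
  proof
    fix t assume "t \<in> {t \<in> {0..1}. grid1 k t = i}"
    then have "real i \<le> real k * t" "real k * t \<le> real i + 1" using grid1_bounds[OF assms(1), of t] by auto
    then show "t \<in> {?a..?b}" using assms by (auto simp: field_simps)
  qed
  then have "measure lborel {t \<in> {0..1}. grid1 k t = i} \<le> measure lborel {?a..?b}"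
    by (rule measure_mono_fmeasurable)
       (use meas emeasure_lborel_cbox_finite[of ?a ?b] in \<open>auto simp: fmeasurable_def less_top\<close>)
  moreover have "{?a<..<?b} \<subseteq> {t \<in> {0..1}. grid1 k t = i}"
  proof
    fix t assume t: "t \<in> {?a<..<?b}"
    then have "grid1 k t = i" using assms by (intro grid1_eqI) (auto simp: field_simps)
    moreover have "0 \<le> ?a" by simp
    then have "0 \<le> t" "t \<le> 1" using t b1 unfolding greaterThanLessThan_iff by linarith+
    ultimately show "t \<in> {t \<in> {0..1}. grid1 k t = i}" by simp
  qed
  then have "measure lborel {?a<..<?b} \<le> measure lborel {t \<in> {0..1}. grid1 k t = i}"
  proof (rule measure_mono_fmeasurable)
    show "{t \<in> {0..1}. grid1 k t = i} \<in> fmeasurable lborel"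
      by (rule fmeasurableI2[of "{0..1}"]) (use meas in \<open>auto simp: fmeasurable_def\<close>)
  qed auto
  ultimately show ?thesis using assms by (simp add: field_simps)
qed

lemma measure_grid:
  assumes k: "0 < k" and c: "c \<in> {..<k} \<times> {..<k}"
  shows "measure unif_square {x. grid k x = c} = 1 / (real k)\<^sup>2"
proof -
  have eq: "square \<inter> {x. grid k x = c} = {t \<in> {0..1}. grid1 k t = fst c} \<times> {t \<in> {0..1}. grid1 k t = snd c}"
    by (auto simp: grid_def)
  have "measure unif_square {x. grid k x = c} = measure lborel (square \<inter> {x. grid k x = c})"
    by (rule measure_unif_square) (rule grid_measurable)
  also have "\<dots> = 1 / real k * (1 / real k)"
    unfolding eq by (subst measure_lborel_Times) (use c k measure_grid1[OF k] in \<open>auto simp: grid1_measurable\<close>)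
  finally show ?thesis by (simp add: power2_eq_square)
qed

lemma measure_grid_set:
  assumes k: "0 < k" and F: "F \<subseteq> {..<k} \<times> {..<k}"
  shows "measure unif_square {x. grid k x \<in> F} = real (card F) / (real k)\<^sup>2"
proof -
  have fF: "finite F" using F finite_subset by blast
  have "{x. grid k x \<in> F} = (\<Union>c\<in>F. {x. grid k x = c})" by auto
  also have "measure unif_square \<dots> = (\<Sum>c\<in>F. measure unif_square {x. grid k x = c})"
    by (rule unif.finite_measure_finite_Union[OF fF]) (use grid_measurable in \<open>auto simp: disjoint_family_on_def\<close>)
  also have "\<dots> = (\<Sum>c\<in>F. 1 / (real k)\<^sup>2)"
    by (rule sum.cong) (use F measure_grid[OF k] in auto)
  finally show ?thesis by simp
qed

lemma grid_dist:
  assumes k: "0 < k" and xy: "x \<in> square" "y \<in> square" and eq: "grid k x = grid k y"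
    and r: "sqrt 2 / real k \<le> r"
  shows "dist x y \<le> r"
proof -
  have *: "\<bar>s - t\<bar> \<le> 1 / real k" if "s \<in> {0..1}" "t \<in> {0..1}" "grid1 k s = grid1 k t" for s t
  proof -
    have "real k * s - real k * t \<le> 1" "real k * t - real k * s \<le> 1"
      using grid1_bounds[OF k that(1)] grid1_bounds[OF k that(2)] that(3) by linarith+
    then have "real k * \<bar>s - t\<bar> \<le> 1" by (simp add: abs_if algebra_simps)
    then show ?thesis using k by (simp add: field_simps)
  qed
  have "\<bar>fst x - fst y\<bar> \<le> 1 / real k" "\<bar>snd x - snd y\<bar> \<le> 1 / real k"
    using xy eq by (auto simp: grid_def intro!: *)
  then have "(fst x - fst y)\<^sup>2 \<le> (1 / real k)\<^sup>2" "(snd x - snd y)\<^sup>2 \<le> (1 / real k)\<^sup>2"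
    using k by (simp_all add: abs_le_square_iff[symmetric])
  then have "dist x y \<le> sqrt (2 * (1 / real k)\<^sup>2)"
    unfolding dist_prod_def dist_real_def by (auto intro!: real_sqrt_le_mono)
  also have "\<dots> = sqrt 2 / real k" using k by (simp add: real_sqrt_mult)
  finally show ?thesis using r by simp
qed

definition mid_cell :: "nat \<Rightarrow> nat \<times> nat \<Rightarrow> (real \<times> real) set" where
  "mid_cell k c = {(real (fst c) + 1/3) / real k<..<(real (fst c) + 2/3) / real k} \<times>
                  {(real (snd c) + 1/3) / real k<..<(real (snd c) + 2/3) / real k}"

lemma mid_cell_near:
  assumes k: "0 < k" and c: "c \<in> {..<k} \<times> {..<k}" and y: "y \<in> mid_cell k c"
    and d: "dist z y \<le> r" and r: "3 * real k * r \<le> 1"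
  shows "grid k z = c"
proof -
  have *: "grid1 k s = i" if "t \<in> {(real i + 1/3) / real k<..<(real i + 2/3) / real k}" "\<bar>s - t\<bar> \<le> r" "i < k" for s t i
  proof (rule grid1_eqI)
    have t: "real i + 1/3 < real k * t" "real k * t < real i + 2/3"
      using that(1) k by (auto simp: field_simps)
    have "real k * \<bar>s - t\<bar> \<le> real k * r" using that(2) by (intro mult_left_mono) auto
    then have "real k * \<bar>s - t\<bar> \<le> 1/3" using r by simp
    then have "\<bar>real k * s - real k * t\<bar> \<le> 1/3"
      by (simp add: abs_mult[symmetric] right_diff_distrib[symmetric] abs_mult)
    then show "real i < real k * s" "real k * s < real i + 1" using t by linarith+
  qed fact
  have "\<bar>fst z - fst y\<bar> \<le> r" "\<bar>snd z - snd y\<bar> \<le> r"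
    using dist_fst_le[of z y] dist_snd_le[of z y] d by (auto simp: dist_real_def)
  then show ?thesis using y c by (auto simp: mid_cell_def grid_def prod_eq_iff intro!: *)
qed

lemma mid_cell_measurable: "mid_cell k c \<in> sets borel"
  unfolding mid_cell_def by (intro borel_open open_Times) auto

lemma measure_mid_cells:
  assumes k: "0 < k" and F: "F \<subseteq> {..<k} \<times> {..<k}"
  shows "measure unif_square (\<Union>c\<in>F. mid_cell k c) = real (card F) / (9 * (real k)\<^sup>2)"
proof -
  have fF: "finite F" using F finite_subset by blast
  have disj: "disjoint_family_on (mid_cell k) F"
    unfolding disjoint_family_on_def
  proof (intro ballI impI)
    fix c d assume "c \<in> F" "d \<in> F" "c \<noteq> d"
    then show "mid_cell k c \<inter> mid_cell k d = {}"
      using mid_cell_near[OF k, of c _ _ 0] mid_cell_near[OF k, of d _ _ 0] F by fastforce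
  qed
  have "measure unif_square (\<Union>c\<in>F. mid_cell k c) = (\<Sum>c\<in>F. measure unif_square (mid_cell k c))"
    by (rule unif.finite_measure_finite_Union[OF fF]) (use mid_cell_measurable disj in auto)
  also have "\<dots> = (\<Sum>c\<in>F. 1 / (9 * (real k)\<^sup>2))"
  proof (rule sum.cong[OF refl])
    fix c assume "c \<in> F"
    then have c: "fst c < k" "snd c < k" using F by auto
    have sub: "{(real i + 1/3) / real k<..<(real i + 2/3) / real k} \<subseteq> {0..1}" if "i < k" for i
    proof -
      have u: "(real i + 2/3) / real k \<le> 1" using that k by (auto simp: field_simps)
      have l: "0 \<le> (real i + 1/3) / real k" by simp
      show ?thesis
      proof
        fix t assume "t \<in> {(real i + 1/3) / real k<..<(real i + 2/3) / real k}"
        then have "(real i + 1/3) / real k < t" "t < (real i + 2/3) / real k" by simp_all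
        then show "t \<in> {0..1}" using u l unfolding atLeastAtMost_iff by linarith
      qed
    qed
    have m: "measure lborel {(real i + 1/3) / real k<..<(real i + 2/3) / real k} = 1 / (3 * real k)" for i :: nat
      using k by (subst measure_lborel_Ioo) (auto simp: field_simps)
    show "measure unif_square (mid_cell k c) = 1 / (9 * (real k)\<^sup>2)"
      unfolding mid_cell_def
      by (subst measure_unif_square_Times) (use c sub m in \<open>auto simp: power2_eq_square\<close>)
  qed
  finally show ?thesis by simp
qed

section \<open>Rainbow walks\<close>

text \<open>The colours are listed from the last step of the walk to its first step.\<close>

primrec reach ::
  "nat set \<Rightarrow> real \<Rightarrow> (nat \<times> nat \<Rightarrow> real \<times> real) \<Rightarrow> nat \<Rightarrow> nat list \<Rightarrow> nat set" where
  "reach A r b u [] = {u}"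
| "reach A r b u (c # cs) = {w \<in> A. \<exists>x \<in> reach A r b u cs. dist (b (c, x)) (b (c, w)) \<le> r}"

definition rainbow_colours :: "nat \<Rightarrow> nat list set" where
  "rainbow_colours h = {cs. distinct cs \<and> set cs \<subseteq> {1..h}}"

lemma finite_rainbow_colours [simp]: "finite (rainbow_colours h)"
proof -
  have "rainbow_colours h = {xs. set xs \<subseteq> {1..h} \<and> distinct xs}" by (auto simp: rainbow_colours_def)
  then show ?thesis using finite_subset_distinct[of "{1..h}"] by simp
qed

lemma rainbow_colours_length: "cs \<in> rainbow_colours h \<Longrightarrow> length cs \<le> h"
  using card_mono[of "{1..h}" "set cs"] by (auto simp: rainbow_colours_def distinct_card)

abbreviation neighbours ::
  "nat set \<Rightarrow> nat set \<Rightarrow> nat \<Rightarrow> real \<Rightarrow> (nat \<times> nat \<Rightarrow> real \<times> real) \<Rightarrow> nat set" where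
  "neighbours A S c r b \<equiv> {w \<in> A. \<exists>s\<in>S. dist (b (c, s)) (b (c, w)) \<le> r}"

lemma reach_subset: "reach A r b u cs \<subseteq> insert u A"
  by (induction cs) auto

lemma reach_cong:
  assumes "\<And>c x. c \<in> set cs \<Longrightarrow> x \<in> insert u A \<Longrightarrow> b (c, x) = b' (c, x)"
  shows "reach A r b u cs = reach A r b' u cs"
  using assms
proof (induction cs)
  case (Cons c cs)
  then have IH: "reach A r b u cs = reach A r b' u cs" by simp
  have *: "b (c, x) = b' (c, x)" if "x \<in> insert u A" for x using Cons.prems that by simp
  have "reach A r b' u cs \<subseteq> insert u A" by (rule reach_subset)
  then show ?case using * by (auto simp: IH) (metis subsetD insert_iff *)+
qed simp

lemma reach_mono_radius: "r \<le> r' \<Longrightarrow> reach A r b u cs \<subseteq> reach A r' b u cs"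
  by (induction cs) (auto intro: order_trans)

text \<open>Loop erasure: either the new vertex extends the path, or the path is cut at its earlier visit.\<close>

lemma reach_imp_rainbow_path:
  assumes "u < n" "cs \<in> rainbow_colours h" "w \<in> reach {..<n} r b u cs"
  shows "\<exists>vs ds. rainbow_path n h r b vs ds \<and> hd vs = u \<and> last vs = w \<and> set ds \<subseteq> set cs"
  using assms(2,3)
proof (induction cs arbitrary: w)
  case Nil
  then show ?case using assms(1)
    by (intro exI[of _ "[u]"] exI[of _ "[]"]) (auto simp: rainbow_path_def)
next
  case (Cons c cs)
  from Cons.prems(2) obtain x where x: "x \<in> reach {..<n} r b u cs" "dist (b (c, x)) (b (c, w)) \<le> r" "w < n" by auto
  have cs: "cs \<in> rainbow_colours h" "c \<notin> set cs" "c \<in> {1..h}" using Cons.prems(1) by (auto simp: rainbow_colours_def)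
  from Cons.IH[OF cs(1) x(1)] obtain vs ds where
    p: "rainbow_path n h r b vs ds" "hd vs = u" "last vs = x" "set ds \<subseteq> set cs" by blast
  have len: "length vs = length ds + 1" using p(1) by (simp add: rainbow_path_def)
  then have ne: "vs \<noteq> []" by auto
  show ?case
  proof (cases "w \<in> set vs")
    case True
    then obtain j where j: "j < length vs" "vs ! j = w" by (auto simp: in_set_conv_nth)
    have "rainbow_path n h r b (take (Suc j) vs) (take j ds)"
      using p(1) j len unfolding rainbow_path_def
      by (auto dest: in_set_takeD)
    moreover have "hd (take (Suc j) vs) = u" using p(2) ne by simp
    moreover have "last (take (Suc j) vs) = w" using j by (simp add: take_Suc_conv_app_nth)
    moreover have "set (take j ds) \<subseteq> set (c # cs)" using p(4) by (auto dest: in_set_takeD)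
    ultimately show ?thesis by blast
  next
    case False
    have "rainbow_path n h r b (vs @ [w]) (ds @ [c])"
      unfolding rainbow_path_def
    proof (intro conjI allI impI)
      fix i assume i: "i < length (ds @ [c])"
      show "dist (b ((ds @ [c]) ! i, (vs @ [w]) ! i)) (b ((ds @ [c]) ! i, (vs @ [w]) ! Suc i)) \<le> r"
      proof (cases "i < length ds")
        case True
        then show ?thesis using p(1) len by (simp add: rainbow_path_def nth_append)
      next
        case False
        then have "i = length ds" using i by simp
        moreover have "vs ! length ds = x" using p(3) ne len by (simp add: last_conv_nth)
        ultimately show ?thesis using x(2) len by (simp add: nth_append)
      qed
    qed (use p False cs x len in \<open>auto simp: rainbow_path_def\<close>)
    moreover have "hd (vs @ [w]) = u" using p(2) ne by simp
    moreover have "last (vs @ [w]) = w" by simp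
    moreover have "set (ds @ [c]) \<subseteq> set (c # cs)" using p(4) by auto
    ultimately show ?thesis by blast
  qed
qed

lemma rainbow_path_imp_reach:
  assumes "rainbow_path n h r b vs ds"
  shows "last vs \<in> reach {..<n} r b (hd vs) (rev ds)"
  using assms
proof (induction ds arbitrary: vs rule: rev_induct)
  case Nil
  then show ?case by (cases vs) (auto simp: rainbow_path_def)
next
  case (snoc c ds)
  have len: "length vs = length ds + 2" using snoc.prems by (simp add: rainbow_path_def)
  define vs' where "vs' = butlast vs"
  have vs: "vs = vs' @ [last vs]" using len unfolding vs'_def by (metis append_butlast_last_id list.size(3) add_is_0 zero_neq_numeral)
  have len': "length vs' = length ds + 1" using len by (simp add: vs'_def)
  then have ne: "vs' \<noteq> []" by auto
  have p: "rainbow_path n h r b (vs' @ [last vs]) (ds @ [c])" using snoc.prems vs by simp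
  have e: "\<forall>i < length (ds @ [c]). dist (b ((ds @ [c]) ! i, (vs' @ [last vs]) ! i)) (b ((ds @ [c]) ! i, (vs' @ [last vs]) ! Suc i)) \<le> r"
    using p unfolding rainbow_path_def by blast
  have "rainbow_path n h r b vs' ds"
    unfolding rainbow_path_def
  proof (intro conjI allI impI)
    fix i assume "i < length ds"
    then show "dist (b (ds ! i, vs' ! i)) (b (ds ! i, vs' ! Suc i)) \<le> r"
      using e[rule_format, of i] len' by (simp add: nth_append)
  qed (use p len' in \<open>auto simp: rainbow_path_def\<close>)
  then have "last vs' \<in> reach {..<n} r b (hd vs') (rev ds)" by (rule snoc.IH)
  moreover have "dist (b (c, last vs')) (b (c, last vs)) \<le> r"
    using e[rule_format, of "length ds"] len' ne by (simp add: nth_append last_conv_nth)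
  moreover have "last vs < n" using p by (simp add: rainbow_path_def)
  moreover have "hd vs = hd vs'" using ne by (subst vs) simp
  ultimately show ?case by auto
qed

lemma rainbow_connected_iff:
  "rainbow_connected n h r b \<longleftrightarrow>
     (\<forall>u<n. \<forall>v<n. u \<noteq> v \<longrightarrow> (\<exists>cs\<in>rainbow_colours h. v \<in> reach {..<n} r b u cs))"
proof -
  have "(\<exists>vs cs. rainbow_path n h r b vs cs \<and> hd vs = u \<and> last vs = v) \<longleftrightarrow>
        (\<exists>cs\<in>rainbow_colours h. v \<in> reach {..<n} r b u cs)" if "u < n" for u v
  proof
    assume "\<exists>vs cs. rainbow_path n h r b vs cs \<and> hd vs = u \<and> last vs = v"
    then obtain vs cs where p: "rainbow_path n h r b vs cs" "hd vs = u" "last vs = v" by blast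
    then have "rev cs \<in> rainbow_colours h" by (auto simp: rainbow_path_def rainbow_colours_def)
    then show "\<exists>cs\<in>rainbow_colours h. v \<in> reach {..<n} r b u cs"
      using rainbow_path_imp_reach[OF p(1)] p by blast
  next
    assume "\<exists>cs\<in>rainbow_colours h. v \<in> reach {..<n} r b u cs"
    then show "\<exists>vs cs. rainbow_path n h r b vs cs \<and> hd vs = u \<and> last vs = v"
      using reach_imp_rainbow_path[OF that] by blast
  qed
  then show ?thesis unfolding rainbow_connected_def by auto
qed

lemma rainbow_connected_mono: "r \<le> r' \<Longrightarrow> rainbow_connected n h r b \<Longrightarrow> rainbow_connected n h r' b"
  unfolding rainbow_connected_iff using reach_mono_radius by blast

lemma reach_first_exit:
  assumes "y \<in> reach V r b u cs" and "A \<subseteq> V"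
  shows "y \<in> reach A r b u cs \<or>
    (\<exists>w c cs1 cs2. w \<in> V - A \<and> cs = cs2 @ c # cs1 \<and>
       (\<exists>x\<in>reach A r b u cs1. dist (b (c, x)) (b (c, w)) \<le> r) \<and> y \<in> reach V r b w cs2)"
  using assms(1)
proof (induction cs arbitrary: y)
  case (Cons c cs)
  from Cons.prems obtain x where x: "x \<in> reach V r b u cs" "dist (b (c, x)) (b (c, y)) \<le> r" "y \<in> V" by auto
  from Cons.IH[OF x(1)] show ?case
  proof
    assume xA: "x \<in> reach A r b u cs"
    show ?case
    proof (cases "y \<in> A")
      case True
      then show ?thesis using xA x by auto
    next
      case False
      then show ?thesis using xA x
        by (intro disjI2 exI[of _ y] exI[of _ c] exI[of _ cs] exI[of _ "[]"]) auto
    qed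
  next
    assume "\<exists>w c cs1 cs2. w \<in> V - A \<and> cs = cs2 @ c # cs1 \<and>
       (\<exists>x\<in>reach A r b u cs1. dist (b (c, x)) (b (c, w)) \<le> r) \<and> x \<in> reach V r b w cs2"
    then obtain w d cs1 cs2 where w: "w \<in> V - A" "cs = cs2 @ d # cs1"
      "\<exists>x\<in>reach A r b u cs1. dist (b (d, x)) (b (d, w)) \<le> r" "x \<in> reach V r b w cs2" by blast
    then have "y \<in> reach V r b w (c # cs2)" using x by auto
    then show ?case using w
      by (intro disjI2 exI[of _ w] exI[of _ d] exI[of _ cs1] exI[of _ "c # cs2"]) auto
  qed
qed simp

lemma sets_finite_set_valued:
  assumes "finite F" "\<And>w. w \<in> F \<Longrightarrow> {\<omega> \<in> space M. w \<in> R \<omega>} \<in> sets M"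
    and "\<And>\<omega>. \<omega> \<in> space M \<Longrightarrow> R \<omega> \<subseteq> F"
  shows "{\<omega> \<in> space M. P (R \<omega>)} \<in> sets M"
proof -
  have "{\<omega> \<in> space M. P (R \<omega>)} = (\<Union>S\<in>{S \<in> Pow F. P S}. {\<omega> \<in> space M. \<forall>w\<in>F. w \<in> R \<omega> \<longleftrightarrow> w \<in> S})"
  proof (intro equalityI subsetI)
    fix \<omega> assume "\<omega> \<in> {\<omega> \<in> space M. P (R \<omega>)}"
    then show "\<omega> \<in> (\<Union>S\<in>{S \<in> Pow F. P S}. {\<omega> \<in> space M. \<forall>w\<in>F. w \<in> R \<omega> \<longleftrightarrow> w \<in> S})"
      using assms(3)[of \<omega>] by (auto intro!: bexI[of _ "R \<omega>"])
  next
    fix \<omega> assume "\<omega> \<in> (\<Union>S\<in>{S \<in> Pow F. P S}. {\<omega> \<in> space M. \<forall>w\<in>F. w \<in> R \<omega> \<longleftrightarrow> w \<in> S})"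
    then obtain S where S: "S \<subseteq> F" "P S" "\<omega> \<in> space M" "\<forall>w\<in>F. w \<in> R \<omega> \<longleftrightarrow> w \<in> S" by auto
    then have "R \<omega> = S" using assms(3)[of \<omega>] by auto
    then show "\<omega> \<in> {\<omega> \<in> space M. P (R \<omega>)}" using S by simp
  qed
  moreover have "{\<omega> \<in> space M. \<forall>w\<in>F. w \<in> R \<omega> \<longleftrightarrow> w \<in> S} \<in> sets M" for S
  proof (rule sets.sets_Collect_finite_All[OF _ assms(1)])
    fix w assume w: "w \<in> F"
    show "{\<omega> \<in> space M. w \<in> R \<omega> \<longleftrightarrow> w \<in> S} \<in> sets M"
    proof (cases "w \<in> S")
      case True
      then show ?thesis using assms(2)[OF w] by simp
    next
      case False
      then show ?thesis using sets.sets_Collect_neg[OF assms(2)[OF w]] by simp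
    qed
  qed
  ultimately show ?thesis using assms(1) by (auto intro!: sets.finite_UN)
qed

lemma dist_le_sets:
  fixes f g :: "'a \<Rightarrow> real \<times> real"
  assumes "f \<in> borel_measurable M" "g \<in> borel_measurable M"
  shows "{\<omega> \<in> space M. dist (f \<omega>) (g \<omega>) \<le> r} \<in> sets M"
  using assms by measurable

lemma reach_sets:
  assumes "finite A" and X: "\<And>c x. c \<in> set cs \<Longrightarrow> x \<in> insert u A \<Longrightarrow> (\<lambda>\<omega>. X \<omega> (c, x)) \<in> borel_measurable M"
  shows "{\<omega> \<in> space M. w \<in> reach A r (X \<omega>) u cs} \<in> sets M"
  using X
proof (induction cs arbitrary: w)
  case (Cons c cs)
  have "{\<omega> \<in> space M. w \<in> reach A r (X \<omega>) u (c # cs)} =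
    {\<omega> \<in> space M. w \<in> A \<and> (\<exists>x\<in>insert u A. x \<in> reach A r (X \<omega>) u cs \<and> dist (X \<omega> (c, x)) (X \<omega> (c, w)) \<le> r)}"
    using reach_subset by fastforce
  moreover have "\<dots> \<in> sets M"
  proof (cases "w \<in> A")
    case True
    have "{\<omega> \<in> space M. \<exists>x\<in>insert u A. x \<in> reach A r (X \<omega>) u cs \<and> dist (X \<omega> (c, x)) (X \<omega> (c, w)) \<le> r} \<in> sets M"
      using Cons True assms(1)
      by (intro sets.sets_Collect_finite_Ex sets.sets_Collect_conj dist_le_sets) auto
    then show ?thesis using True by simp
  qed simp
  ultimately show ?case by simp
qed simp

abbreviation positions :: "(nat \<times> nat) set \<Rightarrow> (nat \<times> nat \<Rightarrow> real \<times> real) measure" where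
  "positions I \<equiv> PiM I (\<lambda>_. unif_square)"

lemma rgg_space_eq: "rgg_space n h = positions ({1..h} \<times> {..<n})"
  by (simp add: rgg_space_def unif_square_def)

lemma position_measurable: "i \<in> I \<Longrightarrow> (\<lambda>\<omega>. \<omega> i) \<in> borel_measurable (positions I)"
  using measurable_component_singleton[of i I "\<lambda>_. unif_square"] by (simp cong: measurable_cong_sets)

lemma reach_positions_sets:
  assumes "finite A" "set cs \<times> insert u A \<subseteq> I"
  shows "{\<omega> \<in> space (positions I). w \<in> reach A r \<omega> u cs} \<in> sets (positions I)"
  by (rule reach_sets) (use assms in \<open>auto intro!: position_measurable\<close>)

lemma reach_positions_sets_pred:
  assumes "finite A" "set cs \<times> insert u A \<subseteq> I"
  shows "{\<omega> \<in> space (positions I). P (reach A r \<omega> u cs)} \<in> sets (positions I)"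
  by (rule sets_finite_set_valued[of "insert u A"]) (use assms reach_subset reach_positions_sets in auto)

lemma rainbow_connected_sets:
  "{\<omega> \<in> space (rgg_space n h). rainbow_connected n h r \<omega>} \<in> sets (rgg_space n h)"
proof -
  have "{\<omega> \<in> space (rgg_space n h). rainbow_connected n h r \<omega>} =
    {\<omega> \<in> space (rgg_space n h). \<forall>u\<in>{..<n}. \<forall>v\<in>{..<n}. u \<noteq> v \<longrightarrow> (\<exists>cs\<in>rainbow_colours h. v \<in> reach {..<n} r \<omega> u cs)}"
    by (auto simp: rainbow_connected_iff)
  also have "\<dots> \<in> sets (rgg_space n h)"
    unfolding rgg_space_eq
    by (intro sets.sets_Collect_finite_All sets.sets_Collect_imp sets.sets_Collect_finite_Ex
          reach_positions_sets sets.sets_Collect_const finite_rainbow_colours) (auto simp: rainbow_colours_def)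
  finally show ?thesis .
qed

lemma AE_positions_square:
  assumes "finite I"
  shows "AE \<omega> in positions I. \<forall>i\<in>I. \<omega> i \<in> square"
proof (rule AE_finite_allI[OF assms])
  fix i assume "i \<in> I"
  have "AE x in unif_square. x \<in> square"
    by (rule unif.AE_prob_1) (simp add: measure_square)
  then show "AE \<omega> in positions I. \<omega> i \<in> square"
    by (intro AE_PiM_component[OF _ \<open>i \<in> I\<close>]) (use unif.prob_space_axioms in auto)
qed

lemma measure_positions_square:
  assumes "finite I" "{\<omega> \<in> space (positions I). \<phi> \<omega>} \<in> sets (positions I)"
  shows "{\<omega> \<in> space (positions I). (\<forall>i\<in>I. \<omega> i \<in> square) \<and> \<phi> \<omega>} \<in> sets (positions I)"
    "\<P>(\<omega> in positions I. \<phi> \<omega>) =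
     \<P>(\<omega> in positions I. (\<forall>i\<in>I. \<omega> i \<in> square) \<and> \<phi> \<omega>)"
proof -
  have *: "{\<omega> \<in> space (positions I). \<omega> i \<in> square} \<in> sets (positions I)" if "i \<in> I" for i
    using measurable_sets[OF position_measurable[OF that] square_borel] by (simp add: vimage_def Int_def conj_commute)
  show 1: "{\<omega> \<in> space (positions I). (\<forall>i\<in>I. \<omega> i \<in> square) \<and> \<phi> \<omega>} \<in> sets (positions I)"
    using * assms by (intro sets.sets_Collect_conj sets.sets_Collect_finite_All) auto
  show "\<P>(\<omega> in positions I. \<phi> \<omega>) =
     \<P>(\<omega> in positions I. (\<forall>i\<in>I. \<omega> i \<in> square) \<and> \<phi> \<omega>)"
    by (rule measure_eq_AE) (use AE_positions_square[OF assms(1)] assms(2) 1 in auto)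
qed

section \<open>Upper bounds on reached sets\<close>

lemma vimage_position_sets:
  "i \<in> I \<Longrightarrow> B \<in> sets borel \<Longrightarrow> {\<omega> \<in> space (positions I). \<omega> i \<in> B} \<in> sets (positions I)"
  using measurable_sets[OF position_measurable] by (simp add: vimage_def Int_def conj_commute)

lemma measure_positions_dist_le:
  assumes "finite I" "i \<in> I" "0 \<le> r"
  shows "\<P>(\<omega> in positions I. dist p (\<omega> i) \<le> r) \<le> 4 * r\<^sup>2"
  using unif.measure_coords[OF assms(1), of "{i}" "\<lambda>_. cball p r"] measure_cball_le[OF assms(3), of p] assms(2)
  by simp

lemma measure_positions_step:
  assumes I: "finite I" and i: "i \<in> I" and j: "j \<in> I" "j \<noteq> i" and r: "0 \<le> r"
    and dep: "\<And>\<omega> \<omega>'. (\<And>k. k \<noteq> i \<Longrightarrow> \<omega> k = \<omega>' k) \<Longrightarrow> \<psi> \<omega> = \<psi> \<omega>'"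
    and meas: "{\<omega> \<in> space (positions I). \<psi> \<omega>} \<in> sets (positions I)"
              "{\<omega> \<in> space (positions (I - {i})). \<psi> \<omega>} \<in> sets (positions (I - {i}))"
  shows "\<P>(\<omega> in positions I. \<psi> \<omega> \<and> dist (\<omega> j) (\<omega> i) \<le> r)
     \<le> 4 * r\<^sup>2 * \<P>(\<omega> in positions (I - {i}). \<psi> \<omega>)"
proof -
  have un: "(I - {i}) \<union> {i} = I" using i by auto
  have dep': "\<psi> (merge (I - {i}) {i} (x, y)) = \<psi> x" if "x \<in> space (positions (I - {i}))" for x y
  proof -
    have "\<psi> (merge (I - {i}) {i} (x, y)) = \<psi> (x(i := merge (I - {i}) {i} (x, y) i))"
      using that by (intro dep) (auto simp: merge_def space_PiM PiE_def extensional_def)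
    also have "\<dots> = \<psi> x" by (rule dep) auto
    finally show ?thesis .
  qed
  have "\<P>(\<omega> in positions ((I - {i}) \<union> {i}). \<psi> \<omega> \<and> dist (\<omega> j) (\<omega> i) \<le> r)
     \<le> 4 * r\<^sup>2 * \<P>(\<omega> in positions (I - {i}). \<psi> \<omega>)"
  proof (rule unif.measure_merge_le)
    show "{\<omega> \<in> space (positions ((I - {i}) \<union> {i})). \<psi> \<omega> \<and> dist (\<omega> j) (\<omega> i) \<le> r} \<in> sets (positions ((I - {i}) \<union> {i}))"
      unfolding un using i j by (intro sets.sets_Collect_conj meas dist_le_sets position_measurable)
    show "\<psi> x" if "x \<in> space (positions (I - {i}))" "\<psi> (merge (I - {i}) {i} (x, y)) \<and> dist (merge (I - {i}) {i} (x, y) j) (merge (I - {i}) {i} (x, y) i) \<le> r" for x y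
      using that dep' by blast
    show "\<P>(y in positions {i}. \<psi> (merge (I - {i}) {i} (x, y)) \<and> dist (merge (I - {i}) {i} (x, y) j) (merge (I - {i}) {i} (x, y) i) \<le> r) \<le> 4 * r\<^sup>2"
      if "x \<in> space (positions (I - {i}))" "\<psi> x" for x
    proof -
      have "{y \<in> space (positions {i}). \<psi> (merge (I - {i}) {i} (x, y)) \<and> dist (merge (I - {i}) {i} (x, y) j) (merge (I - {i}) {i} (x, y) i) \<le> r}
        = {y \<in> space (positions {i}). dist (x j) (y i) \<le> r}"
        using that dep' j by (auto simp: merge_def)
      then show ?thesis using measure_positions_dist_le[of "{i}" i r "x j"] r by simp
    qed
  qed (use I meas in auto)
  then show ?thesis unfolding un .
qed

lemma measure_reach_le:
  assumes fin: "finite I" and sub: "set cs \<times> {..<n} \<subseteq> I" and cs: "distinct cs"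
    and wv: "w < n" "v < n" "w \<noteq> v" and r: "0 \<le> r"
  shows "\<P>(\<omega> in positions I. v \<in> reach {..<n} r \<omega> w cs)
           \<le> (if cs = [] then 0 else 4 * r\<^sup>2 * (2 + 4 * (real n * r\<^sup>2)) ^ (length cs - 1))"
  using fin sub cs wv
proof (induction cs arbitrary: I v)
  case Nil
  then show ?case by simp
next
  case (Cons c cs)
  define f where "f = (if cs = [] then 0 else 4 * r\<^sup>2 * (2 + 4 * (real n * r\<^sup>2)) ^ (length cs - 1))"
  have f0: "0 \<le> f" using r by (simp add: f_def)
  interpret I: prob_space "positions I" by (rule unif.prob_space_power)
  have ccs: "c \<notin> set cs" "distinct cs" and subI: "set cs \<times> {..<n} \<subseteq> I" "{c} \<times> {..<n} \<subseteq> I"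
    using Cons.prems by auto
  have m1: "{\<omega> \<in> space (positions I'). y \<in> reach {..<n} r \<omega> w cs} \<in> sets (positions I')" if "set cs \<times> {..<n} \<subseteq> I'" for I' y
    by (rule reach_positions_sets) (use that Cons.prems in auto)
  let ?R = "\<lambda>y. {\<omega> \<in> space (positions I). y \<in> reach {..<n} r \<omega> w cs}"
  let ?D = "\<lambda>y. {\<omega> \<in> space (positions I). dist (\<omega> (c, y)) (\<omega> (c, v)) \<le> r}"
  let ?B = "\<lambda>y. {\<omega> \<in> space (positions I). y \<in> reach {..<n} r \<omega> w cs \<and> dist (\<omega> (c, y)) (\<omega> (c, v)) \<le> r}"
  have mD: "?D y \<in> sets (positions I)" if "y < n" for y
    using subI that Cons.prems by (intro dist_le_sets position_measurable) auto
  have mB: "?B y \<in> sets (positions I)" if "y < n" for y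
    using mD[OF that] m1[OF subI(1)] by (intro sets.sets_Collect_conj) auto
  have "{\<omega> \<in> space (positions I). v \<in> reach {..<n} r \<omega> w (c # cs)}
    \<subseteq> ?R v \<union> (?D w \<union> (\<Union>y\<in>{..<n} - {v, w}. ?B y))"
  proof
    fix \<omega> assume "\<omega> \<in> {\<omega> \<in> space (positions I). v \<in> reach {..<n} r \<omega> w (c # cs)}"
    then obtain y where y: "\<omega> \<in> space (positions I)" "y \<in> reach {..<n} r \<omega> w cs" "dist (\<omega> (c, y)) (\<omega> (c, v)) \<le> r" by auto
    moreover have "y < n" using reach_subset[of "{..<n}" r \<omega> w cs] y(2) Cons.prems by auto
    ultimately show "\<omega> \<in> ?R v \<union> (?D w \<union> (\<Union>y\<in>{..<n} - {v, w}. ?B y))" by blast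
  qed
  then have "\<P>(\<omega> in positions I. v \<in> reach {..<n} r \<omega> w (c # cs))
     \<le> I.prob (?R v \<union> (?D w \<union> (\<Union>y\<in>{..<n} - {v, w}. ?B y)))"
    using m1[OF subI(1)] mD mB Cons.prems by (intro I.finite_measure_mono sets.Un sets.finite_UN) auto
  also have "\<dots> \<le> I.prob (?R v) + (I.prob (?D w) + I.prob (\<Union>y\<in>{..<n} - {v, w}. ?B y))"
    using m1[OF subI(1)] mD mB Cons.prems
    by (intro order_trans[OF measure_Un_le] add_left_mono sets.Un sets.finite_UN) auto
  also have "I.prob (?R v) \<le> f"
    unfolding f_def using Cons.prems subI ccs by (intro Cons.IH) auto
  also have "I.prob (?D w) \<le> 4 * r\<^sup>2"
    using measure_positions_step[of I "(c, v)" "(c, w)" r "\<lambda>_. True"] Cons.prems r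
      unif.prob_space_power[of "I - {(c, v)}"] by (auto simp: prob_space.prob_space)
  also have "I.prob (\<Union>y\<in>{..<n} - {v, w}. ?B y) \<le> (\<Sum>y\<in>{..<n} - {v, w}. I.prob (?B y))"
    by (rule I.finite_measure_subadditive_finite) (use mB in auto)
  also have "\<dots> \<le> (\<Sum>y\<in>{..<n} - {v, w}. 4 * r\<^sup>2 * f)"
  proof (rule sum_mono)
    fix y assume y: "y \<in> {..<n} - {v, w}"
    have "I.prob (?B y) \<le> 4 * r\<^sup>2 * \<P>(\<omega> in positions (I - {(c, v)}). y \<in> reach {..<n} r \<omega> w cs)"
    proof (rule measure_positions_step)
      show "(y \<in> reach {..<n} r \<omega> w cs) = (y \<in> reach {..<n} r \<omega>' w cs)" if "\<And>k. k \<noteq> (c, v) \<Longrightarrow> \<omega> k = \<omega>' k" for \<omega> \<omega>'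
      proof -
        have "reach {..<n} r \<omega> w cs = reach {..<n} r \<omega>' w cs"
          by (rule reach_cong, rule that) (use ccs in auto)
        then show ?thesis by simp
      qed
    qed (use Cons.prems y r subI ccs in \<open>auto intro!: m1\<close>)
    also have "\<dots> \<le> 4 * r\<^sup>2 * f"
      unfolding f_def using Cons.prems y ccs subI r by (intro mult_left_mono Cons.IH) auto
    finally show "I.prob (?B y) \<le> 4 * r\<^sup>2 * f" .
  qed
  also have "\<dots> \<le> real n * (4 * r\<^sup>2 * f)"
    using f0 r card_mono[of "{..<n}" "{..<n} - {v, w}"] by (simp add: mult_right_mono)
  finally have "\<P>(\<omega> in positions I. v \<in> reach {..<n} r \<omega> w (c # cs))
     \<le> f + (4 * r\<^sup>2 + real n * (4 * r\<^sup>2 * f))" by simp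
  also have "\<dots> \<le> 4 * r\<^sup>2 * (2 + 4 * (real n * r\<^sup>2)) ^ length cs"
  proof (cases "cs = []")
    case True
    then show ?thesis by (simp add: f_def)
  next
    case False
    then obtain l where l: "length cs = Suc l" by (cases cs) auto
    let ?z = "2 + 4 * (real n * r\<^sup>2)"
    have "1 \<le> ?z ^ l" by (rule one_le_power) simp
    then have "4 * r\<^sup>2 * 1 \<le> 4 * r\<^sup>2 * ?z ^ l" by (intro mult_left_mono) auto
    moreover have "f = 4 * r\<^sup>2 * ?z ^ l" using False l by (simp add: f_def)
    ultimately show ?thesis unfolding l by (simp add: algebra_simps)
  qed
  finally show ?case by simp
qed

lemma card_pair_index:
  "card {i \<in> {c} \<times> T. P i} = card {w \<in> T. P (c, w)}"
proof -
  have "{i \<in> {c} \<times> T. P i} = Pair c ` {w \<in> T. P (c, w)}" by auto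
  then show ?thesis by (simp add: card_image inj_on_def)
qed

lemma near_set_sets:
  assumes "finite A" "finite S" "{c} \<times> (A \<union> S) \<subseteq> I"
  shows "{y \<in> space (positions I). P (neighbours A S c r y)} \<in> sets (positions I)"
proof (rule sets_finite_set_valued[OF assms(1)])
  fix w assume w: "w \<in> A"
  have "{\<omega> \<in> space (positions I). \<exists>s\<in>S. dist (\<omega> (c, s)) (\<omega> (c, w)) \<le> r} \<in> sets (positions I)"
    using assms w by (intro sets.sets_Collect_finite_Ex dist_le_sets position_measurable) auto
  then show "{\<omega> \<in> space (positions I). w \<in> neighbours A S c r \<omega>} \<in> sets (positions I)"
    using w by simp
qed auto

lemma near_count_upper:
  assumes V: "finite V" "S \<subseteq> V" "A \<subseteq> V" and M: "real (card S) \<le> M" and r: "0 \<le> r"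
    and x: "1 \<le> real (card V) * r\<^sup>2" and M1: "1 \<le> M"
  shows "\<P>(y in positions ({c} \<times> V).
      13 * (real (card V) * r\<^sup>2) * M < real (card (neighbours A S c r y)))
    \<le> exp (- (4 * (real (card V) * r\<^sup>2)))"
proof -
  let ?x = "real (card V) * r\<^sup>2"
  let ?J = "{c} \<times> S" and ?K = "{c} \<times> (V - S)"
  let ?N = "\<lambda>y. neighbours A S c r y"
  have un: "?J \<union> ?K = {c} \<times> V" using V by auto
  have fS: "finite S" "finite A" using V finite_subset by blast+
  have "\<P>(y in positions (?J \<union> ?K). 13 * ?x * M < real (card (?N y)))
    \<le> exp (- (4 * ?x)) * \<P>(y in positions ?J. True)"
  proof (rule unif.measure_merge_le)
    show "{y \<in> space (positions (?J \<union> ?K)). 13 * ?x * M < real (card (?N y))} \<in> sets (positions (?J \<union> ?K))"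
      unfolding un by (rule near_set_sets) (use V fS in auto)
    show "\<P>(y in positions ?K. 13 * ?x * M < real (card (?N (merge ?J ?K (x, y)))))
       \<le> exp (- (4 * ?x))" for x
    proof -
      interpret K: prob_space "positions ?K" by (rule unif.prob_space_power)
      let ?B = "\<Union>s\<in>S. cball (x (c, s)) r"
      let ?T = "{c} \<times> (A - S)"
      have Bm: "?B \<in> sets borel" using fS by (intro sets.finite_UN) auto
      have fK: "finite ?K" using V by auto
      have TK: "?T \<subseteq> ?K" using V by auto
      have "{y \<in> space (positions ?K). 13 * ?x * M < real (card (?N (merge ?J ?K (x, y))))}
         \<subseteq> {y \<in> space (positions ?K). 12 * ?x * M \<le> real (card {i \<in> ?T. y i \<in> ?B})}"
      proof (intro subsetI CollectI conjI; elim CollectE conjE)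
        fix y assume y: "13 * ?x * M < real (card (?N (merge ?J ?K (x, y))))"
        have "?N (merge ?J ?K (x, y)) \<subseteq> S \<union> {w \<in> A - S. y (c, w) \<in> ?B}"
          using V by (auto simp: merge_def)
        then have "card (?N (merge ?J ?K (x, y))) \<le> card (S \<union> {w \<in> A - S. y (c, w) \<in> ?B})"
          using fS by (intro card_mono) auto
        also have "\<dots> \<le> card S + card {w \<in> A - S. y (c, w) \<in> ?B}" by (rule card_Un_le)
        finally have "13 * ?x * M < M + real (card {w \<in> A - S. y (c, w) \<in> ?B})" using y M by linarith
        moreover have "1 * M \<le> ?x * M" using x M1 by (intro mult_right_mono) auto
        ultimately show "12 * ?x * M \<le> real (card {i \<in> ?T. y i \<in> ?B})"
          unfolding card_pair_index by (simp add: algebra_simps)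
      qed auto
      moreover have "{y \<in> space (positions ?K). 12 * ?x * M \<le> real (card {i \<in> ?T. y i \<in> ?B})} \<in> sets (positions ?K)"
      proof -
        have [measurable]: "(\<lambda>y. real (card {i \<in> ?T. y i \<in> ?B})) \<in> borel_measurable (positions ?K)"
          by (rule unif.count_measurable) (use fS TK Bm in simp_all)
        show ?thesis by measurable
      qed
      ultimately have "\<P>(y in positions ?K. 13 * ?x * M < real (card (?N (merge ?J ?K (x, y)))))
        \<le> \<P>(y in positions ?K. 12 * ?x * M \<le> real (card {i \<in> ?T. y i \<in> ?B}))"
        by (intro K.finite_measure_mono)
      also have "\<dots> \<le> exp (- (1 * (12 * ?x * M))) * exp (real (card ?T) * (4 * r\<^sup>2 * M) * (exp 1 - 1))"
      proof (rule unif.chernoff_upper[OF fK TK])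
        have "measure unif_square ?B \<le> (\<Sum>s\<in>S. measure unif_square (cball (x (c, s)) r))"
          using fS by (intro unif.finite_measure_subadditive_finite) auto
        also have "\<dots> \<le> (\<Sum>s\<in>S. 4 * r\<^sup>2)" by (intro sum_mono measure_cball_le r)
        also have "\<dots> = real (card S) * (4 * r\<^sup>2)" by simp
        also have "\<dots> \<le> M * (4 * r\<^sup>2)" using M by (intro mult_right_mono) auto
        finally show "measure unif_square ?B \<le> 4 * r\<^sup>2 * M" by (simp add: mult.commute)
      qed (use Bm in auto)
      also have "\<dots> = exp (real (card ?T) * (4 * r\<^sup>2 * M) * (exp 1 - 1) - 12 * ?x * M)"
        by (simp add: mult_exp_exp)
      also have "\<dots> \<le> exp (- (4 * ?x))"
      proof -
        have "card ?T \<le> card V" using V fS by (auto simp: card_cartesian_product intro: card_mono)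
        then have "real (card ?T) * (4 * r\<^sup>2 * M) * (exp 1 - 1) \<le> real (card V) * (4 * r\<^sup>2 * M) * 2"
          using exp_le M1 by (intro mult_mono) auto
        moreover have "?x * 1 \<le> ?x * M" using M1 by (intro mult_left_mono) auto
        ultimately show ?thesis by (simp add: algebra_simps)
      qed
      finally show ?thesis .
    qed
  qed (use V fS in auto)
  also have "\<P>(y in positions ?J. True) = 1"
    using prob_space.prob_space[OF unif.prob_space_power[of ?J]] by simp
  finally show ?thesis unfolding un by simp
qed

lemma measure_reach_step_le:
  assumes I: "finite I" and V: "{c} \<times> V \<subseteq> I" "finite V" and A: "A \<subseteq> V" "u \<in> V"
    and cs: "set cs \<times> V \<subseteq> I" "c \<notin> set cs" and q: "0 \<le> q"
    and E: "\<And>S. S \<subseteq> insert u A \<Longrightarrow> P S \<Longrightarrow>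
       \<P>(y in positions ({c} \<times> V). Q (neighbours A S c r y)) \<le> q"
  shows "\<P>(\<omega> in positions I. P (reach A r \<omega> u cs) \<and> Q (reach A r \<omega> u (c # cs))) \<le> q"
proof -
  let ?K = "{c} \<times> V"
  let ?J = "I - ?K"
  have un: "?J \<union> ?K = I" using V by auto
  have fA: "finite A" using A V finite_subset by blast
  have csJ: "set cs \<times> insert u A \<subseteq> ?J" using cs A by auto
  have eq: "reach A r (merge ?J ?K (x, y)) u cs = reach A r x u cs" for x y
    by (rule reach_cong) (use csJ in \<open>auto simp: merge_def\<close>)
  have eq': "reach A r (merge ?J ?K (x, y)) u (c # cs) = neighbours A (reach A r x u cs) c r y" for x y
  proof -
    have "merge ?J ?K (x, y) (c, s) = y (c, s)" if "s \<in> insert u A" for s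
      using that A by (auto simp: merge_def)
    then show ?thesis using reach_subset[of A r x u cs] by (auto simp: eq subset_eq)
  qed
  have "\<P>(\<omega> in positions (?J \<union> ?K). P (reach A r \<omega> u cs) \<and> Q (reach A r \<omega> u (c # cs)))
    \<le> q * \<P>(x in positions ?J. P (reach A r x u cs))"
  proof (rule unif.measure_merge_le)
    show "{\<omega> \<in> space (positions (?J \<union> ?K)). P (reach A r \<omega> u cs) \<and> Q (reach A r \<omega> u (c # cs))} \<in> sets (positions (?J \<union> ?K))"
      unfolding un using fA A V cs by (intro sets.sets_Collect_conj reach_positions_sets_pred) auto
    show "{x \<in> space (positions ?J). P (reach A r x u cs)} \<in> sets (positions ?J)"
      by (rule reach_positions_sets_pred[OF fA csJ])
    show "P (reach A r x u cs)" if "P (reach A r (merge ?J ?K (x, y)) u cs) \<and> Q (reach A r (merge ?J ?K (x, y)) u (c # cs))" for x y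
      using that unfolding eq by simp
    show "\<P>(y in positions ?K. P (reach A r (merge ?J ?K (x, y)) u cs) \<and> Q (reach A r (merge ?J ?K (x, y)) u (c # cs))) \<le> q"
      if "P (reach A r x u cs)" for x
      unfolding eq eq' using E[OF reach_subset that] that by simp
  qed (use I V q in auto)
  also have "\<dots> \<le> q * 1"
    using q prob_space.prob_le_1[OF unif.prob_space_power[of ?J]] by (intro mult_left_mono) auto
  finally show ?thesis unfolding un by simp
qed

lemma measure_reach_card_le:
  assumes I: "finite I" "set cs \<times> V \<subseteq> I" and V: "finite V" and A: "A \<subseteq> V" "u \<in> V"
    and cs: "distinct cs" and r: "0 \<le> r" and x: "1 \<le> real (card V) * r\<^sup>2"
  shows "\<P>(\<omega> in positions I.
        (13 * (real (card V) * r\<^sup>2)) ^ length cs < real (card (reach A r \<omega> u cs)))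
      \<le> real (length cs) * exp (- (4 * (real (card V) * r\<^sup>2)))"
  using I cs
proof (induction cs)
  case Nil
  then show ?case by simp
next
  case (Cons c cs)
  interpret I: prob_space "positions I" by (rule unif.prob_space_power)
  let ?x = "real (card V) * r\<^sup>2"
  let ?M = "(13 * ?x) ^ length cs"
  have fA: "finite A" using A V finite_subset by blast
  have M1: "1 \<le> ?M" by (rule one_le_power) (use x in simp)
  let ?E1 = "{\<omega> \<in> space (positions I). ?M < real (card (reach A r \<omega> u cs))}"
  let ?E2 = "{\<omega> \<in> space (positions I). real (card (reach A r \<omega> u cs)) \<le> ?M \<and> 13 * ?x * ?M < real (card (reach A r \<omega> u (c # cs)))}"
  have m: "?E1 \<in> sets (positions I)" "?E2 \<in> sets (positions I)"
    using fA A Cons.prems by (auto intro!: sets.sets_Collect_conj reach_positions_sets_pred simp del: reach.simps)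
  have "I.prob {\<omega> \<in> space (positions I). (13 * ?x) ^ length (c # cs) < real (card (reach A r \<omega> u (c # cs)))} \<le> I.prob (?E1 \<union> ?E2)"
  proof (rule I.finite_measure_mono)
    have pow: "(13 * ?x) ^ length (c # cs) = 13 * ?x * ?M" by simp
    show "{\<omega> \<in> space (positions I). (13 * ?x) ^ length (c # cs) < real (card (reach A r \<omega> u (c # cs)))} \<subseteq> ?E1 \<union> ?E2"
      unfolding pow using not_less by blast
  qed (intro sets.Un m)
  also have "\<dots> \<le> I.prob ?E1 + I.prob ?E2"
    by (rule measure_Un_le) (fact m)+
  also have "I.prob ?E1 \<le> real (length cs) * exp (- (4 * ?x))"
    by (rule Cons.IH) (use Cons.prems in auto)
  also have "I.prob ?E2 \<le> exp (- (4 * ?x))"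
  proof (rule measure_reach_step_le[where V = V])
    show "\<P>(y in positions ({c} \<times> V). 13 * ?x * ?M < real (card (neighbours A S c r y))) \<le> exp (- (4 * ?x))"
      if "S \<subseteq> insert u A" "real (card S) \<le> ?M" for S
    proof -
      have "S \<subseteq> V" using that(1) A by auto
      then show ?thesis using V A(1) that(2) r x M1 by (intro near_count_upper)
    qed
  qed (use Cons.prems V A in auto)
  finally show ?case by (simp add: algebra_simps)
qed

section \<open>Holes and unreached vertices\<close>

definition holes :: "nat \<Rightarrow> nat \<Rightarrow> nat set \<Rightarrow> (nat \<times> nat \<Rightarrow> real \<times> real) \<Rightarrow> (nat \<times> nat) set" where
  "holes k c S b = {j \<in> {..<k} \<times> {..<k}. \<forall>s\<in>S. grid k (b (c, s)) \<noteq> j}"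

lemma finite_holes [simp]: "finite (holes k c S b)"
  by (auto simp: holes_def intro: finite_subset[of _ "{..<k} \<times> {..<k}"])

lemma hole_sets:
  assumes "finite V" "{c} \<times> V \<subseteq> I" and N: "\<And>s. s \<in> V \<Longrightarrow> {\<omega> \<in> space (positions I). s \<in> N \<omega>} \<in> sets (positions I)"
    and NV: "\<And>\<omega>. N \<omega> \<subseteq> V"
  shows "{\<omega> \<in> space (positions I). j \<in> holes k c (N \<omega>) \<omega>} \<in> sets (positions I)"
proof (cases "j \<in> {..<k} \<times> {..<k}")
  case True
  have "{\<omega> \<in> space (positions I). \<forall>s\<in>V. s \<in> N \<omega> \<longrightarrow> \<omega> (c, s) \<in> - {x. grid k x = j}} \<in> sets (positions I)"
    using assms by (intro sets.sets_Collect_finite_All sets.sets_Collect_imp N vimage_position_sets)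
      (auto intro: borel_comp grid_measurable)
  moreover have "{\<omega> \<in> space (positions I). j \<in> holes k c (N \<omega>) \<omega>} =
     {\<omega> \<in> space (positions I). \<forall>s\<in>V. s \<in> N \<omega> \<longrightarrow> \<omega> (c, s) \<in> - {x. grid k x = j}}"
    using NV True by (auto simp: holes_def)
  ultimately show ?thesis by simp
next
  case False
  then have empty: "{\<omega> \<in> space (positions I). j \<in> holes k c (N \<omega>) \<omega>} = {}" by (auto simp: holes_def)
  show ?thesis unfolding empty by simp
qed

text \<open>Chebyshev: distinct cells are empty with nonpositive correlation, so the variance of the
  number of holes is at most its mean.\<close>

lemma measure_few_holes_le:
  assumes I: "finite I" "{c} \<times> S \<subseteq> I" and M: "card S \<le> M" and k: "2 \<le> k"
    and mu: "\<mu> = (real k)\<^sup>2 * (1 - 1 / (real k)\<^sup>2) ^ M"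
  shows "\<P>(y in positions I. real (card (holes k c S y)) < \<mu> / 2) \<le> 4 / \<mu>"
proof -
  interpret P: prob_space "positions I" by (rule unif.prob_space_power)
  let ?G = "{..<k} \<times> {..<k}"
  define K where "K = (real k)\<^sup>2"
  define m where "m = card S"
  define p where "p = (1 - 1 / K) ^ m"
  have fS: "finite S" using finite_cartesian_productD2[OF finite_subset[OF I(2) I(1)]] by simp
  have K4: "4 \<le> K"
    using power_mono[of 2 "real k" 2] k by (simp add: K_def)
  have cardG: "real (card ?G) = K" by (simp add: K_def power2_eq_square)
  have p0: "0 < p" unfolding p_def using K4 by (intro zero_less_power) (simp add: field_simps)
  define H where "H j = {y \<in> space (positions I). \<forall>s\<in>S. grid k (y (c, s)) \<noteq> j}" for j
  have avoid: "P.prob {y \<in> space (positions I). \<forall>s\<in>S. grid k (y (c, s)) \<notin> F} = (1 - real (card F) / K) ^ m"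
    "{y \<in> space (positions I). \<forall>s\<in>S. grid k (y (c, s)) \<notin> F} \<in> P.events" if F: "F \<subseteq> ?G" for F
  proof -
    let ?A = "{x. grid k x \<in> ?G - F}"
    have G: "grid k x \<in> ?G" for x using grid_mem[of k x] k by simp
    have eq: "{y \<in> space (positions I). \<forall>s\<in>S. grid k (y (c, s)) \<notin> F} = {y \<in> space (positions I). \<forall>i\<in>{c} \<times> S. y i \<in> ?A}"
      using G by auto
    have "P.prob {y \<in> space (positions I). \<forall>i\<in>{c} \<times> S. y i \<in> ?A} = (\<Prod>i\<in>{c} \<times> S. measure unif_square ?A)"
      by (rule unif.measure_coords[OF I]) (use grid_measurable_set[of k "?G - F"] in simp)
    also have "measure unif_square ?A = real (card (?G - F)) / K"
      unfolding K_def by (rule measure_grid_set) (use k in auto)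
    also have "real (card (?G - F)) = K - real (card F)"
      using F finite_subset[OF F] card_mono[OF _ F] cardG by (subst card_Diff_subset) (auto simp: of_nat_diff)
    finally show "P.prob {y \<in> space (positions I). \<forall>s\<in>S. grid k (y (c, s)) \<notin> F} = (1 - real (card F) / K) ^ m"
      using K4 unfolding eq by (simp add: m_def card_cartesian_product diff_divide_distrib)
    show "{y \<in> space (positions I). \<forall>s\<in>S. grid k (y (c, s)) \<notin> F} \<in> P.events"
      unfolding eq using I finite_subset[OF I(2) I(1)] grid_measurable_set[of k "?G - F"]
      by (intro sets.sets_Collect_finite_All vimage_position_sets) auto
  qed
  have Hm: "H j \<in> P.events" and Hp: "P.prob (H j) = p" if "j \<in> ?G" for j
    using avoid[of "{j}"] that by (auto simp: H_def p_def)
  have Hij: "P.prob (H i \<inter> H j) \<le> p * p" if "i \<in> ?G" "j \<in> ?G" "i \<noteq> j" for i j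
  proof -
    have "H i \<inter> H j = {y \<in> space (positions I). \<forall>s\<in>S. grid k (y (c, s)) \<notin> {i, j}}"
      by (auto simp: H_def)
    then have "P.prob (H i \<inter> H j) = (1 - 2 / K) ^ m" using avoid(1)[of "{i, j}"] that by simp
    also have "\<dots> \<le> ((1 - 1 / K) * (1 - 1 / K)) ^ m"
      using K4 by (intro power_mono) (simp_all add: field_simps)
    finally show ?thesis by (simp add: p_def power_mult_distrib)
  qed
  define X where "X y = (\<Sum>j\<in>?G. indicator (H j) y :: real)" for y
  have X: "real (card (holes k c S y)) = X y" if "y \<in> space (positions I)" for y
    using that by (simp add: X_def holes_def H_def indicator_def sum.If_cases Int_def)
  have [measurable]: "X \<in> borel_measurable (positions I)"
    unfolding X_def using Hm by (intro borel_measurable_sum) auto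
  have Eind: "P.expectation (indicator B) = P.prob B" "integrable (positions I) (indicator B :: _ \<Rightarrow> real)"
    if "B \<in> P.events" for B
    using that sets.sets_into_space[OF that] by (simp_all add: P.emeasure_eq_measure Int_absorb2)
  have EX: "P.expectation X = K * p"
  proof -
    have "P.expectation X = (\<Sum>j\<in>?G. P.expectation (indicator (H j)))"
      unfolding X_def by (intro Bochner_Integration.integral_sum Eind Hm)
    also have "\<dots> = (\<Sum>j\<in>?G. p)"
      by (rule sum.cong[OF refl]) (simp only: Eind Hm Hp)
    finally show ?thesis using cardG by simp
  qed
  have Hijm: "H i \<inter> H j \<in> P.events" if "i \<in> ?G" "j \<in> ?G" for i j
    using Hm[OF that(1)] Hm[OF that(2)] by (rule sets.Int)
  have XX: "(X y)\<^sup>2 = (\<Sum>i\<in>?G. \<Sum>j\<in>?G. indicator (H i \<inter> H j) y)" for y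
    unfolding X_def power2_eq_square sum_product by (simp only: indicator_inter_arith)
  have intXX: "integrable (positions I) (\<lambda>y. (X y)\<^sup>2)"
    unfolding XX by (intro Bochner_Integration.integrable_sum Eind Hijm)
  have intX: "integrable (positions I) X"
    unfolding X_def by (intro Bochner_Integration.integrable_sum Eind Hm)
  have EXX: "P.expectation (\<lambda>y. (X y)\<^sup>2) \<le> K * p + (K * p)\<^sup>2"
  proof -
    have "P.expectation (\<lambda>y. (X y)\<^sup>2) = (\<Sum>i\<in>?G. P.expectation (\<lambda>y. \<Sum>j\<in>?G. indicator (H i \<inter> H j) y))"
      unfolding XX by (intro Bochner_Integration.integral_sum Bochner_Integration.integrable_sum Eind Hijm)
    also have "\<dots> = (\<Sum>i\<in>?G. \<Sum>j\<in>?G. P.prob (H i \<inter> H j))"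
    proof (rule sum.cong[OF refl])
      fix i assume i: "i \<in> ?G"
      have "P.expectation (\<lambda>y. \<Sum>j\<in>?G. indicator (H i \<inter> H j) y :: real) = (\<Sum>j\<in>?G. P.expectation (indicator (H i \<inter> H j)))"
        by (rule Bochner_Integration.integral_sum) (rule Eind(2), rule Hijm[OF i])
      also have "\<dots> = (\<Sum>j\<in>?G. P.prob (H i \<inter> H j))"
        by (rule sum.cong[OF refl]) (simp only: Eind Hijm i)
      finally show "P.expectation (\<lambda>y. \<Sum>j\<in>?G. indicator (H i \<inter> H j) y) = (\<Sum>j\<in>?G. P.prob (H i \<inter> H j))" .
    qed
    also have "\<dots> \<le> (\<Sum>i\<in>?G. \<Sum>j\<in>?G. (if i = j then p else 0) + p * p)"
    proof (intro sum_mono)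
      fix i j assume ij: "i \<in> ?G" "j \<in> ?G"
      show "P.prob (H i \<inter> H j) \<le> (if i = j then p else 0) + p * p"
        using Hij[OF ij] Hp[OF ij(1)] p0 by (cases "i = j") simp_all
    qed
    also have "\<dots> = K * p + K * (K * (p * p))"
      using cardG by (simp add: sum.distrib) (simp add: algebra_simps)
    finally show ?thesis by (simp add: power2_eq_square algebra_simps)
  qed
  have var: "P.variance X \<le> K * p"
    using P.variance_eq[OF intX intXX] EX EXX by simp
  have mp: "0 < \<mu>" "\<mu> \<le> K * p"
  proof -
    have "(1 - 1 / K) ^ M \<le> p" unfolding p_def using K4 M by (intro power_decreasing) (auto simp: m_def field_simps)
    then show "\<mu> \<le> K * p" unfolding mu K_def[symmetric] using K4 by (intro mult_left_mono) auto
    show "0 < \<mu>" unfolding mu K_def[symmetric] using K4 by (intro mult_pos_pos zero_less_power) (auto simp: field_simps)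
  qed
  have "P.prob {y \<in> space (positions I). real (card (holes k c S y)) < \<mu> / 2}
     \<le> P.prob {y \<in> space (positions I). K * p / 2 \<le> \<bar>X y - P.expectation X\<bar>}"
  proof (rule P.finite_measure_mono)
    show "{y \<in> space (positions I). real (card (holes k c S y)) < \<mu> / 2} \<subseteq> {y \<in> space (positions I). K * p / 2 \<le> \<bar>X y - P.expectation X\<bar>}"
      using X mp(2) unfolding EX by (auto simp: abs_if)
    show "{y \<in> space (positions I). K * p / 2 \<le> \<bar>X y - P.expectation X\<bar>} \<in> P.events" by measurable
  qed
  also have "\<dots> \<le> P.variance X / (K * p / 2)\<^sup>2"
    by (rule P.Chebyshev_inequality) (use intXX p0 K4 in auto)
  also have "\<dots> \<le> K * p / (K * p / 2)\<^sup>2"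
    using var by (intro divide_right_mono) auto
  also have "\<dots> = 4 / (K * p)" using p0 K4 by (simp add: power2_eq_square field_simps)
  also have "\<dots> \<le> 4 / \<mu>" using mp p0 K4 by (intro divide_left_mono mult_pos_pos) auto
  finally show ?thesis .
qed

definition reach_avoiding ::
  "nat set \<Rightarrow> real \<Rightarrow> nat \<Rightarrow> nat \<Rightarrow> nat \<Rightarrow> (nat \<times> nat \<Rightarrow> real \<times> real) \<Rightarrow> nat set" where
  "reach_avoiding A r h u c b = (\<Union>cs\<in>{cs \<in> rainbow_colours h. c \<notin> set cs}. reach A r b u cs)"

lemma reach_avoiding_subset: "reach_avoiding A r h u c b \<subseteq> insert u A"
  unfolding reach_avoiding_def using reach_subset by fast

lemma reach_avoiding_cong:
  assumes "\<And>d x. d \<in> {1..h} - {c} \<Longrightarrow> x \<in> insert u A \<Longrightarrow> b (d, x) = b' (d, x)"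
  shows "reach_avoiding A r h u c b = reach_avoiding A r h u c b'"
  unfolding reach_avoiding_def
  by (intro SUP_cong refl reach_cong assms) (auto simp: rainbow_colours_def)

lemma reach_avoiding_sets:
  assumes "finite A" "({1..h} - {c}) \<times> insert u A \<subseteq> I"
  shows "{\<omega> \<in> space (positions I). s \<in> reach_avoiding A r h u c \<omega>} \<in> sets (positions I)"
proof -
  have "{\<omega> \<in> space (positions I). s \<in> reach_avoiding A r h u c \<omega>} =
    {\<omega> \<in> space (positions I). \<exists>cs\<in>{cs \<in> rainbow_colours h. c \<notin> set cs}. s \<in> reach A r \<omega> u cs}"
    by (auto simp: reach_avoiding_def)
  also have "\<dots> \<in> sets (positions I)"
    by (intro sets.sets_Collect_finite_Ex reach_positions_sets)
       (use assms in \<open>auto simp: rainbow_colours_def intro: finite_subset[OF _ finite_rainbow_colours[of h]]\<close>)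
  finally show ?thesis .
qed

lemma rainbow_colours_avoid_length:
  assumes "cs \<in> rainbow_colours h" "c \<in> {1..h}" "c \<notin> set cs"
  shows "length cs \<le> h - 1"
proof -
  have "card (set cs) \<le> card ({1..h} - {c})"
    using assms by (intro card_mono) (auto simp: rainbow_colours_def)
  then show ?thesis using assms by (simp add: rainbow_colours_def distinct_card)
qed

lemma card_reach_avoiding_le:
  assumes "\<And>cs. cs \<in> rainbow_colours h \<Longrightarrow> real (card (reach A r b u cs)) \<le> y ^ length cs"
    and y: "1 \<le> y" and c: "c \<in> {1..h}" and M: "real (card (rainbow_colours h)) * y ^ (h - 1) \<le> real M"
  shows "card (reach_avoiding A r h u c b) \<le> M"
proof -
  let ?C = "{cs \<in> rainbow_colours h. c \<notin> set cs}"
  have fC: "finite ?C" by (rule finite_subset[OF _ finite_rainbow_colours[of h]]) auto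
  have "real (card (reach_avoiding A r h u c b)) \<le> (\<Sum>cs\<in>?C. real (card (reach A r b u cs)))"
    unfolding reach_avoiding_def of_nat_sum[symmetric] of_nat_le_iff by (rule card_UN_le[OF fC])
  also have "\<dots> \<le> (\<Sum>cs\<in>?C. y ^ (h - 1))"
  proof (rule sum_mono)
    fix cs assume cs: "cs \<in> ?C"
    then have "real (card (reach A r b u cs)) \<le> y ^ length cs" using assms(1) by auto
    also have "\<dots> \<le> y ^ (h - 1)" using cs c y by (intro power_increasing rainbow_colours_avoid_length) auto
    finally show "real (card (reach A r b u cs)) \<le> y ^ (h - 1)" .
  qed
  also have "\<dots> = real (card ?C) * y ^ (h - 1)" by simp
  also have "\<dots> \<le> real (card (rainbow_colours h)) * y ^ (h - 1)"
    using y by (intro mult_right_mono of_nat_mono card_mono) auto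
  finally show ?thesis using M by linarith
qed

context
  fixes h n k M :: nat and r \<mu> :: real and W :: "nat set"
  assumes h: "2 \<le> h" and W: "W \<subseteq> {1..<n}" and n: "0 < n" and r: "0 \<le> r"
    and x: "1 \<le> real n * r\<^sup>2" and k: "2 \<le> k" and kr: "3 * real k * r \<le> 1"
    and M: "real (card (rainbow_colours h)) * (13 * (real n * r\<^sup>2)) ^ (h - 1) \<le> real M"
    and mu: "\<mu> = (real k)\<^sup>2 * (1 - 1 / (real k)\<^sup>2) ^ M"
begin

private abbreviation "A \<equiv> {..<n} - W"
private abbreviation "I \<equiv> {1..h} \<times> {..<n}"
private abbreviation "G \<equiv> {..<k} \<times> {..<k}"
private abbreviation "N c \<omega> \<equiv> reach_avoiding A r h 0 c \<omega>"
private abbreviation "X \<equiv> real n * r\<^sup>2"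

private lemma zero_A: "insert 0 A = A"
  using W n by auto

private lemma inverse_cells: "0 < (real k)\<^sup>2" "1 / (real k)\<^sup>2 \<le> 1 / 4"
proof -
  have K: "4 \<le> (real k)\<^sup>2" using power_mono[of 2 "real k" 2] k by simp
  show "0 < (real k)\<^sup>2" using k by simp
  show "1 / (real k)\<^sup>2 \<le> 1 / 4" using K by (intro frac_le) auto
qed

private lemma mu_pos: "0 < \<mu>"
  unfolding mu
proof (rule mult_pos_pos, fact inverse_cells(1), rule zero_less_power)
  show "0 < 1 - 1 / (real k)\<^sup>2" using inverse_cells(2) by linarith
qed

private lemma mu_le: "\<mu> \<le> (real k)\<^sup>2"
proof -
  have "(1 - 1 / (real k)\<^sup>2) ^ M \<le> 1" using inverse_cells(2) by (intro power_le_one) auto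
  then have "(real k)\<^sup>2 * (1 - 1 / (real k)\<^sup>2) ^ M \<le> (real k)\<^sup>2 * 1" by (intro mult_left_mono) auto
  then show ?thesis by (simp add: mu)
qed

private lemma N_subset: "N c \<omega> \<subseteq> A"
  using reach_avoiding_subset[of A r h 0 c \<omega>] zero_A by simp

private lemma fin_W: "finite W"
  using W finite_subset by blast

private lemma N_sets: "c \<in> {1..h} \<Longrightarrow> ({1..h} - {c}) \<times> A \<subseteq> J \<Longrightarrow> {\<omega> \<in> space (positions J). s \<in> N c \<omega>} \<in> sets (positions J)"
  by (rule reach_avoiding_sets) (simp_all only: zero_A finite_Diff finite_lessThan)

private lemma holes_sets:
  "c \<in> {1..h} \<Longrightarrow> {1..h} \<times> A \<subseteq> J \<Longrightarrow> {\<omega> \<in> space (positions J). j \<in> holes k c (N c \<omega>) \<omega>} \<in> sets (positions J)"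
  by (rule hole_sets[OF _ _ N_sets N_subset]) blast+

private lemma card_holes_sets:
  "c \<in> {1..h} \<Longrightarrow> {1..h} \<times> A \<subseteq> J \<Longrightarrow> {\<omega> \<in> space (positions J). P (card (holes k c (N c \<omega>) \<omega>))} \<in> sets (positions J)"
  by (rule sets_finite_set_valued[of G _ _ "\<lambda>H. P (card H)", OF _ holes_sets]) (auto simp: holes_def)

private lemma card_N_sets:
  "c \<in> {1..h} \<Longrightarrow> ({1..h} - {c}) \<times> A \<subseteq> J \<Longrightarrow> {\<omega> \<in> space (positions J). P (N c \<omega>)} \<in> sets (positions J)"
  by (rule sets_finite_set_valued[OF _ N_sets N_subset]) auto

private definition E_pair where
  "E_pair = {\<omega> \<in> space (positions I). \<exists>v\<in>W. \<exists>w\<in>W. \<exists>cs\<in>rainbow_colours h.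
     w \<noteq> v \<and> length cs \<le> h - 1 \<and> v \<in> reach {..<n} r \<omega> w cs}"

private definition E_size where
  "E_size = {\<omega> \<in> space (positions I). \<exists>cs\<in>rainbow_colours h. (13 * X) ^ length cs < real (card (reach A r \<omega> 0 cs))}"

private definition E_hole where
  "E_hole = {\<omega> \<in> space (positions I). \<exists>c\<in>{1..h}. card (N c \<omega>) \<le> M \<and> real (card (holes k c (N c \<omega>) \<omega>)) < \<mu> / 2}"

private definition E_cover where
  "E_cover = {\<omega> \<in> space (positions I). (\<forall>c\<in>{1..h}. \<mu> / 2 \<le> real (card (holes k c (N c \<omega>) \<omega>))) \<and>
      (\<forall>v\<in>W. \<exists>c\<in>{1..h}. \<omega> (c, v) \<notin> (\<Union>j\<in>holes k c (N c \<omega>) \<omega>. mid_cell k j))}"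

private lemma E_sets:
  "E_pair \<in> sets (positions I)" "E_size \<in> sets (positions I)" "E_hole \<in> sets (positions I)"
proof -
  show "E_pair \<in> sets (positions I)"
    unfolding E_pair_def
    by (intro sets.sets_Collect_finite_Ex sets.sets_Collect_conj sets.sets_Collect_const reach_positions_sets fin_W finite_rainbow_colours)
       (use W in \<open>auto simp: rainbow_colours_def\<close>)
  show "E_size \<in> sets (positions I)"
    unfolding E_size_def
    by (intro sets.sets_Collect_finite_Ex reach_positions_sets_pred finite_rainbow_colours)
       (use n in \<open>auto simp: rainbow_colours_def\<close>)
  show "E_hole \<in> sets (positions I)"
    unfolding E_hole_def
    by (intro sets.sets_Collect_finite_Ex sets.sets_Collect_conj card_N_sets card_holes_sets) auto
qed

private lemma cover_pred_sets:
  assumes "{1..h} \<times> A \<subseteq> J" "{1..h} \<times> W \<subseteq> J"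
  shows "{\<omega> \<in> space (positions J). \<forall>v\<in>W. \<exists>c\<in>{1..h}. \<omega> (c, v) \<notin> (\<Union>j\<in>holes k c (N c \<omega>) \<omega>. mid_cell k j)} \<in> sets (positions J)"
proof -
  have "{\<omega> \<in> space (positions J). \<forall>v\<in>W. \<exists>c\<in>{1..h}. \<omega> (c, v) \<notin> (\<Union>j\<in>holes k c (N c \<omega>) \<omega>. mid_cell k j)} =
    {\<omega> \<in> space (positions J). \<forall>v\<in>W. \<exists>c\<in>{1..h}. \<forall>j\<in>G. j \<in> holes k c (N c \<omega>) \<omega> \<longrightarrow> \<omega> (c, v) \<in> - mid_cell k j}"
  proof -
    have "b \<notin> (\<Union>j\<in>holes k c S b'. mid_cell k j) \<longleftrightarrow> (\<forall>j\<in>G. j \<in> holes k c S b' \<longrightarrow> b \<in> - mid_cell k j)"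
      for b b' c S by (auto simp: holes_def)
    then show ?thesis by (simp only:)
  qed
  also have "\<dots> \<in> sets (positions J)"
    by (intro sets.sets_Collect_finite_All sets.sets_Collect_finite_Ex sets.sets_Collect_imp holes_sets
         vimage_position_sets borel_comp mid_cell_measurable fin_W) (use assms in auto)
  finally show ?thesis .
qed

private lemma E_cover_sets: "E_cover \<in> sets (positions I)"
  unfolding E_cover_def
  by (intro sets.sets_Collect_conj sets.sets_Collect_finite_All card_holes_sets cover_pred_sets) (use W in auto)

private lemma connected_subset:
  "{\<omega> \<in> space (positions I). rainbow_connected n h r \<omega>} \<subseteq> E_pair \<union> (E_size \<union> (E_hole \<union> E_cover))"
proof
  fix \<omega> assume w: "\<omega> \<in> {\<omega> \<in> space (positions I). rainbow_connected n h r \<omega>}"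
  show "\<omega> \<in> E_pair \<union> (E_size \<union> (E_hole \<union> E_cover))"
  proof (rule ccontr)
    assume "\<not> ?thesis"
    then have np: "\<omega> \<notin> E_pair" and ns: "\<omega> \<notin> E_size" and nh: "\<omega> \<notin> E_hole" and nc: "\<omega> \<notin> E_cover" by auto
    have sp: "\<omega> \<in> space (positions I)" using w by simp
    have "card (N c \<omega>) \<le> M" if "c \<in> {1..h}" for c
      by (rule card_reach_avoiding_le[OF _ _ that M]) (use ns sp x in \<open>auto simp: E_size_def not_less\<close>)
    then have big: "\<mu> / 2 \<le> real (card (holes k c (N c \<omega>) \<omega>))" if "c \<in> {1..h}" for c
      using nh sp that by (auto simp: E_hole_def not_less)
    have "\<exists>c\<in>{1..h}. \<omega> (c, v) \<notin> (\<Union>j\<in>holes k c (N c \<omega>) \<omega>. mid_cell k j)" if v: "v \<in> W" for v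
    proof -
      have "v < n" "0 \<noteq> v" using v W by auto
      then obtain cs where cs: "cs \<in> rainbow_colours h" "v \<in> reach {..<n} r \<omega> 0 cs"
        using w n by (auto simp: rainbow_connected_iff)
      have "v \<notin> reach A r \<omega> 0 cs" using reach_subset[of A r \<omega> 0 cs] zero_A v by auto
      then obtain y c cs1 cs2 where y: "y \<in> {..<n} - A" "cs = cs2 @ c # cs1"
        "\<exists>x\<in>reach A r \<omega> 0 cs1. dist (\<omega> (c, x)) (\<omega> (c, y)) \<le> r" "v \<in> reach {..<n} r \<omega> y cs2"
        using reach_first_exit[OF cs(2) Diff_subset[of "{..<n}" W]] by blast
      have cs12: "cs1 \<in> rainbow_colours h" "cs2 \<in> rainbow_colours h" "c \<in> {1..h}" "c \<notin> set cs1" "c \<notin> set cs2"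
        using cs(1) y(2) by (auto simp: rainbow_colours_def)
      have "y = v"
        using np sp v y(1,4) cs12 rainbow_colours_avoid_length[OF cs12(2,3,5)] by (auto simp: E_pair_def)
      then obtain z where z: "z \<in> N c \<omega>" "dist (\<omega> (c, z)) (\<omega> (c, v)) \<le> r"
        using y(3) cs12 by (auto simp: reach_avoiding_def)
      have "\<omega> (c, v) \<notin> mid_cell k j" if j: "j \<in> holes k c (N c \<omega>) \<omega>" for j
      proof
        assume "\<omega> (c, v) \<in> mid_cell k j"
        then have "grid k (\<omega> (c, z)) = j"
          using mid_cell_near[of k j "\<omega> (c, v)" "\<omega> (c, z)" r] k j z(2) kr by (auto simp: holes_def)
        then show False using j z(1) by (auto simp: holes_def)
      qed
      then show ?thesis using cs12 by blast
    qed
    then have "\<omega> \<in> E_cover" using big sp by (auto simp: E_cover_def)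
    then show False using nc by simp
  qed
qed

private lemma prob_pair: "measure (positions I) E_pair \<le> (real (card W))\<^sup>2 * real (card (rainbow_colours h)) * (4 * r\<^sup>2 * (2 + 4 * X) ^ (h - 2))"
proof -
  interpret P: prob_space "positions I" by (rule unif.prob_space_power)
  let ?q = "4 * r\<^sup>2 * (2 + 4 * X) ^ (h - 2)"
  let ?C = "{cs \<in> rainbow_colours h. length cs \<le> h - 1}"
  let ?T = "{(v, w, cs). v \<in> W \<and> w \<in> W \<and> w \<noteq> v \<and> cs \<in> ?C}"
  have fC: "finite ?C" by (rule finite_subset[OF _ finite_rainbow_colours[of h]]) auto
  have T: "?T \<subseteq> W \<times> W \<times> ?C" by auto
  have fT: "finite ?T" by (rule finite_subset[OF T]) (use fin_W fC in auto)
  have "card ?T \<le> card (W \<times> W \<times> ?C)" by (rule card_mono[OF _ T]) (use fin_W fC in auto)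
  also have "\<dots> \<le> card W * (card W * card (rainbow_colours h))"
    by (auto simp: card_cartesian_product intro!: mult_left_mono card_mono)
  finally have cT: "real (card ?T) \<le> (real (card W))\<^sup>2 * real (card (rainbow_colours h))"
    by (simp add: power2_eq_square mult.assoc flip: of_nat_mult)
  let ?R = "\<lambda>(v, w, cs). {\<omega> \<in> space (positions I). v \<in> reach {..<n} r \<omega> w cs}"
  have Rm: "?R t \<in> P.events" if "t \<in> ?T" for t
  proof -
    obtain v w cs where t: "t = (v, w, cs)" by (cases t)
    show ?thesis unfolding t prod.case
      by (rule reach_positions_sets) (use that t W in \<open>auto simp: rainbow_colours_def\<close>)
  qed
  have Rp: "P.prob (?R t) \<le> ?q" if "t \<in> ?T" for t
  proof -
    obtain v w cs where t: "t = (v, w, cs)" by (cases t)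
    have vw: "w < n" "v < n" "w \<noteq> v" "cs \<in> rainbow_colours h" "length cs - 1 \<le> h - 2" using that t W by auto
    have "P.prob (?R t) \<le> (if cs = [] then 0 else 4 * r\<^sup>2 * (2 + 4 * X) ^ (length cs - 1))"
      unfolding t prod.case by (rule measure_reach_le) (use vw r in \<open>auto simp: rainbow_colours_def\<close>)
    also have "\<dots> \<le> ?q" using vw x by (auto intro!: mult_left_mono power_increasing)
    finally show ?thesis .
  qed
  have "E_pair \<subseteq> (\<Union>t\<in>?T. ?R t)"
  proof
    fix \<omega> assume "\<omega> \<in> E_pair"
    then obtain v w cs where "(v, w, cs) \<in> ?T" "\<omega> \<in> ?R (v, w, cs)"
      unfolding E_pair_def by blast
    then show "\<omega> \<in> (\<Union>t\<in>?T. ?R t)" by (rule UN_I)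
  qed
  then have "P.prob E_pair \<le> P.prob (\<Union>t\<in>?T. ?R t)"
    by (rule P.finite_measure_mono) (rule sets.finite_UN[OF fT Rm])
  also have "\<dots> \<le> (\<Sum>t\<in>?T. P.prob (?R t))"
    by (rule P.finite_measure_subadditive_finite[OF fT image_subsetI]) (rule Rm)
  also have "\<dots> \<le> (\<Sum>t\<in>?T. ?q)" by (rule sum_mono) (rule Rp)
  also have "\<dots> = real (card ?T) * ?q" by simp
  also have "\<dots> \<le> (real (card W))\<^sup>2 * real (card (rainbow_colours h)) * ?q"
    by (rule mult_right_mono[OF cT]) simp
  finally show ?thesis .
qed

private lemma prob_size: "measure (positions I) E_size \<le> real (card (rainbow_colours h)) * (real h * exp (- (4 * X)))"
proof -
  interpret P: prob_space "positions I" by (rule unif.prob_space_power)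
  let ?R = "\<lambda>cs. {\<omega> \<in> space (positions I). (13 * X) ^ length cs < real (card (reach A r \<omega> 0 cs))}"
  have Rm: "?R cs \<in> P.events" if "cs \<in> rainbow_colours h" for cs
    by (rule reach_positions_sets_pred) (use that n in \<open>auto simp: rainbow_colours_def\<close>)
  have union: "E_size = (\<Union>cs\<in>rainbow_colours h. ?R cs)" unfolding E_size_def by blast
  have "P.prob E_size \<le> (\<Sum>cs\<in>rainbow_colours h. P.prob (?R cs))"
    unfolding union by (rule P.finite_measure_subadditive_finite[OF finite_rainbow_colours image_subsetI]) (rule Rm)
  also have "\<dots> \<le> (\<Sum>cs\<in>rainbow_colours h. real h * exp (- (4 * X)))"
  proof (rule sum_mono)
    fix cs assume cs: "cs \<in> rainbow_colours h"
    have "P.prob (?R cs) \<le> real (length cs) * exp (- (4 * X))"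
    proof -
      have "set cs \<times> {..<n} \<subseteq> I" "distinct cs" using cs by (auto simp: rainbow_colours_def)
      moreover have "(0::nat) \<in> {..<n}" "1 \<le> real (card {..<n}) * r\<^sup>2" using n x by simp_all
      ultimately show ?thesis
        using measure_reach_card_le[of I cs "{..<n}" A 0 r] r
        by (simp only: card_lessThan finite_SigmaI finite_lessThan finite_atLeastAtMost Diff_subset simp_thms)
    qed
    also have "\<dots> \<le> real h * exp (- (4 * X))"
      using rainbow_colours_length[OF cs] by (intro mult_right_mono) auto
    finally show "P.prob (?R cs) \<le> real h * exp (- (4 * X))" .
  qed
  finally show ?thesis by simp
qed

private lemma prob_hole: "measure (positions I) E_hole \<le> real h * (4 / \<mu>)"
proof -
  interpret P: prob_space "positions I" by (rule unif.prob_space_power)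
  let ?R = "\<lambda>c. {\<omega> \<in> space (positions I). card (N c \<omega>) \<le> M \<and> real (card (holes k c (N c \<omega>) \<omega>)) < \<mu> / 2}"
  have Rm: "?R c \<in> P.events" if "c \<in> {1..h}" for c
    by (intro sets.sets_Collect_conj card_N_sets card_holes_sets) (use that in auto)
  have union: "E_hole = (\<Union>c\<in>{1..h}. ?R c)" unfolding E_hole_def by blast
  have "P.prob E_hole \<le> (\<Sum>c\<in>{1..h}. P.prob (?R c))"
    unfolding union by (rule P.finite_measure_subadditive_finite[OF finite_atLeastAtMost image_subsetI]) (rule Rm)
  also have "\<dots> \<le> (\<Sum>c\<in>{1..h}. 4 / \<mu>)"
  proof (rule sum_mono)
    fix c assume c: "c \<in> {1..h}"
    let ?K = "{c} \<times> {..<n}"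
    let ?J = "I - ?K"
    have un: "?J \<union> ?K = I" using c by auto
    have eqN: "N c (merge ?J ?K (x, y)) = N c x" for x y
      by (rule reach_avoiding_cong) (use n in \<open>auto simp: merge_def\<close>)
    have eqH: "holes k c (N c x) (merge ?J ?K (x, y)) = holes k c (N c x) y" for x y
    proof -
      have "merge ?J ?K (x, y) (c, s) = y (c, s)" if "s \<in> N c x" for s
        using that reach_avoiding_subset[of A r h 0 c x] zero_A by (auto simp: merge_def)
      then show ?thesis by (auto simp: holes_def)
    qed
    have "\<P>(\<omega> in positions (?J \<union> ?K). card (N c \<omega>) \<le> M \<and> real (card (holes k c (N c \<omega>) \<omega>)) < \<mu> / 2)
      \<le> 4 / \<mu> * \<P>(x in positions ?J. card (N c x) \<le> M)"
    proof (rule unif.measure_merge_le)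
      show "{\<omega> \<in> space (positions (?J \<union> ?K)). card (N c \<omega>) \<le> M \<and> real (card (holes k c (N c \<omega>) \<omega>)) < \<mu> / 2} \<in> sets (positions (?J \<union> ?K))"
        unfolding un by (rule Rm[OF c])
      show "{x \<in> space (positions ?J). card (N c x) \<le> M} \<in> sets (positions ?J)"
        by (rule card_N_sets) (use c in auto)
      show "\<P>(y in positions ?K. card (N c (merge ?J ?K (x, y))) \<le> M \<and>
             real (card (holes k c (N c (merge ?J ?K (x, y))) (merge ?J ?K (x, y)))) < \<mu> / 2) \<le> 4 / \<mu>"
        if "card (N c x) \<le> M" for x
        unfolding eqN eqH
      proof -
        have "{c} \<times> N c x \<subseteq> ?K" using reach_avoiding_subset[of A r h 0 c x] zero_A by auto
        then show "\<P>(y in positions ?K. card (N c x) \<le> M \<and> real (card (holes k c (N c x) y)) < \<mu> / 2) \<le> 4 / \<mu>"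
          using measure_few_holes_le[of ?K c "N c x" M k \<mu>] that k mu by simp
      qed
    qed (use eqN mu_pos in auto)
    also have "\<dots> \<le> 4 / \<mu> * 1"
      using mu_pos prob_space.prob_le_1[OF unif.prob_space_power[of ?J]] by (intro mult_left_mono) auto
    finally show "P.prob (?R c) \<le> 4 / \<mu>" unfolding un by simp
  qed
  finally show ?thesis by simp
qed

private lemma prob_cover: "measure (positions I) E_cover \<le> exp (- (real (card W) * (\<mu> / (18 * (real k)\<^sup>2)) ^ h))"
proof -
  let ?J = "{1..h} \<times> A" and ?K = "{1..h} \<times> W"
  let ?t = "\<mu> / (18 * (real k)\<^sup>2)"
  let ?B = "\<lambda>c \<omega>. (\<Union>j\<in>holes k c (N c \<omega>) \<omega>. mid_cell k j)"
  have un: "?J \<union> ?K = I" using W by auto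
  have t: "0 \<le> ?t" "?t \<le> 1" using mu_pos mu_le k by (auto simp: field_simps)
  have eqH: "holes k c (N c (merge ?J ?K (x, y))) (merge ?J ?K (x, y)) = holes k c (N c x) x" if "c \<in> {1..h}" for c x y
  proof -
    have "N c (merge ?J ?K (x, y)) = N c x"
      by (rule reach_avoiding_cong) (simp only: zero_A, simp add: merge_def)
    moreover have "merge ?J ?K (x, y) (c, s) = x (c, s)" if "s \<in> N c x" for s
      using subsetD[OF N_subset that] \<open>c \<in> {1..h}\<close> by (simp add: merge_def)
    ultimately show ?thesis by (auto simp: holes_def)
  qed
  have "\<P>(\<omega> in positions (?J \<union> ?K). (\<forall>c\<in>{1..h}. \<mu> / 2 \<le> real (card (holes k c (N c \<omega>) \<omega>))) \<and>
      (\<forall>v\<in>W. \<exists>c\<in>{1..h}. \<omega> (c, v) \<notin> ?B c \<omega>))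
    \<le> exp (- (real (card W) * ?t ^ h)) * \<P>(x in positions ?J. \<forall>c\<in>{1..h}. \<mu> / 2 \<le> real (card (holes k c (N c x) x)))"
  proof (rule unif.measure_merge_le)
    show "{\<omega> \<in> space (positions (?J \<union> ?K)). (\<forall>c\<in>{1..h}. \<mu> / 2 \<le> real (card (holes k c (N c \<omega>) \<omega>))) \<and>
      (\<forall>v\<in>W. \<exists>c\<in>{1..h}. \<omega> (c, v) \<notin> ?B c \<omega>)} \<in> sets (positions (?J \<union> ?K))"
      unfolding un using E_cover_sets unfolding E_cover_def .
    show "{x \<in> space (positions ?J). \<forall>c\<in>{1..h}. \<mu> / 2 \<le> real (card (holes k c (N c x) x))} \<in> sets (positions ?J)"
      by (intro sets.sets_Collect_finite_All card_holes_sets) auto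
    show "\<P>(y in positions ?K.
        (\<forall>c\<in>{1..h}. \<mu> / 2 \<le> real (card (holes k c (N c (merge ?J ?K (x, y))) (merge ?J ?K (x, y))))) \<and>
        (\<forall>v\<in>W. \<exists>c\<in>{1..h}. merge ?J ?K (x, y) (c, v) \<notin> ?B c (merge ?J ?K (x, y)))) \<le> exp (- (real (card W) * ?t ^ h))"
      if big: "\<forall>c\<in>{1..h}. \<mu> / 2 \<le> real (card (holes k c (N c x) x))" for x
    proof -
      interpret K: prob_space "positions ?K" by (rule unif.prob_space_power)
      have Bm: "?B c x \<in> sets borel" for c by (intro sets.finite_UN mid_cell_measurable) simp
      let ?\<phi> = "\<lambda>v y. \<exists>c\<in>{1..h}. y (c, v) \<notin> ?B c x"
      have event: "{y \<in> space (positions ?K).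
        (\<forall>c\<in>{1..h}. \<mu> / 2 \<le> real (card (holes k c (N c (merge ?J ?K (x, y))) (merge ?J ?K (x, y))))) \<and>
        (\<forall>v\<in>W. \<exists>c\<in>{1..h}. merge ?J ?K (x, y) (c, v) \<notin> ?B c (merge ?J ?K (x, y)))} = {y \<in> space (positions ?K). \<forall>v\<in>W. ?\<phi> v y}"
      proof -
        have "(\<forall>c\<in>{1..h}. \<mu> / 2 \<le> real (card (holes k c (N c (merge ?J ?K (x, y))) (merge ?J ?K (x, y))))) \<and>
            (\<forall>v\<in>W. \<exists>c\<in>{1..h}. merge ?J ?K (x, y) (c, v) \<notin> ?B c (merge ?J ?K (x, y))) \<longleftrightarrow> (\<forall>v\<in>W. ?\<phi> v y)" for y
        proof -
          have big': "\<forall>c\<in>{1..h}. \<mu> / 2 \<le> real (card (holes k c (N c (merge ?J ?K (x, y))) (merge ?J ?K (x, y))))"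
          proof
            fix c assume c: "c \<in> {1..h}"
            show "\<mu> / 2 \<le> real (card (holes k c (N c (merge ?J ?K (x, y))) (merge ?J ?K (x, y))))"
              unfolding eqH[OF c] by (rule bspec[OF big c])
          qed
          have mem: "merge ?J ?K (x, y) (c, v) \<notin> ?B c (merge ?J ?K (x, y)) \<longleftrightarrow> y (c, v) \<notin> ?B c x"
            if "v \<in> W" "c \<in> {1..h}" for v c
          proof -
            have "merge ?J ?K (x, y) (c, v) = y (c, v)" using that by (simp add: merge_def)
            then show ?thesis unfolding eqH[OF that(2)] by (simp only:)
          qed
          have eq: "(\<forall>v\<in>W. \<exists>c\<in>{1..h}. merge ?J ?K (x, y) (c, v) \<notin> ?B c (merge ?J ?K (x, y))) \<longleftrightarrow> (\<forall>v\<in>W. ?\<phi> v y)"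
            by (intro ball_cong bex_cong refl mem)
          show ?thesis
            by (rule iffI, erule conjE, erule iffD1[OF eq], rule conjI[OF big'], erule iffD2[OF eq])
        qed
        then show ?thesis by (intro Collect_cong conj_cong refl)
      qed
      have "\<P>(y in positions ?K. \<forall>v\<in>W. ?\<phi> v y) = (\<Prod>v\<in>W. \<P>(y in positions ?K. ?\<phi> v y))"
      proof (rule unif.measure_blocks[where L = "\<lambda>v. {1..h} \<times> {v}"])
        show "{\<eta> \<in> space (positions ({1..h} \<times> {v})). ?\<phi> v \<eta>} \<in> sets (positions ({1..h} \<times> {v}))" for v
        proof -
          have "{\<eta> \<in> space (positions ({1..h} \<times> {v})). \<exists>c\<in>{1..h}. \<eta> (c, v) \<in> - ?B c x} \<in> sets (positions ({1..h} \<times> {v}))"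
            by (intro sets.sets_Collect_finite_Ex vimage_position_sets borel_comp Bm) auto
          then show ?thesis by simp
        qed
      qed (use fin_W in \<open>auto simp: disjoint_family_on_def\<close>)
      also have "\<dots> \<le> (\<Prod>v\<in>W. exp (- (?t ^ h)))"
      proof (rule prod_mono, intro conjI)
        fix v assume v: "v \<in> W"
        let ?T = "{1..h} \<times> {v}"
        let ?F = "{y \<in> space (positions ?K). \<forall>i\<in>?T. y i \<in> ?B (fst i) x}"
        have Fm: "?F \<in> K.events"
          by (intro sets.sets_Collect_finite_All vimage_position_sets Bm) (use v in auto)
        have "?t ^ h = (\<Prod>i\<in>?T. ?t)" by (simp add: card_cartesian_product)
        also have "\<dots> \<le> (\<Prod>i\<in>?T. measure unif_square (?B (fst i) x))"
        proof (rule prod_mono, intro conjI t(1))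
          fix i assume i: "i \<in> ?T"
          have "?t = \<mu> / 2 / (9 * (real k)\<^sup>2)" by simp
          also have "\<dots> \<le> real (card (holes k (fst i) (N (fst i) x) x)) / (9 * (real k)\<^sup>2)"
            using big i by (intro divide_right_mono) auto
          also have "\<dots> = measure unif_square (?B (fst i) x)"
            by (rule measure_mid_cells[symmetric]) (use k in \<open>auto simp: holes_def\<close>)
          finally show "?t \<le> measure unif_square (?B (fst i) x)" .
        qed
        also have "\<dots> = K.prob ?F"
          by (rule unif.measure_coords[symmetric]) (use fin_W v Bm in auto)
        finally have "?t ^ h \<le> K.prob ?F" .
        moreover have "{y \<in> space (positions ?K). ?\<phi> v y} = space (positions ?K) - ?F" by auto
        ultimately have "K.prob {y \<in> space (positions ?K). ?\<phi> v y} \<le> 1 - ?t ^ h"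
          using K.prob_compl[OF Fm] by simp
        also have "\<dots> \<le> exp (- (?t ^ h))" using exp_ge_add_one_self[of "- (?t ^ h)"] by simp
        finally show "K.prob {y \<in> space (positions ?K). ?\<phi> v y} \<le> exp (- (?t ^ h))" .
      qed simp
      also have "\<dots> = exp (- (real (card W) * ?t ^ h))" by (simp add: exp_of_nat_mult[symmetric])
      finally show ?thesis unfolding event .
    qed
  qed (use fin_W eqH in auto)
  also have "\<dots> \<le> exp (- (real (card W) * ?t ^ h)) * 1"
    using prob_space.prob_le_1[OF unif.prob_space_power[of ?J]] by (intro mult_left_mono) auto
  finally show ?thesis unfolding un E_cover_def by simp
qed

lemma measure_connected_le:
  "\<P>(\<omega> in rgg_space n h. rainbow_connected n h r \<omega>) \<le>
     (real (card W))\<^sup>2 * real (card (rainbow_colours h)) * (4 * r\<^sup>2 * (2 + 4 * (real n * r\<^sup>2)) ^ (h - 2))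
     + real (card (rainbow_colours h)) * (real h * exp (- (4 * (real n * r\<^sup>2))))
     + real h * (4 / \<mu>)
     + exp (- (real (card W) * (\<mu> / (18 * (real k)\<^sup>2)) ^ h))"
proof -
  interpret P: prob_space "positions I" by (rule unif.prob_space_power)
  note m = E_sets E_cover_sets
  have "P.prob {\<omega> \<in> space (positions I). rainbow_connected n h r \<omega>} \<le> P.prob (E_pair \<union> (E_size \<union> (E_hole \<union> E_cover)))"
    by (rule P.finite_measure_mono[OF connected_subset]) (intro sets.Un m)
  also have "\<dots> \<le> P.prob E_pair + (P.prob E_size + (P.prob E_hole + P.prob E_cover))"
    by (intro order_trans[OF measure_Un_le] add_left_mono sets.Un m order_refl)
  finally show ?thesis
    using prob_pair prob_size prob_hole prob_cover unfolding rgg_space_eq by linarith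
qed

end

section \<open>Growth of reached sets\<close>

lemma exp_minus_le_quadratic:
  assumes "0 \<le> (t::real)"
  shows "exp (- t) \<le> 1 - t + t\<^sup>2 / 2"
proof -
  let ?f = "\<lambda>t::real. 1 - t + t\<^sup>2 / 2 - exp (- t)"
  have "?f 0 \<le> ?f t"
  proof (rule DERIV_nonneg_imp_nondecreasing[OF assms])
    fix s :: real
    have "(?f has_real_derivative (- 1 + s + exp (- s))) (at s)"
      by (auto intro!: derivative_eq_intros)
    moreover have "0 \<le> - 1 + s + exp (- s)" using exp_ge_add_one_self[of "- s"] by simp
    ultimately show "\<exists>y. (?f has_real_derivative y) (at s) \<and> 0 \<le> y" by blast
  qed
  then show ?thesis by simp
qed

lemma count_lower_tail:
  assumes I: "finite I" and T: "T \<subseteq> I" and B: "B \<in> sets borel"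
    and p: "p \<le> measure unif_square B" "0 \<le> p" and e: "0 \<le> \<epsilon>"
  shows "\<P>(\<omega> in positions I. real (card {i \<in> T. \<omega> i \<in> B}) \<le> (1 - \<epsilon>) * (real (card T) * p))
    \<le> exp (- (\<epsilon>\<^sup>2 * (real (card T) * p) / 2))"
proof -
  let ?\<mu> = "real (card T) * p"
  have "\<P>(\<omega> in positions I. real (card {i \<in> T. \<omega> i \<in> B}) \<le> (1 - \<epsilon>) * ?\<mu>)
    \<le> exp (\<epsilon> * ((1 - \<epsilon>) * ?\<mu>)) * exp (- (?\<mu> * (1 - exp (- \<epsilon>))))"
    by (rule unif.chernoff_lower[OF I T]) (use B p e in auto)
  also have "\<dots> = exp (?\<mu> * (\<epsilon> * (1 - \<epsilon>) - (1 - exp (- \<epsilon>))))"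
    by (simp add: mult_exp_exp algebra_simps)
  also have "\<dots> \<le> exp (?\<mu> * (- (\<epsilon>\<^sup>2 / 2)))"
  proof -
    have "\<epsilon> * (1 - \<epsilon>) - (1 - exp (- \<epsilon>)) \<le> - (\<epsilon>\<^sup>2 / 2)"
      using exp_minus_le_quadratic[OF e] by (simp add: power2_eq_square algebra_simps)
    then have "?\<mu> * (\<epsilon> * (1 - \<epsilon>) - (1 - exp (- \<epsilon>))) \<le> ?\<mu> * (- (\<epsilon>\<^sup>2 / 2))"
      using p(2) by (intro mult_left_mono) auto
    then show ?thesis by (simp only: exp_le_cancel_iff)
  qed
  also have "\<dots> = exp (- (\<epsilon>\<^sup>2 * ?\<mu> / 2))" by (simp add: algebra_simps)
  finally show ?thesis .
qed

lemma grid_image_sets: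
  assumes "finite T" "T \<subseteq> I" "0 < k"
  shows "{\<omega> \<in> space (positions I). P ((\<lambda>i. grid k (\<omega> i)) ` T)} \<in> sets (positions I)"
proof (rule sets_finite_set_valued[of "{..<k} \<times> {..<k}"])
  fix j
  have "{\<omega> \<in> space (positions I). \<exists>i\<in>T. \<omega> i \<in> {x. grid k x = j}} \<in> sets (positions I)"
    using assms by (intro sets.sets_Collect_finite_Ex vimage_position_sets grid_measurable) auto
  moreover have "{\<omega> \<in> space (positions I). j \<in> (\<lambda>i. grid k (\<omega> i)) ` T} =
     {\<omega> \<in> space (positions I). \<exists>i\<in>T. \<omega> i \<in> {x. grid k x = j}}" by auto
  ultimately show "{\<omega> \<in> space (positions I). j \<in> (\<lambda>i. grid k (\<omega> i)) ` T} \<in> sets (positions I)" by simp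
qed (simp, (rule image_subsetI grid_mem assms)+)

text \<open>Revealing the points one at a time, each new point lands in an already occupied cell with
  probability at most \<open>s / k\<^sup>2\<close>.\<close>

lemma nn_integral_exp_occupied:
  assumes "finite T" "card T \<le> s" "0 < k"
  shows "(\<integral>\<^sup>+ \<omega>. ennreal (exp (- real (card ((\<lambda>i. grid k (\<omega> i)) ` T)))) \<partial>positions T)
           \<le> ennreal ((real s / (real k)\<^sup>2 + exp (- 1)) ^ card T)"
  using assms(1,2)
proof (induction T rule: finite_induct)
  case empty
  then show ?case by (simp add: prob_space.emeasure_space_1[OF unif.prob_space_power])
next
  case (insert i T)
  interpret P: product_prob_space "\<lambda>_. unif_square" by unfold_locales
  let ?R = "\<lambda>\<omega> T. (\<lambda>i. grid k (\<omega> i)) ` T"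
  let ?b = "real s / (real k)\<^sup>2 + exp (- 1)"
  have meas: "(\<lambda>\<omega>. ennreal (exp (- real (card (?R \<omega> S))))) \<in> borel_measurable (positions S')" if "S \<subseteq> S'" "finite S" for S S'
  proof (rule measurableI)
    fix B :: "ennreal set"
    show "(\<lambda>\<omega>. ennreal (exp (- real (card (?R \<omega> S))))) -` B \<inter> space (positions S') \<in> sets (positions S')"
      using grid_image_sets[OF that(2,1) assms(3), of "\<lambda>F. ennreal (exp (- real (card F))) \<in> B"]
      by (simp add: vimage_def Int_def conj_commute)
  qed simp
  have "(\<integral>\<^sup>+ \<omega>. ennreal (exp (- real (card (?R \<omega> (insert i T))))) \<partial>positions (insert i T))
    = (\<integral>\<^sup>+ x. (\<integral>\<^sup>+ y. ennreal (exp (- real (card (?R (x(i := y)) (insert i T))))) \<partial>unif_square) \<partial>positions T)"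
    by (rule P.product_nn_integral_insert[OF insert(1,2)], rule meas) (use insert in auto)
  also have "\<dots> \<le> (\<integral>\<^sup>+ x. ennreal ?b * ennreal (exp (- real (card (?R x T)))) \<partial>positions T)"
  proof (rule nn_integral_mono)
    fix x
    let ?F = "?R x T"
    have fF: "finite ?F" using insert by simp
    have FG: "?F \<subseteq> {..<k} \<times> {..<k}" by (rule image_subsetI, rule grid_mem[OF assms(3)])
    have R: "?R (x(i := y)) (insert i T) = insert (grid k y) ?F" for y
      using insert(2) by auto
    let ?E = "{y. grid k y \<in> ?F}"
    have E: "?E \<in> sets borel" by (rule grid_measurable_set)
    have "(\<integral>\<^sup>+ y. ennreal (exp (- real (card (?R (x(i := y)) (insert i T))))) \<partial>unif_square)
      \<le> (\<integral>\<^sup>+ y. ennreal (exp (- real (card ?F))) * indicator ?E y + ennreal (exp (- 1) * exp (- real (card ?F))) \<partial>unif_square)"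
    proof (rule nn_integral_mono)
      fix y
      show "ennreal (exp (- real (card (?R (x(i := y)) (insert i T))))) \<le>
        ennreal (exp (- real (card ?F))) * indicator ?E y + ennreal (exp (- 1) * exp (- real (card ?F)))"
      proof (cases "grid k y \<in> ?F")
        case True
        then show ?thesis unfolding R by (simp add: insert_absorb)
      next
        case False
        then show ?thesis unfolding R using fF by (simp add: mult_exp_exp)
      qed
    qed
    also have "\<dots> = ennreal (exp (- real (card ?F))) * emeasure unif_square ?E + ennreal (exp (- 1) * exp (- real (card ?F)))"
      using E by (subst nn_integral_add) (auto simp: nn_integral_cmult_indicator unif.emeasure_space_1[unfolded space_unif_square])
    also have "\<dots> = ennreal (exp (- real (card ?F)) * (real (card ?F) / (real k)\<^sup>2) + exp (- 1) * exp (- real (card ?F)))"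
      unfolding unif.emeasure_eq_measure measure_grid_set[OF assms(3) FG]
      by (simp add: ennreal_mult[symmetric] ennreal_plus[symmetric] del: ennreal_plus)
    also have "\<dots> \<le> ennreal (?b * exp (- real (card ?F)))"
    proof (rule ennreal_leI)
      have "card ?F \<le> s" using card_image_le[OF insert(1), of "\<lambda>i. grid k (x i)"] insert by simp
      then have "real (card ?F) / (real k)\<^sup>2 \<le> real s / (real k)\<^sup>2" by (intro divide_right_mono) auto
      then have "exp (- real (card ?F)) * (real (card ?F) / (real k)\<^sup>2) \<le> exp (- real (card ?F)) * (real s / (real k)\<^sup>2)"
        by (intro mult_left_mono) auto
      then show "exp (- real (card ?F)) * (real (card ?F) / (real k)\<^sup>2) + exp (- 1) * exp (- real (card ?F)) \<le> ?b * exp (- real (card ?F))"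
        by (simp add: algebra_simps)
    qed
    finally show "(\<integral>\<^sup>+ y. ennreal (exp (- real (card (?R (x(i := y)) (insert i T))))) \<partial>unif_square)
       \<le> ennreal ?b * ennreal (exp (- real (card (?R x T))))"
      by (simp add: ennreal_mult)
  qed
  also have "\<dots> = ennreal ?b * (\<integral>\<^sup>+ x. ennreal (exp (- real (card (?R x T)))) \<partial>positions T)"
    by (rule nn_integral_cmult) (use insert meas in auto)
  also have "\<dots> \<le> ennreal ?b * ennreal (?b ^ card T)"
    using insert by (intro mult_left_mono) auto
  also have "\<dots> = ennreal (?b ^ card (insert i T))"
    using insert by (simp add: ennreal_mult)
  finally show ?case .
qed

lemma measure_few_occupied_le:
  assumes T: "finite T" and k: "0 < k" and e: "exp 1 * (real (card T) / (real k)\<^sup>2) \<le> \<epsilon> / 2"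
  shows "\<P>(\<omega> in positions T. real (card ((\<lambda>i. grid k (\<omega> i)) ` T)) \<le> (1 - \<epsilon>) * real (card T))
    \<le> exp (- (\<epsilon> * real (card T) / 2))"
proof -
  interpret P: prob_space "positions T" by (rule unif.prob_space_power)
  let ?O = "\<lambda>\<omega>. real (card ((\<lambda>i. grid k (\<omega> i)) ` T))"
  let ?E = "{\<omega> \<in> space (positions T). ?O \<omega> \<le> (1 - \<epsilon>) * real (card T)}"
  let ?q = "real (card T) / (real k)\<^sup>2"
  let ?a = "exp ((1 - \<epsilon>) * real (card T))"
  have E: "?E \<in> P.events" by (rule grid_image_sets) (use T k in auto)
  have meas: "(\<lambda>\<omega>. ennreal (exp (- ?O \<omega>))) \<in> borel_measurable (positions T)"
  proof (rule measurableI)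
    fix B :: "ennreal set"
    show "(\<lambda>\<omega>. ennreal (exp (- ?O \<omega>))) -` B \<inter> space (positions T) \<in> sets (positions T)"
      using grid_image_sets[OF T order_refl k, of "\<lambda>F. ennreal (exp (- real (card F))) \<in> B"]
      by (simp add: vimage_def Int_def conj_commute)
  qed simp
  have "emeasure (positions T) ?E = (\<integral>\<^sup>+ \<omega>. indicator ?E \<omega> \<partial>positions T)" using E by simp
  also have "\<dots> \<le> (\<integral>\<^sup>+ \<omega>. ennreal ?a * ennreal (exp (- ?O \<omega>)) \<partial>positions T)"
    by (rule nn_integral_mono)
       (auto simp: indicator_def mult_exp_exp ennreal_mult[symmetric] simp flip: ennreal_1 intro!: ennreal_leI)
  also have "\<dots> = ennreal ?a * (\<integral>\<^sup>+ \<omega>. ennreal (exp (- ?O \<omega>)) \<partial>positions T)"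
    by (rule nn_integral_cmult[OF meas])
  also have "\<dots> \<le> ennreal ?a * ennreal ((?q + exp (- 1)) ^ card T)"
    by (intro mult_left_mono nn_integral_exp_occupied T k) auto
  also have "\<dots> = ennreal (?a * (?q + exp (- 1)) ^ card T)"
    by (simp add: ennreal_mult)
  finally have "P.prob ?E \<le> ?a * (?q + exp (- 1)) ^ card T"
    by (simp add: P.emeasure_eq_measure)
  also have "\<dots> \<le> ?a * exp (\<epsilon> / 2 - 1) ^ card T"
  proof (intro mult_left_mono power_mono)
    have "?q + exp (- 1) = exp (- 1) * (1 + exp 1 * ?q)"
      by (simp add: algebra_simps mult_exp_exp)
    also have "\<dots> \<le> exp (- 1) * exp (\<epsilon> / 2)"
    proof -
      have "1 + exp 1 * ?q \<le> exp (\<epsilon> / 2)"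
        using exp_ge_add_one_self[of "\<epsilon> / 2"] e by linarith
      then show ?thesis by (rule mult_left_mono) simp
    qed
    also have "\<dots> = exp (\<epsilon> / 2 - 1)" by (simp add: mult_exp_exp)
    finally show "?q + exp (- 1) \<le> exp (\<epsilon> / 2 - 1)" .
  qed auto
  also have "\<dots> = exp (- (\<epsilon> * real (card T) / 2))"
    by (simp add: exp_of_nat_mult[symmetric] mult_exp_exp algebra_simps)
  finally show ?thesis .
qed

text \<open>The neighbourhood of a point set contains its grid cells, provided cells have diameter at most \<open>r\<close>.\<close>

lemma near_count_lower:
  assumes V: "finite V" "S \<subseteq> V" and k: "0 < k" "sqrt 2 / real k \<le> r"
    and e: "exp 1 * (real (card S) / (real k)\<^sup>2) \<le> \<epsilon> / 2" "0 \<le> \<epsilon>"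
  shows "\<P>(y in positions ({c} \<times> V).
      real (card (neighbours V S c r y))
        \<le> (1 - \<epsilon>) * (real (card (V - S)) * ((1 - \<epsilon>) * real (card S) / (real k)\<^sup>2)))
    \<le> exp (- (\<epsilon> * real (card S) / 2))
      + exp (- (\<epsilon>\<^sup>2 * (real (card (V - S)) * ((1 - \<epsilon>) * real (card S) / (real k)\<^sup>2)) / 2))"
proof (cases "\<epsilon> \<le> 1")
  case False
  let ?p = "(1 - \<epsilon>) * real (card S) / (real k)\<^sup>2"
  have "?p \<le> 0" using False by (simp add: divide_nonpos_nonneg mult_nonpos_nonneg)
  then have "real (card (V - S)) * ?p \<le> 0" by (intro mult_nonneg_nonpos) auto
  then have "\<epsilon>\<^sup>2 * (real (card (V - S)) * ?p) \<le> 0" by (rule mult_nonneg_nonpos[OF zero_le_power2])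
  moreover have "1 \<le> exp (- (z / 2))" if "z \<le> 0" for z :: real using that by simp
  ultimately have "1 \<le> exp (- (\<epsilon>\<^sup>2 * (real (card (V - S)) * ?p) / 2))" by blast
  then show ?thesis
    using prob_space.prob_le_1[OF unif.prob_space_power[of "{c} \<times> V"]] by (smt (verit) exp_ge_zero)
next
  case e1: True
  let ?J = "{c} \<times> S" and ?K = "{c} \<times> (V - S)"
  let ?I = "{c} \<times> V"
  let ?N = "\<lambda>y. neighbours V S c r y"
  let ?p = "(1 - \<epsilon>) * real (card S) / (real k)\<^sup>2"
  let ?\<mu> = "real (card (V - S)) * ?p"
  let ?O = "\<lambda>y. real (card ((\<lambda>i. grid k (y i)) ` ?J))"
  interpret P: prob_space "positions ?I" by (rule unif.prob_space_power)
  have un: "?J \<union> ?K = ?I" using V by auto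
  have fS: "finite S" using V finite_subset by blast
  have JI: "?J \<subseteq> ?I" using V by auto
  have fJ: "finite ?J" "finite ?K" "finite ?I" using V fS by auto
  have cardJ: "card ?J = card S" by (simp add: card_cartesian_product)
  have p0: "0 \<le> ?p" using e1 by simp
  let ?small = "\<lambda>y. ?O y \<le> (1 - \<epsilon>) * real (card S)"
  let ?few = "\<lambda>y. real (card (?N y)) \<le> (1 - \<epsilon>) * ?\<mu>"
  let ?sq = "\<lambda>y. \<forall>i\<in>?J. y i \<in> square"
  have sq_sets: "{y \<in> space (positions I'). ?sq y} \<in> sets (positions I')" if "?J \<subseteq> I'" for I'
    using fJ that by (intro sets.sets_Collect_finite_All vimage_position_sets square_borel) auto
  have few_sets: "{y \<in> space (positions ?I). ?few y} \<in> sets (positions ?I)"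
    by (rule near_set_sets) (use V fS in auto)
  have small_sets: "{y \<in> space (positions I'). ?small y} \<in> sets (positions I')" if "?J \<subseteq> I'" for I'
    by (rule grid_image_sets[OF fJ(1) that k(1)])
  let ?A1 = "{y \<in> space (positions ?I). ?small y}"
  let ?A2 = "{y \<in> space (positions ?I). (?sq y \<and> \<not> ?small y) \<and> (\<forall>i\<in>?K. y i \<in> square) \<and> ?few y}"
  have K_sets: "{y \<in> space (positions ?I). \<forall>i\<in>?K. y i \<in> square} \<in> sets (positions ?I)"
    using fJ V by (intro sets.sets_Collect_finite_All vimage_position_sets square_borel) auto
  have A: "?A1 \<in> P.events" "?A2 \<in> P.events"
    by (intro small_sets sets.sets_Collect_conj sets.sets_Collect_neg sq_sets few_sets K_sets JI)+
  have "P.prob {y \<in> space (positions ?I). ?few y} = P.prob {y \<in> space (positions ?I). (\<forall>i\<in>?I. y i \<in> square) \<and> ?few y}"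
    by (rule measure_positions_square(2)[OF fJ(3) few_sets])
  also have "\<dots> \<le> P.prob (?A1 \<union> ?A2)"
  proof (rule P.finite_measure_mono)
    show "{y \<in> space (positions ?I). (\<forall>i\<in>?I. y i \<in> square) \<and> ?few y} \<subseteq> ?A1 \<union> ?A2"
    proof
      fix y assume y: "y \<in> {y \<in> space (positions ?I). (\<forall>i\<in>?I. y i \<in> square) \<and> ?few y}"
      then have "?sq y" "\<forall>i\<in>?K. y i \<in> square" using un by blast+
      then show "y \<in> ?A1 \<union> ?A2" using y by blast
    qed
  qed (intro sets.Un A)
  also have "\<dots> \<le> P.prob ?A1 + P.prob ?A2" by (rule measure_Un_le) (fact A)+
  also have "P.prob ?A1 \<le> exp (- (\<epsilon> * real (card S) / 2))"
  proof -
    have "\<P>(y in positions (?J \<union> ?K). ?small y)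
        \<le> 1 * \<P>(y in positions ?J. ?small y)"
    proof (rule unif.measure_merge_le)
      have "(\<lambda>i. grid k (merge ?J ?K (x, y) i)) ` ?J = (\<lambda>i. grid k (x i)) ` ?J" for x y
        by (rule image_cong) (auto simp: merge_def)
      then show "?small (merge ?J ?K (x, y)) \<Longrightarrow> ?small x" for x y by simp
      show "{y \<in> space (positions (?J \<union> ?K)). ?small y} \<in> sets (positions (?J \<union> ?K))"
        by (rule small_sets) simp
    qed (use fJ small_sets[OF order_refl] prob_space.prob_le_1[OF unif.prob_space_power[of ?K]] in auto)
    also have "\<dots> \<le> exp (- (\<epsilon> * real (card S) / 2))"
      using measure_few_occupied_le[OF fJ(1) k(1), of \<epsilon>] e unfolding cardJ by simp
    finally show ?thesis unfolding un .
  qed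
  also have "P.prob ?A2 \<le> exp (- (\<epsilon>\<^sup>2 * ?\<mu> / 2))"
  proof -
    have "\<P>(y in positions (?J \<union> ?K). (?sq y \<and> \<not> ?small y) \<and> (\<forall>i\<in>?K. y i \<in> square) \<and> ?few y)
        \<le> exp (- (\<epsilon>\<^sup>2 * ?\<mu> / 2)) * \<P>(y in positions ?J. ?sq y \<and> \<not> ?small y)"
    proof (rule unif.measure_merge_le)
      show "{y \<in> space (positions (?J \<union> ?K)). (?sq y \<and> \<not> ?small y) \<and> (\<forall>i\<in>?K. y i \<in> square) \<and> ?few y} \<in> sets (positions (?J \<union> ?K))"
        unfolding un by (fact A(2))
      show "{y \<in> space (positions ?J). ?sq y \<and> \<not> ?small y} \<in> sets (positions ?J)"
        by (intro sets.sets_Collect_conj sets.sets_Collect_neg sq_sets small_sets order_refl)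
      have eq: "merge ?J ?K (x, y) i = x i" if "i \<in> ?J" for x y :: "nat \<times> nat \<Rightarrow> real \<times> real" and i using that by (simp add: merge_def)
      have eq_img: "(\<lambda>i. grid k (merge ?J ?K (x, y) i)) ` ?J = (\<lambda>i. grid k (x i)) ` ?J" for x y
        by (rule image_cong[OF refl]) (simp only: eq)
      show "?sq x \<and> \<not> ?small x" if "(?sq (merge ?J ?K (x, y)) \<and> \<not> ?small (merge ?J ?K (x, y))) \<and> (\<forall>i\<in>?K. merge ?J ?K (x, y) i \<in> square) \<and> ?few (merge ?J ?K (x, y))" for x y
      proof -
        have "?sq (merge ?J ?K (x, y))" "\<not> ?small (merge ?J ?K (x, y))" using that by blast+
        then show ?thesis unfolding eq_img using eq by (metis (no_types, lifting))
      qed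
      show "\<P>(y in positions ?K. (?sq (merge ?J ?K (x, y)) \<and> \<not> ?small (merge ?J ?K (x, y))) \<and> (\<forall>i\<in>?K. merge ?J ?K (x, y) i \<in> square) \<and> ?few (merge ?J ?K (x, y)))
         \<le> exp (- (\<epsilon>\<^sup>2 * ?\<mu> / 2))" if x: "?sq x \<and> \<not> ?small x" for x
      proof -
        interpret K: prob_space "positions ?K" by (rule unif.prob_space_power)
        let ?F = "(\<lambda>i. grid k (x i)) ` ?J"
        let ?B = "square \<inter> {z. grid k z \<in> ?F}"
        have B: "?B \<in> sets borel" by (intro sets.Int square_borel grid_measurable_set)
        have FG: "?F \<subseteq> {..<k} \<times> {..<k}" by (rule image_subsetI, rule grid_mem[OF k(1)])
        have "measure unif_square ?B = measure unif_square {z. grid k z \<in> ?F}"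
          using measure_unif_square[OF B] measure_unif_square[OF grid_measurable_set[of k ?F]] by (simp add: Int_assoc[symmetric])
        also have "\<dots> = real (card ?F) / (real k)\<^sup>2" by (rule measure_grid_set[OF k(1) FG])
        finally have mB: "?p \<le> measure unif_square ?B"
          using x k(1) by (simp add: divide_right_mono)
        have Ks: "{y \<in> space (positions ?K). real (card {i \<in> ?K. y i \<in> ?B}) \<le> (1 - \<epsilon>) * (real (card ?K) * ?p)} \<in> K.events"
        proof -
          have [measurable]: "(\<lambda>y. real (card {i \<in> ?K. y i \<in> ?B})) \<in> borel_measurable (positions ?K)"
            by (rule unif.count_measurable) (use fJ B in simp_all)
          show ?thesis by measurable
        qed
        have cardK: "card ?K = card (V - S)" by (simp add: card_cartesian_product)
        have "\<P>(y in positions ?K. (?sq (merge ?J ?K (x, y)) \<and> \<not> ?small (merge ?J ?K (x, y))) \<and> (\<forall>i\<in>?K. merge ?J ?K (x, y) i \<in> square) \<and> ?few (merge ?J ?K (x, y)))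
          \<le> \<P>(y in positions ?K. real (card {i \<in> ?K. y i \<in> ?B}) \<le> (1 - \<epsilon>) * (real (card ?K) * ?p))"
        proof (rule K.finite_measure_mono[OF _ Ks], intro subsetI CollectI conjI; elim CollectE conjE)
          fix y assume few: "?few (merge ?J ?K (x, y))"
          have "{w \<in> V - S. y (c, w) \<in> ?B} \<subseteq> ?N (merge ?J ?K (x, y))"
          proof
            fix w assume w: "w \<in> {w \<in> V - S. y (c, w) \<in> ?B}"
            then obtain s where s: "s \<in> S" "grid k (y (c, w)) = grid k (x (c, s))" by auto
            have "dist (x (c, s)) (y (c, w)) \<le> r"
              by (rule grid_dist[OF k(1) _ _ _ k(2)]) (use x s w in auto)
            moreover have "merge ?J ?K (x, y) (c, s) = x (c, s)" "merge ?J ?K (x, y) (c, w) = y (c, w)"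
              using s w by (simp_all add: merge_def)
            ultimately have "dist (merge ?J ?K (x, y) (c, s)) (merge ?J ?K (x, y) (c, w)) \<le> r" by (simp only:)
            then show "w \<in> ?N (merge ?J ?K (x, y))" using s(1) w by blast
          qed
          then have "card {w \<in> V - S. y (c, w) \<in> ?B} \<le> card (?N (merge ?J ?K (x, y)))"
            by (rule card_mono[rotated]) (use V in simp)
          then show "real (card {i \<in> ?K. y i \<in> ?B}) \<le> (1 - \<epsilon>) * (real (card ?K) * ?p)"
            using few unfolding card_pair_index cardK by linarith
        qed
        also have "\<dots> \<le> exp (- (\<epsilon>\<^sup>2 * (real (card ?K) * ?p) / 2))"
          by (rule count_lower_tail[OF fJ(2) order_refl B mB p0 e(2)])
        finally show ?thesis unfolding cardK .
      qed
    qed (use fJ in auto)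
    also have "\<dots> \<le> exp (- (\<epsilon>\<^sup>2 * ?\<mu> / 2)) * 1"
      using prob_space.prob_le_1[OF unif.prob_space_power[of ?J]] by (intro mult_left_mono) auto
    finally show ?thesis unfolding un by simp
  qed
  finally show ?thesis by simp
qed

text \<open>The sample space also contains positions outside the square. They form a null set, so the
  revealed position of \<open>s\<close> may be assumed to lie in the square.\<close>

lemma measure_merge_point_le:
  assumes V: "finite V" "s \<in> V" and q: "0 \<le> q"
    and meas: "{y \<in> space (positions ({c} \<times> V)). \<phi> y} \<in> sets (positions ({c} \<times> V))"
    and inner: "\<And>x. x \<in> square \<Longrightarrow>
      \<P>(y in positions ({c} \<times> (V - {s})). \<phi> (y((c, s) := x))) \<le> q"
  shows "\<P>(y in positions ({c} \<times> V). \<phi> y) \<le> q"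
proof -
  let ?J = "{(c, s)}" and ?K = "{c} \<times> (V - {s})" and ?I = "{c} \<times> V"
  have un: "?J \<union> ?K = ?I" using V by auto
  have fI: "finite ?I" using V by auto
  interpret P: prob_space "positions ?I" by (rule unif.prob_space_power)
  let ?\<psi> = "\<lambda>y. y (c, s) \<in> square"
  have "(c, s) \<in> ?I" using V by simp
  then have m: "{y \<in> space (positions ?I). ?\<psi> y \<and> \<phi> y} \<in> sets (positions ?I)"
    by (intro sets.sets_Collect_conj vimage_position_sets square_borel meas)
  have "P.prob {y \<in> space (positions ?I). \<phi> y} = P.prob {y \<in> space (positions ?I). (\<forall>i\<in>?I. y i \<in> square) \<and> \<phi> y}"
    by (rule measure_positions_square(2)[OF fI meas])
  also have "\<dots> \<le> P.prob {y \<in> space (positions ?I). ?\<psi> y \<and> \<phi> y}"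
    by (rule P.finite_measure_mono[OF _ m]) (use V in blast)
  also have "\<dots> \<le> q"
  proof -
    have "\<P>(y in positions (?J \<union> ?K). ?\<psi> y \<and> \<phi> y)
        \<le> q * \<P>(y in positions ?J. ?\<psi> y)"
    proof (rule unif.measure_merge_le)
      show "{y \<in> space (positions (?J \<union> ?K)). ?\<psi> y \<and> \<phi> y} \<in> sets (positions (?J \<union> ?K))"
        unfolding un by (rule m)
      show "{y \<in> space (positions ?J). ?\<psi> y} \<in> sets (positions ?J)"
        by (intro vimage_position_sets square_borel) auto
      show "?\<psi> x" if "?\<psi> (merge ?J ?K (x, y)) \<and> \<phi> (merge ?J ?K (x, y))" for x y
        using that by (simp add: merge_def)
      show "\<P>(y in positions ?K. ?\<psi> (merge ?J ?K (x, y)) \<and> \<phi> (merge ?J ?K (x, y))) \<le> q"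
        if x: "?\<psi> x" for x
      proof -
        have "merge ?J ?K (x, y) = y((c, s) := x (c, s))" if "y \<in> space (positions ?K)" for y
          using that by (auto simp: merge_def space_PiM PiE_def extensional_def fun_eq_iff)
        then have "{y \<in> space (positions ?K). ?\<psi> (merge ?J ?K (x, y)) \<and> \<phi> (merge ?J ?K (x, y))}
          = {y \<in> space (positions ?K). \<phi> (y((c, s) := x (c, s)))}"
          using x by auto
        then show ?thesis using inner[OF x] by simp
      qed
    qed (use V q in auto)
    also have "\<dots> \<le> q * 1"
      using q prob_space.prob_le_1[OF unif.prob_space_power[of ?J]] by (intro mult_left_mono) auto
    finally show ?thesis unfolding un by simp
  qed
  finally show ?thesis .
qed

lemma near_count_point_lower:
  assumes V: "finite V" "s \<in> V" and r: "0 \<le> r" "r \<le> 1 / 2" and e: "0 \<le> \<epsilon>"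
  shows "\<P>(y in positions ({c} \<times> V).
      real (card (neighbours V {s} c r y))
        \<le> (1 - \<epsilon>) * (real (card (V - {s})) * (pi * r\<^sup>2 / 4)))
    \<le> exp (- (\<epsilon>\<^sup>2 * (real (card (V - {s})) * (pi * r\<^sup>2 / 4)) / 2))"
    (is "measure _ {y \<in> _. ?few y} \<le> ?q")
proof (rule measure_merge_point_le[OF V])
  show "{y \<in> space (positions ({c} \<times> V)). ?few y} \<in> sets (positions ({c} \<times> V))"
    by (rule near_set_sets) (use V in auto)
  fix x :: "real \<times> real" assume x: "x \<in> square"
  let ?K = "{c} \<times> (V - {s})"
  interpret K: prob_space "positions ?K" by (rule unif.prob_space_power)
  have fK: "finite ?K" using V by auto
  have cardK: "card ?K = card (V - {s})" by (simp add: card_cartesian_product)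
  have B: "cball x r \<in> sets borel" by simp
  have Ks: "{y \<in> space (positions ?K). real (card {i \<in> ?K. y i \<in> cball x r}) \<le> (1 - \<epsilon>) * (real (card ?K) * (pi * r\<^sup>2 / 4))} \<in> K.events"
  proof -
    have [measurable]: "(\<lambda>y. real (card {i \<in> ?K. y i \<in> cball x r})) \<in> borel_measurable (positions ?K)"
      by (rule unif.count_measurable) (use fK B in simp_all)
    show ?thesis by measurable
  qed
  have "K.prob {y \<in> space (positions ?K). ?few (y((c, s) := x))}
    \<le> K.prob {y \<in> space (positions ?K). real (card {i \<in> ?K. y i \<in> cball x r}) \<le> (1 - \<epsilon>) * (real (card ?K) * (pi * r\<^sup>2 / 4))}"
  proof (rule K.finite_measure_mono[OF _ Ks], intro subsetI CollectI conjI; elim CollectE conjE)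
    fix y assume few: "?few (y((c, s) := x))"
    have "card {w \<in> V - {s}. y (c, w) \<in> cball x r} \<le> card {w \<in> V. \<exists>t\<in>{s}. dist ((y((c, s) := x)) (c, t)) ((y((c, s) := x)) (c, w)) \<le> r}"
      by (rule card_mono) (use V in auto)
    then show "real (card {i \<in> ?K. y i \<in> cball x r}) \<le> (1 - \<epsilon>) * (real (card ?K) * (pi * r\<^sup>2 / 4))"
      using few unfolding card_pair_index cardK by linarith
  qed
  also have "\<dots> \<le> exp (- (\<epsilon>\<^sup>2 * (real (card ?K) * (pi * r\<^sup>2 / 4)) / 2))"
    by (rule count_lower_tail[OF fK order_refl B measure_cball_quarter[OF r x] _ e]) simp
  finally show "K.prob {y \<in> space (positions ?K). ?few (y((c, s) := x))} \<le> ?q" unfolding cardK .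
qed simp

lemma measure_no_near_le:
  assumes V: "finite V" "S \<subseteq> V" "v \<in> V" and r: "0 \<le> r" "r \<le> 1 / 2"
  shows "\<P>(y in positions ({c} \<times> V).
      v \<notin> neighbours V S c r y)
    \<le> exp (- (real (card S) * (pi * r\<^sup>2 / 4)))"
    (is "measure _ {y \<in> _. ?none y} \<le> ?q")
proof (cases "v \<in> S")
  case True
  then have emp: "{y \<in> space (positions ({c} \<times> V)). ?none y} = {}" using V r by (auto intro!: bexI[of _ v])
  show ?thesis unfolding emp by simp
next
  case False
  have fS: "finite S" using V finite_subset by blast
  show ?thesis
  proof (rule measure_merge_point_le[OF V(1,3)])
    show "{y \<in> space (positions ({c} \<times> V)). ?none y} \<in> sets (positions ({c} \<times> V))"
      by (rule near_set_sets) (use V fS in auto)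
    fix x :: "real \<times> real" assume x: "x \<in> square"
    let ?K = "{c} \<times> (V - {v})"
    have eq: "{y \<in> space (positions ?K). ?none (y((c, v) := x))} = {y \<in> space (positions ?K). \<forall>i\<in>{c} \<times> S. y i \<in> - cball x r}"
      using False V by (auto simp: dist_commute)
    have "\<P>(y in positions ?K. \<forall>i\<in>{c} \<times> S. y i \<in> - cball x r)
       = (\<Prod>i\<in>{c} \<times> S. measure unif_square (- cball x r))"
      by (rule unif.measure_coords) (use V False in auto)
    also have "\<dots> \<le> (\<Prod>i\<in>{c} \<times> S. exp (- (pi * r\<^sup>2 / 4)))"
    proof (rule prod_mono, intro conjI)
      have "measure unif_square (- cball x r) = 1 - measure unif_square (cball x r)"
        using unif.prob_compl[of "cball x r"] by (simp add: Compl_eq_Diff_UNIV)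
      also have "\<dots> \<le> 1 + - (pi * r\<^sup>2 / 4)" using measure_cball_quarter[OF r x] by simp
      also have "\<dots> \<le> exp (- (pi * r\<^sup>2 / 4))" by (rule exp_ge_add_one_self)
      finally show "measure unif_square (- cball x r) \<le> exp (- (pi * r\<^sup>2 / 4))" .
    qed simp
    also have "\<dots> = exp (- (real (card S) * (pi * r\<^sup>2 / 4)))"
      by (simp add: card_cartesian_product exp_of_nat_mult[symmetric])
    finally show "\<P>(y in positions ?K. ?none (y((c, v) := x))) \<le> ?q"
      unfolding eq .
  qed simp
qed

lemma reach_chain:
  fixes a :: "nat \<Rightarrow> real"
  assumes I: "{1..h} \<times> {..<n} \<subseteq> I" "finite I" and uv: "u < n" and a0: "a 0 \<le> 1" and q: "0 \<le> q"
    and step: "\<And>j S. j < m \<Longrightarrow> S \<subseteq> {..<n} \<Longrightarrow> a j \<le> real (card S) \<Longrightarrow>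
      \<P>(y in positions ({Suc j} \<times> {..<n}).
        real (card (neighbours {..<n} S (Suc j) r y)) < a (Suc j)) \<le> q"
    and mh: "m \<le> h" and k: "k \<le> m"
  shows "\<P>(\<omega> in positions I.
       real (card (reach {..<n} r \<omega> u (rev [1..<Suc k]))) < a k) \<le> real k * q"
  using k
proof (induction k)
  case 0
  have emp: "{\<omega> \<in> space (positions I). real (card (reach {..<n} r \<omega> u (rev [1..<Suc 0]))) < a 0} = {}"
    using a0 by auto
  show ?case unfolding emp by simp
next
  case (Suc k)
  interpret P: prob_space "positions I" by (rule unif.prob_space_power)
  have L: "rev [1..<Suc (Suc k)] = Suc k # rev [1..<Suc k]" by simp
  let ?R = "\<lambda>\<omega>. reach {..<n} r \<omega> u (rev [1..<Suc k])"
  let ?R' = "\<lambda>\<omega>. reach {..<n} r \<omega> u (Suc k # rev [1..<Suc k])"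
  let ?E1 = "{\<omega> \<in> space (positions I). real (card (?R \<omega>)) < a k}"
  let ?E2 = "{\<omega> \<in> space (positions I). a k \<le> real (card (?R \<omega>)) \<and> real (card (?R' \<omega>)) < a (Suc k)}"
  have sub: "set (rev [1..<Suc k]) \<times> insert u {..<n} \<subseteq> I" "set (Suc k # rev [1..<Suc k]) \<times> insert u {..<n} \<subseteq> I"
    using I Suc.prems mh uv by auto
  have m: "?E1 \<in> P.events" "?E2 \<in> P.events"
    by (intro sets.sets_Collect_conj reach_positions_sets_pred sub finite_lessThan)+
  have "P.prob {\<omega> \<in> space (positions I). real (card (?R' \<omega>)) < a (Suc k)} \<le> P.prob (?E1 \<union> ?E2)"
  proof (rule P.finite_measure_mono)
    show "{\<omega> \<in> space (positions I). real (card (?R' \<omega>)) < a (Suc k)} \<subseteq> ?E1 \<union> ?E2"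
      using not_less by blast
  qed (intro sets.Un m)
  also have "\<dots> \<le> P.prob ?E1 + P.prob ?E2" by (rule measure_Un_le) (fact m)+
  also have "P.prob ?E1 \<le> real k * q" by (rule Suc.IH) (use Suc.prems in simp)
  also have "P.prob ?E2 \<le> q"
  proof (rule measure_reach_step_le[where V = "{..<n}"])
    show "\<P>(y in positions ({Suc k} \<times> {..<n}).
        real (card (neighbours {..<n} S (Suc k) r y)) < a (Suc k)) \<le> q"
      if "S \<subseteq> insert u {..<n}" "a k \<le> real (card S)" for S
      by (rule step) (use that uv Suc.prems in auto)
  qed (use I uv q Suc.prems mh in auto)
  finally show ?case unfolding L by (simp add: algebra_simps)
qed

lemma measure_not_reach_le:
  fixes a :: "nat \<Rightarrow> real"
  assumes h: "1 \<le> h" and uv: "u < n" "v < n" and a0: "a 0 \<le> 1" and q: "0 \<le> q" and r: "0 \<le> r" "r \<le> 1 / 2"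
    and step: "\<And>j S. j < h - 1 \<Longrightarrow> S \<subseteq> {..<n} \<Longrightarrow> a j \<le> real (card S) \<Longrightarrow>
      \<P>(y in positions ({Suc j} \<times> {..<n}).
        real (card (neighbours {..<n} S (Suc j) r y)) < a (Suc j)) \<le> q"
  shows "\<P>(\<omega> in positions ({1..h} \<times> {..<n}).
       v \<notin> reach {..<n} r \<omega> u (rev [1..<Suc h])) \<le> real h * q + exp (- (a (h - 1) * (pi * r\<^sup>2 / 4)))"
proof -
  let ?I = "{1..h} \<times> {..<n}"
  interpret P: prob_space "positions ?I" by (rule unif.prob_space_power)
  have hh: "h = Suc (h - 1)" using h by simp
  have L: "rev [1..<Suc h] = h # rev [1..<Suc (h - 1)]" using hh by (metis One_nat_def Suc_le_mono le0 rev.simps(2) rev_append rev_singleton_conv append_Cons append_Nil upt_Suc_append)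
  let ?R = "\<lambda>\<omega>. reach {..<n} r \<omega> u (rev [1..<Suc (h - 1)])"
  let ?R' = "\<lambda>\<omega>. reach {..<n} r \<omega> u (h # rev [1..<Suc (h - 1)])"
  let ?E1 = "{\<omega> \<in> space (positions ?I). real (card (?R \<omega>)) < a (h - 1)}"
  let ?E2 = "{\<omega> \<in> space (positions ?I). a (h - 1) \<le> real (card (?R \<omega>)) \<and> v \<notin> ?R' \<omega>}"
  have sub: "set (rev [1..<Suc (h - 1)]) \<times> insert u {..<n} \<subseteq> ?I" "set (h # rev [1..<Suc (h - 1)]) \<times> insert u {..<n} \<subseteq> ?I"
    using h uv by auto
  have m: "?E1 \<in> P.events" "?E2 \<in> P.events"
    by (intro sets.sets_Collect_conj reach_positions_sets_pred sub finite_lessThan)+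
  have "P.prob {\<omega> \<in> space (positions ?I). v \<notin> ?R' \<omega>} \<le> P.prob (?E1 \<union> ?E2)"
  proof (rule P.finite_measure_mono)
    show "{\<omega> \<in> space (positions ?I). v \<notin> ?R' \<omega>} \<subseteq> ?E1 \<union> ?E2"
      using not_less by blast
  qed (intro sets.Un m)
  also have "\<dots> \<le> P.prob ?E1 + P.prob ?E2" by (rule measure_Un_le) (fact m)+
  also have "P.prob ?E1 \<le> real (h - 1) * q"
    by (rule reach_chain[where m = "h - 1" and h = h]) (use assms in auto)
  also have "real (h - 1) * q \<le> real h * q" using q by (intro mult_right_mono) auto
  also have "P.prob ?E2 \<le> exp (- (a (h - 1) * (pi * r\<^sup>2 / 4)))"
  proof (rule measure_reach_step_le[where V = "{..<n}"])
    fix S assume S: "S \<subseteq> insert u {..<n}" "a (h - 1) \<le> real (card S)"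
    have "\<P>(y in positions ({h} \<times> {..<n}).
        v \<notin> neighbours {..<n} S h r y) \<le> exp (- (real (card S) * (pi * r\<^sup>2 / 4)))"
      by (rule measure_no_near_le) (use S uv r in auto)
    also have "\<dots> \<le> exp (- (a (h - 1) * (pi * r\<^sup>2 / 4)))"
      using S(2) by (simp add: mult_right_mono)
    finally show "\<P>(y in positions ({h} \<times> {..<n}).
        v \<notin> neighbours {..<n} S h r y) \<le> exp (- (a (h - 1) * (pi * r\<^sup>2 / 4)))" .
  qed (use h uv in auto)
  finally show ?thesis unfolding L by simp
qed

lemma measure_disconnected_le:
  assumes r: "0 \<le> q"
    and pair: "\<And>u v. u < n \<Longrightarrow> v < n \<Longrightarrow> u \<noteq> v \<Longrightarrow>
      \<P>(\<omega> in rgg_space n h. \<forall>cs\<in>rainbow_colours h. v \<notin> reach {..<n} r \<omega> u cs) \<le> q"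
  shows "\<P>(\<omega> in rgg_space n h. \<not> rainbow_connected n h r \<omega>) \<le> (real n)\<^sup>2 * q"
proof -
  let ?M = "rgg_space n h"
  interpret P: prob_space ?M unfolding rgg_space_eq by (rule unif.prob_space_power)
  let ?T = "{(u, v). u < n \<and> v < n \<and> u \<noteq> v}"
  let ?R = "\<lambda>(u, v). {\<omega> \<in> space ?M. \<forall>cs\<in>rainbow_colours h. v \<notin> reach {..<n} r \<omega> u cs}"
  have T: "?T \<subseteq> {..<n} \<times> {..<n}" by auto
  have fT: "finite ?T" by (rule finite_subset[OF T]) auto
  have Rm: "?R t \<in> P.events" if t: "t \<in> ?T" for t
  proof -
    obtain u v where uv: "t = (u, v)" by (cases t)
    show ?thesis unfolding uv prod.case rgg_space_eq
      by (intro sets.sets_Collect_finite_All sets.sets_Collect_neg reach_positions_sets finite_rainbow_colours finite_lessThan)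
         (use t uv in \<open>auto simp: rainbow_colours_def\<close>)
  qed
  have "{\<omega> \<in> space ?M. \<not> rainbow_connected n h r \<omega>} \<subseteq> (\<Union>t\<in>?T. ?R t)"
  proof
    fix \<omega> assume w: "\<omega> \<in> {\<omega> \<in> space ?M. \<not> rainbow_connected n h r \<omega>}"
    then obtain u v where "(u, v) \<in> ?T" "\<omega> \<in> ?R (u, v)"
      unfolding rainbow_connected_iff by blast
    then show "\<omega> \<in> (\<Union>t\<in>?T. ?R t)" by (rule UN_I)
  qed
  then have "P.prob {\<omega> \<in> space ?M. \<not> rainbow_connected n h r \<omega>} \<le> P.prob (\<Union>t\<in>?T. ?R t)"
    by (rule P.finite_measure_mono) (rule sets.finite_UN[OF fT Rm])
  also have "\<dots> \<le> (\<Sum>t\<in>?T. P.prob (?R t))"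
    by (rule P.finite_measure_subadditive_finite[OF fT image_subsetI]) (rule Rm)
  also have "\<dots> \<le> (\<Sum>t\<in>?T. q)"
    by (rule sum_mono) (use pair in auto)
  also have "\<dots> = real (card ?T) * q" by simp
  also have "\<dots> \<le> (real n)\<^sup>2 * q"
    using card_mono[OF _ T] r by (intro mult_right_mono) (simp_all add: power2_eq_square flip: of_nat_mult)
  finally show ?thesis .
qed

section \<open>Two layers\<close>

abbreviation no_common_neighbour ::
  "nat \<Rightarrow> nat \<Rightarrow> nat \<Rightarrow> nat \<Rightarrow> nat set \<Rightarrow> real \<Rightarrow> (nat \<times> nat \<Rightarrow> real \<times> real) \<Rightarrow> bool" where
  "no_common_neighbour c d u v W r b \<equiv>
     \<forall>w\<in>W. \<not> (dist (b (c, u)) (b (c, w)) \<le> r \<and> dist (b (d, v)) (b (d, w)) \<le> r)"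

lemma no_common_neighbour_sets:
  assumes "finite W" "{(c, u), (d, v)} \<union> {c, d} \<times> W \<subseteq> I"
  shows "{\<omega> \<in> space (positions I). no_common_neighbour c d u v W r \<omega>} \<in> sets (positions I)"
  using assms by (intro sets.sets_Collect_finite_All sets.sets_Collect_neg sets.sets_Collect_conj dist_le_sets position_measurable) auto

lemma no_common_fixed_le:
  assumes K: "finite K" "{c, d} \<times> W \<subseteq> K" and cd: "c \<noteq> d"
    and al: "\<alpha> \<le> measure unif_square (cball p r) * measure unif_square (cball q r)"
  shows "\<P>(y in positions K. \<forall>w\<in>W. \<not> (dist p (y (c, w)) \<le> r \<and> dist q (y (d, w)) \<le> r))
     \<le> exp (- (real (card W) * \<alpha>))"
proof -
  interpret K: prob_space "positions K" by (rule unif.prob_space_power)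
  let ?L = "\<lambda>w. {(c, w), (d, w)}"
  let ?\<phi> = "\<lambda>w y. \<not> (dist p (y (c, w)) \<le> r \<and> dist q (y (d, w)) \<le> r)"
  have fW: "finite W"
    using finite_subset[OF K(2) K(1)] finite_cartesian_productD2[of "{c, d}" W] by simp
  have "K.prob {y \<in> space (positions K). \<forall>w\<in>W. ?\<phi> w y} = (\<Prod>w\<in>W. K.prob {y \<in> space (positions K). ?\<phi> w y})"
  proof (rule unif.measure_blocks[where L = ?L])
    show "{\<eta> \<in> space (positions (?L w)). ?\<phi> w \<eta>} \<in> sets (positions (?L w))" for w
    proof -
      have "{\<eta> \<in> space (positions (?L w)). \<not> (\<eta> (c, w) \<in> cball p r \<and> \<eta> (d, w) \<in> cball q r)} \<in> sets (positions (?L w))"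
        by (intro sets.sets_Collect_neg sets.sets_Collect_conj vimage_position_sets) auto
      then show ?thesis by simp
    qed
  qed (use K fW cd in \<open>auto simp: disjoint_family_on_def\<close>)
  also have "\<dots> \<le> (\<Prod>w\<in>W. exp (- \<alpha>))"
  proof (rule prod_mono, intro conjI)
    fix w assume w: "w \<in> W"
    let ?B = "\<lambda>i. if fst i = c then cball p r else cball q r"
    let ?F = "{y \<in> space (positions K). \<forall>i\<in>?L w. y i \<in> ?B i}"
    have LK: "?L w \<subseteq> K" using w K by auto
    have Fm: "?F \<in> K.events"
      using LK by (intro sets.sets_Collect_finite_All vimage_position_sets) auto
    have "K.prob ?F = (\<Prod>i\<in>?L w. measure unif_square (?B i))"
      by (rule unif.measure_coords[OF K(1) LK]) auto
    also have "\<dots> = measure unif_square (cball p r) * measure unif_square (cball q r)"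
      using cd by auto
    finally have "\<alpha> \<le> K.prob ?F" using al by simp
    moreover have "{y \<in> space (positions K). ?\<phi> w y} = space (positions K) - ?F"
      using cd by auto
    ultimately have "K.prob {y \<in> space (positions K). ?\<phi> w y} \<le> 1 + - \<alpha>"
      using K.prob_compl[OF Fm] by simp
    also have "\<dots> \<le> exp (- \<alpha>)" by (rule exp_ge_add_one_self)
    finally show "K.prob {y \<in> space (positions K). ?\<phi> w y} \<le> exp (- \<alpha>)" .
  qed simp
  also have "\<dots> = exp (- (real (card W) * \<alpha>))" by (simp add: exp_of_nat_mult[symmetric])
  finally show ?thesis .
qed

lemma no_common_region_le:
  assumes I: "finite I" "{(c, u), (d, v)} \<union> {c, d} \<times> W \<subseteq> I" and cd: "c \<noteq> d" and uv: "u \<notin> W" "v \<notin> W"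
    and C: "{x \<in> space (positions {(c, u), (d, v)}). C (x (c, u)) (x (d, v))} \<in> sets (positions {(c, u), (d, v)})"
      "{x \<in> space (positions I). C (x (c, u)) (x (d, v))} \<in> sets (positions I)"
    and al: "\<And>p q. C p q \<Longrightarrow> \<alpha> \<le> measure unif_square (cball p r) * measure unif_square (cball q r)"
  shows "\<P>(\<omega> in positions I. C (\<omega> (c, u)) (\<omega> (d, v)) \<and> no_common_neighbour c d u v W r \<omega>)
     \<le> exp (- (real (card W) * \<alpha>)) *
       \<P>(x in positions {(c, u), (d, v)}. C (x (c, u)) (x (d, v)))"
proof -
  let ?J = "{(c, u), (d, v)}"
  let ?K = "I - ?J"
  have un: "?J \<union> ?K = I" using I by auto
  have fW: "finite W"
    using finite_subset[OF I(2) I(1)] finite_cartesian_productD2[of "{c, d}" W] by simp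
  have eq: "merge ?J ?K (x, y) (c, u) = x (c, u)" "merge ?J ?K (x, y) (d, v) = x (d, v)" for x y :: "nat \<times> nat \<Rightarrow> real \<times> real"
    by (simp_all add: merge_def)
  have eqW: "merge ?J ?K (x, y) (c, w) = y (c, w)" "merge ?J ?K (x, y) (d, w) = y (d, w)" if "w \<in> W" for x y :: "nat \<times> nat \<Rightarrow> real \<times> real" and w
    using that uv I by (auto simp: merge_def)
  have "\<P>(\<omega> in positions (?J \<union> ?K). C (\<omega> (c, u)) (\<omega> (d, v)) \<and> no_common_neighbour c d u v W r \<omega>)
     \<le> exp (- (real (card W) * \<alpha>)) * \<P>(x in positions ?J. C (x (c, u)) (x (d, v)))"
  proof (rule unif.measure_merge_le)
    show "{\<omega> \<in> space (positions (?J \<union> ?K)). C (\<omega> (c, u)) (\<omega> (d, v)) \<and> no_common_neighbour c d u v W r \<omega>} \<in> sets (positions (?J \<union> ?K))"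
      unfolding un by (rule sets.sets_Collect_conj[OF no_common_neighbour_sets[OF fW I(2)] C(2)])
    show "C (x (c, u)) (x (d, v))" if "C (merge ?J ?K (x, y) (c, u)) (merge ?J ?K (x, y) (d, v)) \<and> no_common_neighbour c d u v W r (merge ?J ?K (x, y))" for x y
      using that unfolding eq by blast
    show "\<P>(y in positions ?K. C (merge ?J ?K (x, y) (c, u)) (merge ?J ?K (x, y) (d, v)) \<and> no_common_neighbour c d u v W r (merge ?J ?K (x, y)))
        \<le> exp (- (real (card W) * \<alpha>))" if x: "C (x (c, u)) (x (d, v))" for x
    proof -
      have "{y \<in> space (positions ?K). C (merge ?J ?K (x, y) (c, u)) (merge ?J ?K (x, y) (d, v)) \<and> no_common_neighbour c d u v W r (merge ?J ?K (x, y))}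
        = {y \<in> space (positions ?K). \<forall>w\<in>W. \<not> (dist (x (c, u)) (y (c, w)) \<le> r \<and> dist (x (d, v)) (y (d, w)) \<le> r)}"
        unfolding eq using x by (intro Collect_cong conj_cong refl) (simp add: eqW)
      moreover have "{c, d} \<times> W \<subseteq> ?K" using I uv by auto
      ultimately show ?thesis using no_common_fixed_le[of ?K c d W \<alpha> "x (c, u)" r "x (d, v)"] I cd al[OF x] by simp
    qed
  qed (use I C in auto)
  then show ?thesis unfolding un .
qed

definition no_common_bound :: "real \<Rightarrow> real \<Rightarrow> real" where
  "no_common_bound N r = exp (- (N * (pi * r\<^sup>2)\<^sup>2 / 4)) + 8 * r\<^sup>2 * exp (- (N * (pi * r\<^sup>2)\<^sup>2 / 8))
     + 16 * (r\<^sup>2)\<^sup>2 * exp (- (N * (pi * r\<^sup>2)\<^sup>2 / 16))"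

lemma no_common_bound_nonneg: "0 \<le> no_common_bound N r"
  by (simp add: no_common_bound_def)

lemma no_common_bound_mono: "N \<le> N' \<Longrightarrow> no_common_bound N' r \<le> no_common_bound N r"
  unfolding no_common_bound_def by (intro add_mono mult_left_mono) (auto intro!: divide_right_mono mult_right_mono)

text \<open>A point has a full half disc around it unless it is near a corner of the square; the three
  summands of the bound account for zero, one or two of the end positions being near a corner.\<close>

lemma measure_no_common_le:
  assumes I: "finite I" "{(c, u), (d, v)} \<union> {c, d} \<times> W \<subseteq> I" and cd: "c \<noteq> d" and uv: "u \<notin> W" "v \<notin> W"
    and r: "0 \<le> r" "r \<le> 1 / 2"
  shows "\<P>(\<omega> in positions I. no_common_neighbour c d u v W r \<omega>) \<le> no_common_bound (real (card W)) r"
proof -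
  let ?J = "{(c, u), (d, v)}"
  let ?N = "real (card W)"
  interpret P: prob_space "positions I" by (rule unif.prob_space_power)
  interpret J: prob_space "positions ?J" by (rule unif.prob_space_power)
  have fW: "finite W"
    using finite_subset[OF I(2) I(1)] finite_cartesian_productD2[of "{c, d}" W] by simp
  note none = no_common_neighbour_sets[OF fW I(2), of r]
  let ?S = "\<lambda>p q. p \<in> square \<and> q \<in> square"
  let ?k = "\<lambda>p. p \<in> {x. corner r x}"
  let ?C0 = "\<lambda>p q. ?S p q \<and> \<not> ?k p \<and> \<not> ?k q"
  let ?C1 = "\<lambda>p q. ?S p q \<and> (?k p \<and> \<not> ?k q \<or> \<not> ?k p \<and> ?k q)"
  let ?C2 = "\<lambda>p q. ?S p q \<and> ?k p \<and> ?k q"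
  have ms: "{x \<in> space (positions I'). ?C0 (x (c, u)) (x (d, v))} \<in> sets (positions I')"
    "{x \<in> space (positions I'). ?C1 (x (c, u)) (x (d, v))} \<in> sets (positions I')"
    "{x \<in> space (positions I'). ?C2 (x (c, u)) (x (d, v))} \<in> sets (positions I')" if "?J \<subseteq> I'" for I'
    using that by (intro sets.sets_Collect_conj sets.sets_Collect_disj sets.sets_Collect_neg
        vimage_position_sets square_borel corner_measurable; simp)+
  have JI: "?J \<subseteq> I" using I by auto
  let ?E = "\<lambda>C. {\<omega> \<in> space (positions I). C (\<omega> (c, u)) (\<omega> (d, v)) \<and> no_common_neighbour c d u v W r \<omega>}"
  have Em: "?E ?C0 \<in> P.events" "?E ?C1 \<in> P.events" "?E ?C2 \<in> P.events"
    by (rule sets.sets_Collect_conj[OF none], rule ms[OF JI])+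
  have half: "pi * r\<^sup>2 / 2 \<le> measure unif_square (cball p r)" if "p \<in> square" "\<not> ?k p" for p
    using measure_cball_half[OF r that(1)] that(2) by simp
  have quarter: "pi * r\<^sup>2 / 4 \<le> measure unif_square (cball p r)" if "p \<in> square" for p
    by (rule measure_cball_quarter[OF r that])
  have mult: "x * y \<le> x' * y'" if "x \<le> x'" "y \<le> y'" "0 \<le> x" "0 \<le> y" for x y x' y' :: real
    using that by (intro mult_mono) auto
  have p0: "0 \<le> pi * r\<^sup>2 / 2" "0 \<le> pi * r\<^sup>2 / 4" by simp_all
  have "P.prob {\<omega> \<in> space (positions I). no_common_neighbour c d u v W r \<omega>} =
    P.prob {\<omega> \<in> space (positions I). (\<forall>i\<in>I. \<omega> i \<in> square) \<and> no_common_neighbour c d u v W r \<omega>}"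
    by (rule measure_positions_square(2)[OF I(1) none])
  also have "\<dots> \<le> P.prob (?E ?C0 \<union> (?E ?C1 \<union> ?E ?C2))"
  proof (rule P.finite_measure_mono)
    show "{\<omega> \<in> space (positions I). (\<forall>i\<in>I. \<omega> i \<in> square) \<and> no_common_neighbour c d u v W r \<omega>} \<subseteq> ?E ?C0 \<union> (?E ?C1 \<union> ?E ?C2)"
    proof
      fix \<omega> assume w: "\<omega> \<in> {\<omega> \<in> space (positions I). (\<forall>i\<in>I. \<omega> i \<in> square) \<and> no_common_neighbour c d u v W r \<omega>}"
      then have "?S (\<omega> (c, u)) (\<omega> (d, v))" using JI by blast
      then show "\<omega> \<in> ?E ?C0 \<union> (?E ?C1 \<union> ?E ?C2)" using w by blast
    qed
  qed (intro sets.Un Em)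
  also have "\<dots> \<le> P.prob (?E ?C0) + (P.prob (?E ?C1) + P.prob (?E ?C2))"
    by (intro order_trans[OF measure_Un_le] add_left_mono sets.Un Em order_refl)
  also have "P.prob (?E ?C0) \<le> exp (- (?N * (pi * r\<^sup>2)\<^sup>2 / 4)) * 1"
  proof -
    have "P.prob (?E ?C0) \<le> exp (- (?N * (pi * r\<^sup>2 / 2 * (pi * r\<^sup>2 / 2)))) * J.prob {x \<in> space (positions ?J). ?C0 (x (c, u)) (x (d, v))}"
      by (rule no_common_region_le[OF I cd uv ms(1)[OF order_refl] ms(1)[OF JI]]) (intro mult half p0; blast)
    also have "\<dots> \<le> exp (- (?N * (pi * r\<^sup>2 / 2 * (pi * r\<^sup>2 / 2)))) * 1" by (intro mult_left_mono J.prob_le_1) simp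
    finally show ?thesis by (simp add: power2_eq_square algebra_simps)
  qed
  also have "P.prob (?E ?C1) \<le> exp (- (?N * (pi * r\<^sup>2)\<^sup>2 / 8)) * (8 * r\<^sup>2)"
  proof -
    have "P.prob (?E ?C1) \<le> exp (- (?N * (pi * r\<^sup>2 / 2 * (pi * r\<^sup>2 / 4)))) * J.prob {x \<in> space (positions ?J). ?C1 (x (c, u)) (x (d, v))}"
    proof (rule no_common_region_le[OF I cd uv ms(2)[OF order_refl] ms(2)[OF JI]])
      fix p q assume C: "?C1 p q"
      show "pi * r\<^sup>2 / 2 * (pi * r\<^sup>2 / 4) \<le> measure unif_square (cball p r) * measure unif_square (cball q r)"
      proof (cases "?k p")
        case True
        then have "pi * r\<^sup>2 / 4 * (pi * r\<^sup>2 / 2) \<le> measure unif_square (cball p r) * measure unif_square (cball q r)"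
          using C by (intro mult half quarter p0) auto
        then show ?thesis by (simp add: mult.commute)
      next
        case False
        then show ?thesis using C by (intro mult half quarter p0) auto
      qed
    qed
    also have "J.prob {x \<in> space (positions ?J). ?C1 (x (c, u)) (x (d, v))} \<le>
       J.prob ({x \<in> space (positions ?J). \<forall>i\<in>{(c, u)}. x i \<in> {x. corner r x}} \<union> {x \<in> space (positions ?J). \<forall>i\<in>{(d, v)}. x i \<in> {x. corner r x}})"
    proof (rule J.finite_measure_mono)
      show "{x \<in> space (positions ?J). \<forall>i\<in>{(c, u)}. x i \<in> {x. corner r x}} \<union> {x \<in> space (positions ?J). \<forall>i\<in>{(d, v)}. x i \<in> {x. corner r x}} \<in> J.events"
        by (intro sets.Un sets.sets_Collect_finite_All vimage_position_sets corner_measurable) auto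
    qed auto
    also have "\<dots> \<le> J.prob {x \<in> space (positions ?J). \<forall>i\<in>{(c, u)}. x i \<in> {x. corner r x}} + J.prob {x \<in> space (positions ?J). \<forall>i\<in>{(d, v)}. x i \<in> {x. corner r x}}"
      by (intro measure_Un_le sets.sets_Collect_finite_All vimage_position_sets corner_measurable) auto
    also have "\<dots> \<le> 8 * r\<^sup>2"
      using unif.measure_coords[of ?J "{(c, u)}" "\<lambda>_. {x. corner r x}"] unif.measure_coords[of ?J "{(d, v)}" "\<lambda>_. {x. corner r x}"]
        measure_corner[OF r] by simp
    finally show ?thesis by (simp add: power2_eq_square algebra_simps)
  qed
  also have "P.prob (?E ?C2) \<le> exp (- (?N * (pi * r\<^sup>2)\<^sup>2 / 16)) * (16 * (r\<^sup>2)\<^sup>2)"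
  proof -
    have "P.prob (?E ?C2) \<le> exp (- (?N * (pi * r\<^sup>2 / 4 * (pi * r\<^sup>2 / 4)))) * J.prob {x \<in> space (positions ?J). ?C2 (x (c, u)) (x (d, v))}"
      by (rule no_common_region_le[OF I cd uv ms(3)[OF order_refl] ms(3)[OF JI]]) (intro mult quarter p0; blast)
    also have "J.prob {x \<in> space (positions ?J). ?C2 (x (c, u)) (x (d, v))} \<le>
       J.prob {x \<in> space (positions ?J). \<forall>i\<in>?J. x i \<in> {x. corner r x}}"
    proof (rule J.finite_measure_mono)
      show "{x \<in> space (positions ?J). \<forall>i\<in>?J. x i \<in> {x. corner r x}} \<in> J.events"
        by (intro sets.sets_Collect_finite_All vimage_position_sets corner_measurable) auto
    qed auto
    also have "\<dots> = (\<Prod>i\<in>?J. measure unif_square {x. corner r x})"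
      by (rule unif.measure_coords) auto
    also have "\<dots> = measure unif_square {x. corner r x} * measure unif_square {x. corner r x}"
      using cd by simp
    also have "\<dots> \<le> (4 * r\<^sup>2) * (4 * r\<^sup>2)"
      using measure_corner[OF r] by (intro mult) auto
    finally show ?thesis by (simp add: power2_eq_square algebra_simps)
  qed
  finally show ?thesis by (simp add: no_common_bound_def algebra_simps)
qed

text \<open>The two colour orders use disjoint sets of midpoints, hence independent positions.\<close>

lemma measure_pair_two_layers_le:
  assumes uv: "u < n" "v < n" "u \<noteq> v" and r: "0 \<le> r" "r \<le> 1 / 2"
  shows "\<P>(\<omega> in rgg_space n 2. \<forall>cs\<in>rainbow_colours 2. v \<notin> reach {..<n} r \<omega> u cs)
    \<le> (no_common_bound (real ((n - 2) div 2)) r)\<^sup>2"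
proof -
  let ?I = "{1..2::nat} \<times> {..<n}"
  let ?m = "(n - 2) div 2"
  interpret P: prob_space "positions ?I" by (rule unif.prob_space_power)
  let ?V = "{..<n} - {u, v}"
  have cV: "card ?V = n - 2" using uv by (simp add: card_Diff_subset)
  then obtain W1 where W1: "W1 \<subseteq> ?V" "card W1 = ?m"
    using obtain_subset_with_card_n[of ?m ?V] by (metis div_le_dividend)
  define W2 where "W2 = ?V - W1"
  have W2: "W2 \<subseteq> ?V" "W1 \<inter> W2 = {}" "finite W1" "finite W2"
    using W1 finite_subset[OF W1(1)] by (auto simp: W2_def)
  have "card W2 = n - 2 - ?m" unfolding W2_def using W1 W2 cV by (simp add: card_Diff_subset)
  then have cW2: "?m \<le> card W2" by linarith
  define \<phi> where "\<phi> b = (if b then no_common_neighbour 1 2 u v W1 r else no_common_neighbour 2 1 u v W2 r)" for b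
  define L where "L b = (if b then {(1, u), (2, v)} \<union> {1, 2} \<times> W1 else {(2, u), (1, v)} \<union> {2, 1} \<times> W2 :: (nat \<times> nat) set)" for b :: bool
  have I12: "{1..2} = {1, 2::nat}" by auto
  have LI: "L b \<subseteq> ?I" for b using uv W1 W2 by (auto simp: L_def)
  have "\<P>(\<omega> in positions ?I. \<forall>cs\<in>rainbow_colours 2. v \<notin> reach {..<n} r \<omega> u cs)
     \<le> P.prob {\<omega> \<in> space (positions ?I). \<forall>b\<in>UNIV. \<phi> b \<omega>}"
  proof (rule P.finite_measure_mono)
    have cols: "[2, 1] \<in> rainbow_colours 2" "[1, 2] \<in> rainbow_colours 2" by (auto simp: rainbow_colours_def)
    have "v \<in> reach {..<n} r \<omega> u [d, c]" if "w \<in> ?V" "dist (\<omega> (c, u)) (\<omega> (c, w)) \<le> r" "dist (\<omega> (d, v)) (\<omega> (d, w)) \<le> r" for \<omega> c d w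
      using that uv by (auto simp: dist_commute)
    then show "{\<omega> \<in> space (positions ?I). \<forall>cs\<in>rainbow_colours 2. v \<notin> reach {..<n} r \<omega> u cs}
       \<subseteq> {\<omega> \<in> space (positions ?I). \<forall>b\<in>UNIV. \<phi> b \<omega>}"
      using cols W1(1) W2(1) unfolding \<phi>_def by (auto split: if_splits simp del: reach.simps) blast+
    show "{\<omega> \<in> space (positions ?I). \<forall>b\<in>UNIV. \<phi> b \<omega>} \<in> P.events"
    proof (rule sets.sets_Collect_finite_All)
      show "{\<omega> \<in> space (positions ?I). \<phi> b \<omega>} \<in> P.events" for b
        unfolding \<phi>_def using no_common_neighbour_sets[OF W2(3), of 1 u 2 v ?I r] no_common_neighbour_sets[OF W2(4), of 2 u 1 v ?I r]
          LI[of True] LI[of False] by (auto simp: L_def)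
    qed simp
  qed
  also have "\<dots> = (\<Prod>b\<in>UNIV. P.prob {\<omega> \<in> space (positions ?I). \<phi> b \<omega>})"
  proof (rule unif.measure_blocks[where L = L])
    show "disjoint_family_on L UNIV"
      using uv W1 W2 by (auto simp: disjoint_family_on_def L_def)
    show "\<phi> b (restrict \<omega> (L b)) = \<phi> b \<omega>" for b \<omega>
      by (simp add: \<phi>_def L_def)
    show "{\<eta> \<in> space (positions (L b)). \<phi> b \<eta>} \<in> sets (positions (L b))" for b
      unfolding \<phi>_def using no_common_neighbour_sets[OF W2(3), of 1 u 2 v "L b" r] no_common_neighbour_sets[OF W2(4), of 2 u 1 v "L b" r]
      by (auto simp: L_def)
  qed (use LI in auto)
  also have "\<dots> = P.prob {\<omega> \<in> space (positions ?I). \<phi> False \<omega>} * P.prob {\<omega> \<in> space (positions ?I). \<phi> True \<omega>}"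
    by (simp add: UNIV_bool)
  also have "\<dots> \<le> no_common_bound (real ?m) r * no_common_bound (real ?m) r"
  proof (intro mult_mono no_common_bound_nonneg)
    have "P.prob {\<omega> \<in> space (positions ?I). no_common_neighbour 2 1 u v W2 r \<omega>} \<le> no_common_bound (real (card W2)) r"
      by (rule measure_no_common_le) (use LI[of False] W2 uv r in \<open>auto simp: L_def\<close>)
    also have "\<dots> \<le> no_common_bound (real ?m) r" using cW2 by (intro no_common_bound_mono) simp
    finally show "P.prob {\<omega> \<in> space (positions ?I). \<phi> False \<omega>} \<le> no_common_bound (real ?m) r" by (simp add: \<phi>_def)
    have "P.prob {\<omega> \<in> space (positions ?I). no_common_neighbour 1 2 u v W1 r \<omega>} \<le> no_common_bound (real (card W1)) r"
      by (rule measure_no_common_le) (use LI[of True] W1 uv r in \<open>auto simp: L_def\<close>)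
    then show "P.prob {\<omega> \<in> space (positions ?I). \<phi> True \<omega>} \<le> no_common_bound (real ?m) r" by (simp add: \<phi>_def W1)
  qed simp
  finally show ?thesis unfolding rgg_space_eq by (simp add: power2_eq_square)
qed

section \<open>The critical radius\<close>

definition critical_radius :: "nat \<Rightarrow> real \<Rightarrow> nat \<Rightarrow> real" where
  "critical_radius h c n = c * (ln (real n) / real n ^ (h - 1)) powr (1 / (2 * real h))"

context
  fixes h :: nat and c :: real
  assumes h: "2 \<le> h" and c: "0 < c"
begin

private abbreviation "r \<equiv> critical_radius h c"
private abbreviation "x n \<equiv> real n * (r n)\<^sup>2"

lemma critical_radius_pos: "2 \<le> n \<Longrightarrow> 0 < r n"
  using c by (auto simp: critical_radius_def)

lemma critical_radius_power:
  assumes "2 \<le> n"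
  shows "r n ^ (2 * h) = c ^ (2 * h) * (ln (real n) / real n ^ (h - 1))"
proof -
  let ?z = "ln (real n) / real n ^ (h - 1)"
  have z: "0 < ?z" using assms by simp
  have "(?z powr (1 / (2 * real h))) ^ (2 * h) = (?z powr (1 / (2 * real h))) powr real (2 * h)"
    by (rule powr_realpow[symmetric]) (simp only: powr_gt_zero, use z in linarith)
  also have "\<dots> = ?z" using z h assms by (simp add: powr_powr)
  finally show ?thesis by (simp add: critical_radius_def power_mult_distrib)
qed

lemma critical_mean_last:
  assumes "2 \<le> n"
  shows "(r n)\<^sup>2 * x n ^ (h - 1) = c ^ (2 * h) * ln (real n)"
proof -
  have "(r n)\<^sup>2 * x n ^ (h - 1) = real n ^ (h - 1) * (r n)\<^sup>2 ^ Suc (h - 1)"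
    by (simp add: power_mult_distrib)
  also have "Suc (h - 1) = h" using h by simp
  also have "(r n)\<^sup>2 ^ h = r n ^ (2 * h)" by (simp add: power_mult)
  finally show ?thesis using assms by (simp add: critical_radius_power)
qed

lemma critical_mean_power:
  assumes "2 \<le> n"
  shows "x n ^ h = c ^ (2 * h) * (real n * ln (real n))"
proof -
  have "x n ^ h = x n ^ Suc (h - 1)" using h by simp
  also have "\<dots> = real n * ((r n)\<^sup>2 * x n ^ (h - 1))" by simp
  finally show ?thesis using critical_mean_last[OF assms] by simp
qed

lemma critical_mean_ge: "\<forall>\<^sub>F n in at_top. real n powr (1 / real h) \<le> x n"
proof -
  have "\<forall>\<^sub>F n::nat in at_top. 1 \<le> c ^ (2 * h) * ln (real n)"
  proof -
    have "filterlim (\<lambda>n::nat. ln (real n)) at_top at_top" by real_asymp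
    then have "\<forall>\<^sub>F n::nat in at_top. 1 / c ^ (2 * h) \<le> ln (real n)" by (simp add: filterlim_at_top)
    then show ?thesis by eventually_elim (use c in \<open>simp add: field_simps\<close>)
  qed
  then show ?thesis using eventually_ge_at_top[of 2]
  proof eventually_elim
    case (elim n)
    have "(real n powr (1 / real h)) ^ h = (real n powr (1 / real h)) powr real h"
      by (rule powr_realpow[symmetric]) (use elim in simp)
    also have "\<dots> = real n * 1" using elim h by (simp add: powr_powr)
    also have "\<dots> \<le> real n * (c ^ (2 * h) * ln (real n))" using elim by (intro mult_left_mono) auto
    also have "\<dots> = x n ^ h" using critical_mean_power[of n] elim by simp
    finally show ?case
      using power_mono_iff[of "real n powr (1 / real h)" "x n" h] h by simp
  qed
qed

lemma critical_radius_tendsto: "r \<longlonglongrightarrow> 0"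
proof -
  have "(\<lambda>n. ln (real n) / real n ^ (h - 1)) \<longlonglongrightarrow> 0"
  proof (rule tendsto_sandwich[of "\<lambda>_. 0" _ _ "\<lambda>n. ln (real n) / real n"])
    show "\<forall>\<^sub>F n in at_top. ln (real n) / real n ^ (h - 1) \<le> ln (real n) / real n"
      using eventually_ge_at_top[of 1]
    proof eventually_elim
      case (elim n)
      have "real n ^ 1 \<le> real n ^ (h - 1)" using elim h by (intro power_increasing) auto
      then show ?case using elim by (intro divide_left_mono) auto
    qed
    show "\<forall>\<^sub>F n in at_top. 0 \<le> ln (real n) / real n ^ (h - 1)"
      using eventually_ge_at_top[of 1] by eventually_elim auto
    show "(\<lambda>n. ln (real n) / real n) \<longlonglongrightarrow> 0" by real_asymp
  qed auto
  then have "(\<lambda>n. (ln (real n) / real n ^ (h - 1)) powr (1 / (2 * real h))) \<longlonglongrightarrow> 0"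
    by (rule tendsto_zero_powrI[OF _ tendsto_const])
       (use h in \<open>auto intro: eventually_mono[OF eventually_ge_at_top[of 1]]\<close>)
  then have "(\<lambda>n. c * (ln (real n) / real n ^ (h - 1)) powr (1 / (2 * real h))) \<longlonglongrightarrow> c * 0"
    by (rule tendsto_mult_left)
  then show ?thesis by (simp add: critical_radius_def[abs_def])
qed

lemma critical_mean_at_top: "filterlim x at_top at_top"
proof (rule filterlim_at_top_mono[OF _ critical_mean_ge])
  have "0 < 1 / real h" using h by simp
  then show "filterlim (\<lambda>n. real n powr (1 / real h)) at_top at_top" by real_asymp
qed

lemma ln_over_critical_mean: "(\<lambda>n. ln (real n) / x n) \<longlonglongrightarrow> 0"
proof (rule tendsto_sandwich[of "\<lambda>_. 0" _ _ "\<lambda>n. ln (real n) / real n powr (1 / real h)"])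
  have "0 < 1 / real h" using h by simp
  then show "(\<lambda>n. ln (real n) / real n powr (1 / real h)) \<longlonglongrightarrow> 0" by real_asymp
  show "\<forall>\<^sub>F n in at_top. 0 \<le> ln (real n) / x n"
    using eventually_ge_at_top[of 1] by eventually_elim auto
  show "\<forall>\<^sub>F n in at_top. ln (real n) / x n \<le> ln (real n) / real n powr (1 / real h)"
    using critical_mean_ge eventually_ge_at_top[of 2]
  proof eventually_elim
    case (elim n)
    have "0 < real n powr (1 / real h)" using elim by simp
    then show ?case using elim by (intro divide_left_mono mult_pos_pos) auto
  qed
qed auto

lemma square_exp_critical_mean:
  assumes "0 < \<delta>"
  shows "(\<lambda>n. (real n)\<^sup>2 * exp (- (\<delta> * x n))) \<longlonglongrightarrow> 0"
proof (rule tendsto_sandwich[of "\<lambda>_. 0" _ _ "\<lambda>n. (real n)\<^sup>2 * exp (- (\<delta> * real n powr (1 / real h)))"])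
  have "0 < 1 / real h" using h by simp
  then show "(\<lambda>n. (real n)\<^sup>2 * exp (- (\<delta> * real n powr (1 / real h)))) \<longlonglongrightarrow> 0"
    using assms by real_asymp
  show "\<forall>\<^sub>F n in at_top. (real n)\<^sup>2 * exp (- (\<delta> * x n)) \<le> (real n)\<^sup>2 * exp (- (\<delta> * real n powr (1 / real h)))"
    using critical_mean_ge by eventually_elim (use assms in \<open>auto intro!: mult_left_mono\<close>)
qed auto

lemma critical_penultimate_eq:
  assumes "2 \<le> n"
  shows "c ^ (2 * h) * (ln (real n) / x n) = (r n)\<^sup>2 * x n ^ (h - 2)"
proof -
  have xp: "0 < x n" using critical_radius_pos[OF assms] assms by simp
  have "h - 1 = Suc (h - 2)" using h by simp
  then have "c ^ (2 * h) * ln (real n) = (r n)\<^sup>2 * x n ^ (h - 2) * x n"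
    using critical_mean_last[OF assms] by (simp only: power_Suc2 mult.assoc)
  moreover have "a * (b / y) = d" if "a * b = d * y" "0 < y" for a b d y :: real
    using that by (simp add: field_simps)
  ultimately show ?thesis using xp by blast
qed

lemma critical_penultimate: "(\<lambda>n. (r n)\<^sup>2 * x n ^ (h - 2)) \<longlonglongrightarrow> 0"
proof -
  have "\<forall>\<^sub>F n in at_top. c ^ (2 * h) * (ln (real n) / x n) = (r n)\<^sup>2 * x n ^ (h - 2)"
    using eventually_ge_at_top[of 2] by eventually_elim (rule critical_penultimate_eq)
  moreover have "(\<lambda>n. c ^ (2 * h) * (ln (real n) / x n)) \<longlonglongrightarrow> c ^ (2 * h) * 0"
    by (rule tendsto_mult_left[OF ln_over_critical_mean])
  ultimately show ?thesis using Lim_transform_eventually by fastforce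
qed

end

lemma near_set_mono_sets:
  assumes V: "finite V" "T \<subseteq> S" "S \<subseteq> V"
    and bnd: "a \<le> z" and z: "\<P>(y in positions ({c} \<times> V).
      real (card (neighbours V T c r y)) \<le> z) \<le> q"
  shows "\<P>(y in positions ({c} \<times> V).
      real (card (neighbours V S c r y)) < a) \<le> q"
proof -
  interpret P: prob_space "positions ({c} \<times> V)" by (rule unif.prob_space_power)
  have "P.prob {y \<in> space (positions ({c} \<times> V)). real (card (neighbours V S c r y)) < a}
    \<le> P.prob {y \<in> space (positions ({c} \<times> V)). real (card (neighbours V T c r y)) \<le> z}"
  proof (rule P.finite_measure_mono)
    show "{y \<in> space (positions ({c} \<times> V)). real (card (neighbours V T c r y)) \<le> z} \<in> P.events"
      by (rule near_set_sets) (use V finite_subset[OF order_trans[OF V(2,3)] V(1)] in auto)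
    have mono: "card (neighbours V T c r y) \<le> card (neighbours V S c r y)"
      for y :: "nat \<times> nat \<Rightarrow> real \<times> real"
      by (rule card_mono) (use V in auto)
    have "real (card (neighbours V T c r y)) \<le> z"
      if "real (card (neighbours V S c r y)) < a"
      for y :: "nat \<times> nat \<Rightarrow> real \<times> real"
      using of_nat_mono[OF mono[of y], where 'a = real] that bnd by linarith
    then show "{y \<in> space (positions ({c} \<times> V)). real (card (neighbours V S c r y)) < a}
      \<subseteq> {y \<in> space (positions ({c} \<times> V)). real (card (neighbours V T c r y)) \<le> z}"
      by blast
  qed
  then show ?thesis using z by simp
qed

lemma growth_first_step:
  assumes S: "S \<subseteq> {..<n}" "1 \<le> card S" and n: "19 \<le> n" and r: "0 \<le> r" "r \<le> 1 / 2"
  shows "\<P>(y in positions ({c} \<times> {..<n}).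
      real (card (neighbours {..<n} S c r y)) < 9 / 10 * (pi / 4) * (real n * r\<^sup>2))
    \<le> exp (- (4 / 10000 * (real n * r\<^sup>2)))"
proof -
  obtain s where s: "s \<in> S" using S(2) by fastforce
  have cV: "real (card ({..<n} - {s})) = real n - 1" using s S n by (auto simp: of_nat_diff)
  let ?z = "(1 - 1 / 20) * (real (card ({..<n} - {s})) * (pi * r\<^sup>2 / 4))"
  show ?thesis
  proof (rule near_set_mono_sets[where T = "{s}" and z = ?z])
    have "9 / 10 * real n * (pi / 4 * r\<^sup>2) \<le> 19 / 20 * (real n - 1) * (pi / 4 * r\<^sup>2)"
      using n by (intro mult_right_mono) auto
    then show "9 / 10 * (pi / 4) * (real n * r\<^sup>2) \<le> ?z" unfolding cV by (simp add: algebra_simps)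
    have "\<P>(y in positions ({c} \<times> {..<n}).
      real (card (neighbours {..<n} {s} c r y)) \<le> ?z)
      \<le> exp (- ((1 / 20)\<^sup>2 * (real (card ({..<n} - {s})) * (pi * r\<^sup>2 / 4)) / 2))"
      by (rule near_count_point_lower) (use s S r in auto)
    also have "\<dots> \<le> exp (- (4 / 10000 * (real n * r\<^sup>2)))"
    proof -
      have "4 / 10000 * real n * r\<^sup>2 \<le> 1 / 3200 * (real n - 1) * 3 * r\<^sup>2"
        using n by (intro mult_right_mono) auto
      also have "\<dots> \<le> 1 / 3200 * (real n - 1) * pi * r\<^sup>2"
        using n pi_gt3 by (intro mult_right_mono mult_left_mono) auto
      finally show ?thesis unfolding cV by (simp add: power2_eq_square algebra_simps)
    qed
    finally show "\<P>(y in positions ({c} \<times> {..<n}).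
      real (card (neighbours {..<n} {s} c r y)) \<le> ?z) \<le> exp (- (4 / 10000 * (real n * r\<^sup>2)))" .
  qed (use s S in auto)
qed

lemma growth_step:
  assumes S: "S \<subseteq> {..<n}" "a \<le> real (card S)" and a: "0 \<le> a" and r: "0 < r" "r \<le> 1 / 100"
    and small: "(a + 1) * r\<^sup>2 \<le> 6 / 1000" and x: "1 \<le> real n * r\<^sup>2"
  shows "\<P>(y in positions ({c} \<times> {..<n}).
      real (card (neighbours {..<n} S c r y)) < 45 / 100 * (real n * r\<^sup>2) * a)
    \<le> 2 * exp (- (9 / 100000 * a))"
proof -
  define k where "k = nat \<lceil>sqrt 2 / r\<rceil>"
  define s where "s = nat \<lceil>a\<rceil>"
  let ?x = "real n * r\<^sup>2"
  have s: "a \<le> real s" "real s \<le> a + 1" using a le_of_int_ceiling[of a] of_int_ceiling_le_add_one[of a] by (simp_all add: s_def)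
  have "s \<le> card S" using S(2) a by (simp add: s_def ceiling_le_iff)
  then obtain T where T: "T \<subseteq> S" "card T = s" by (meson obtain_subset_with_card_n)
  have pos: "0 < sqrt 2 / r" using r by simp
  have k: "sqrt 2 / r \<le> real k" "real k \<le> sqrt 2 / r + 1" using pos le_of_int_ceiling[of "sqrt 2 / r"] of_int_ceiling_le_add_one[of "sqrt 2 / r"] by (simp_all add: k_def)
  have k0: "0 < k" using k(1) pos by (metis gr0I less_le_trans linorder_not_less of_nat_0)
  have kr: "sqrt 2 \<le> real k * r" "real k * r \<le> sqrt 2 + r"
    using k r by (simp_all add: field_simps)
  have s2: "sqrt 2 \<le> 15 / 10" by (rule real_le_lsqrt) (simp_all add: power2_eq_square)
  have K: "2 \<le> (real k)\<^sup>2 * r\<^sup>2" "(real k)\<^sup>2 * r\<^sup>2 \<le> 204 / 100"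
  proof -
    have "(sqrt 2)\<^sup>2 \<le> (real k * r)\<^sup>2" using kr(1) by (intro power_mono) auto
    then show "2 \<le> (real k)\<^sup>2 * r\<^sup>2" by (simp add: power_mult_distrib)
    have "(real k * r)\<^sup>2 \<le> (sqrt 2 + r)\<^sup>2" using kr(2) r by (intro power_mono) auto
    also have "\<dots> = 2 + (2 * sqrt 2 + r) * r" by (simp add: power2_eq_square algebra_simps)
    also have "\<dots> \<le> 2 + (2 * (15 / 10) + 1) * (1 / 100)"
      using s2 r by (intro add_left_mono mult_mono) auto
    finally show "(real k)\<^sup>2 * r\<^sup>2 \<le> 204 / 100" by (simp add: power_mult_distrib)
  qed
  have K0: "0 < (real k)\<^sup>2" using k0 by simp
  have sr: "real s * r\<^sup>2 \<le> 6 / 1000"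
    using mult_right_mono[OF s(2), of "r\<^sup>2"] small by simp
  have sn: "real s \<le> 6 / 1000 * real n"
  proof -
    have "real s * r\<^sup>2 \<le> 6 / 1000 * (real n * r\<^sup>2)" using sr x by simp
    then show ?thesis using r by simp
  qed
  have lo: "49 / 100 * (real s * r\<^sup>2) \<le> real s / (real k)\<^sup>2"
  proof -
    have "49 / 100 * (real s * r\<^sup>2) * (real k)\<^sup>2 = real s * (49 / 100 * ((real k)\<^sup>2 * r\<^sup>2))" by simp
    also have "\<dots> \<le> real s * 1" using K(2) by (intro mult_left_mono) auto
    finally show ?thesis using K0 by (simp add: pos_le_divide_eq)
  qed
  have hi: "real s / (real k)\<^sup>2 \<le> 3 / 1000"
  proof -
    have "real s * 2 \<le> real s * ((real k)\<^sup>2 * r\<^sup>2)" using K(1) by (intro mult_left_mono) auto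
    also have "\<dots> = real s * r\<^sup>2 * (real k)\<^sup>2" by simp
    also have "\<dots> \<le> 6 / 1000 * (real k)\<^sup>2" using sr by (intro mult_right_mono) auto
    finally show ?thesis using K0 by (simp add: pos_divide_le_eq)
  qed
  have TV: "T \<subseteq> {..<n}" using T S by auto
  have cV: "real (card ({..<n} - T)) = real n - real s"
    using T TV card_mono[OF _ TV] finite_subset[OF TV] by (simp add: card_Diff_subset of_nat_diff)
  have nV: "994 / 1000 * real n \<le> real n - real s" using sn by simp
  let ?p = "(1 - 1 / 50) * real (card T) / (real k)\<^sup>2"
  let ?\<mu> = "real (card ({..<n} - T)) * ?p"
  have mu: "47 / 100 * (?x * a) \<le> ?\<mu>"
  proof -
    have p: "48 / 100 * (a * r\<^sup>2) \<le> ?p"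
    proof -
      have "48 / 100 * (a * r\<^sup>2) \<le> 98 / 100 * (49 / 100 * (real s * r\<^sup>2))"
      proof -
        have "48 / 100 * (a * r\<^sup>2) \<le> 4802 / 10000 * (real s * r\<^sup>2)"
          using s(1) a by (intro mult_mono mult_right_mono) auto
        then show ?thesis by simp
      qed
      also have "\<dots> \<le> 98 / 100 * (real s / (real k)\<^sup>2)" using lo by (rule mult_left_mono) simp
      finally show ?thesis using T(2) by simp
    qed
    have "47 / 100 * (?x * a) \<le> 994 / 1000 * real n * (48 / 100 * (a * r\<^sup>2))"
      using a mult_nonneg_nonneg[of "real n * r\<^sup>2" a] by (simp add: algebra_simps)
    also have "\<dots> \<le> ?\<mu>" unfolding cV using nV p a by (intro mult_mono) auto
    finally show ?thesis .
  qed
  have xa: "a \<le> ?x * a" using x a mult_right_mono[of 1 ?x a] by simp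
  show ?thesis
  proof (rule near_set_mono_sets[where T = T and z = "(1 - 1 / 50) * ?\<mu>"])
    show "45 / 100 * ?x * a \<le> (1 - 1 / 50) * ?\<mu>"
      using mu xa a by simp
    have "\<P>(y in positions ({c} \<times> {..<n}).
      real (card (neighbours {..<n} T c r y)) \<le> (1 - 1 / 50) * ?\<mu>)
      \<le> exp (- (1 / 50 * real (card T) / 2)) + exp (- ((1 / 50)\<^sup>2 * ?\<mu> / 2))"
    proof (rule near_count_lower[OF _ TV k0])
      show "sqrt 2 / real k \<le> r" using kr(1) k0 by (simp add: pos_divide_le_eq mult.commute)
      have "exp 1 * (real (card T) / (real k)\<^sup>2) \<le> 3 * (3 / 1000)"
        using hi T(2) exp_le by (intro mult_mono) auto
      then show "exp 1 * (real (card T) / (real k)\<^sup>2) \<le> 1 / 50 / 2" by (rule order_trans) simp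
    qed auto
    also have "\<dots> \<le> exp (- (9 / 100000 * a)) + exp (- (9 / 100000 * a))"
    proof (intro add_mono; simp only: exp_le_cancel_iff neg_le_iff_le)
      show "9 / 100000 * a \<le> 1 / 50 * real (card T) / 2" using s a T by simp
      show "9 / 100000 * a \<le> (1 / 50)\<^sup>2 * ?\<mu> / 2"
        using mu xa a by (simp add: power2_eq_square)
    qed
    finally show "\<P>(y in positions ({c} \<times> {..<n}).
      real (card (neighbours {..<n} T c r y)) \<le> (1 - 1 / 50) * ?\<mu>)
      \<le> 2 * exp (- (9 / 100000 * a))" by simp
  qed (use T S in auto)
qed

lemma disconnected_tendsto_many_layers:
  assumes h: "3 \<le> h" and c: "0 < c" "c ^ (2 * h) = 2 ^ (3 * h - 1) / pi ^ 3"
  shows "(\<lambda>n. \<P>(\<omega> in rgg_space n h. \<not> rainbow_connected n h (critical_radius h c n) \<omega>)) \<longlonglongrightarrow> 0"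
proof -
  have h2: "2 \<le> h" using h by simp
  define r where "r = critical_radius h c"
  define x where "x n = real n * (r n)\<^sup>2" for n
  define \<beta> where "\<beta> j = 9 / 10 * (pi / 4) * (45 / 100 :: real) ^ (j - 1)" for j :: nat
  define a where "a n j = (if j = 0 then 1 else \<beta> j * x n ^ j)" for n j
  define \<delta> where "\<delta> = 9 / 100000 * \<beta> (Suc h)"
  define \<gamma> where "\<gamma> = \<beta> (h - 1) * (pi / 4) * c ^ (2 * h)"
  note crit = critical_radius_pos[OF h2 c(1)] critical_mean_at_top[OF h2 c(1)] critical_penultimate[OF h2 c(1)]
    critical_radius_tendsto[OF h2 c(1)] critical_mean_last[OF h2 c(1)] square_exp_critical_mean[OF h2 c(1)]
  note crit' = crit[folded r_def, folded x_def]
  have \<beta>: "0 < \<beta> j" "\<beta> j \<le> 1" for j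
  proof -
    show "0 < \<beta> j" by (simp add: \<beta>_def)
    have "\<beta> j \<le> 9 / 10 * 1 * 1" unfolding \<beta>_def using pi_less_4 by (intro mult_mono power_le_one) auto
    then show "\<beta> j \<le> 1" by simp
  qed
  have \<beta>_Suc: "\<beta> (Suc j) = 45 / 100 * \<beta> j" if "0 < j" for j
    using that by (cases j) (simp_all add: \<beta>_def)
  have \<beta>_mono: "\<beta> (Suc h) \<le> \<beta> j" if "j \<le> h" for j
    unfolding \<beta>_def using that by (intro mult_left_mono power_decreasing) auto
  have \<delta>: "0 < \<delta>" using \<beta>(1) by (simp add: \<delta>_def)
  have \<gamma>: "2 < \<gamma>"
  proof -
    define m where "m = h - 3"
    have m: "h = Suc (Suc (Suc m))" using h by (simp add: m_def)
    have p: "(2::real) ^ (3 * h - 1) = 256 * 8 ^ m"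
    proof -
      have "3 * h - 1 = 8 + 3 * m" by (simp add: m)
      then have "(2::real) ^ (3 * h - 1) = 2 ^ 8 * (2 ^ 3) ^ m" by (simp only: power_add power_mult)
      then show ?thesis by simp
    qed
    have "\<gamma> = 9 / 10 * (pi / 4) * (45 / 100) ^ Suc m * (pi / 4) * (256 * 8 ^ m / pi ^ 3)"
      unfolding \<gamma>_def c(2) p \<beta>_def by (simp add: m)
    also have "\<dots> = 648 / (100 * pi) * (45 / 100 * 8) ^ m"
      unfolding power_mult_distrib by (simp add: power3_eq_cube field_simps)
    also have "\<dots> \<ge> 648 / (100 * pi) * 1"
      by (intro mult_left_mono one_le_power) auto
    moreover have "2 < 648 / (100 * pi)" using pi_approx by (simp add: field_simps)
    ultimately show ?thesis by linarith
  qed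
  let ?q = "\<lambda>n. 2 * exp (- (\<delta> * x n))"
  let ?P = "\<lambda>n. \<P>(\<omega> in rgg_space n h. \<not> rainbow_connected n h (r n) \<omega>)"
  have ev: "\<forall>\<^sub>F n in at_top. ?P n \<le> (real n)\<^sup>2 * (real h * ?q n + real n powr - \<gamma>)"
  proof -
    have "(\<lambda>n. (r n)\<^sup>2 * x n ^ (h - 2) + (r n)\<^sup>2) \<longlonglongrightarrow> 0 + 0\<^sup>2"
      by (intro tendsto_add tendsto_power crit')
    then have "\<forall>\<^sub>F n in at_top. (r n)\<^sup>2 * x n ^ (h - 2) + (r n)\<^sup>2 < 6 / 1000"
      by (intro order_tendstoD) auto
    moreover have "\<forall>\<^sub>F n in at_top. r n < 1 / 100"
      by (rule order_tendstoD(2)[OF crit'(4)]) simp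
    moreover have "\<forall>\<^sub>F n in at_top. 1 \<le> x n"
      using crit'(2) by (simp add: filterlim_at_top)
    ultimately show ?thesis using eventually_ge_at_top[of 19]
    proof eventually_elim
      case (elim n)
      have n: "2 \<le> n" "19 \<le> n" using elim by simp_all
      have r: "0 < r n" "r n \<le> 1 / 100" using crit'(1)[OF n(1)] elim by simp_all
      have x1: "1 \<le> x n" using elim by simp
      have step: "\<P>(y in positions ({Suc j} \<times> {..<n}).
          real (card (neighbours {..<n} S (Suc j) (r n) y)) < a n (Suc j)) \<le> ?q n"
        if j: "j < h - 1" and S: "S \<subseteq> {..<n}" "a n j \<le> real (card S)" for j S
      proof (cases "j = 0")
        case True
        have "a n (Suc j) = 9 / 10 * (pi / 4) * (real n * (r n)\<^sup>2)"
          by (simp add: a_def \<beta>_def x_def True)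
        moreover have "1 \<le> card S" using S(2) True by (simp add: a_def)
        ultimately have "\<P>(y in positions ({Suc j} \<times> {..<n}).
          real (card (neighbours {..<n} S (Suc j) (r n) y)) < a n (Suc j))
          \<le> exp (- (4 / 10000 * x n))"
          using growth_first_step[OF S(1) _ n(2), of "r n" "Suc j"] r by (simp only: x_def)
        also have "\<dots> \<le> exp (- (\<delta> * x n))"
        proof -
          have "\<delta> \<le> 4 / 10000" using \<beta>(2)[of "Suc h"] by (simp add: \<delta>_def)
          then show ?thesis using x1 by (simp add: mult_right_mono)
        qed
        also have "\<dots> \<le> ?q n" by simp
        finally show ?thesis .
      next
        case False
        have aj: "a n j = \<beta> j * x n ^ j" and aSj: "a n (Suc j) = 45 / 100 * (real n * (r n)\<^sup>2) * a n j"
          using False \<beta>_Suc[of j] by (simp_all add: a_def x_def)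
        have xj: "1 * x n \<le> x n ^ (j - 1) * x n" using x1 by (intro mult_right_mono one_le_power) auto
        then have xj: "x n \<le> x n ^ j" using False by (cases j) (simp_all add: mult.commute)
        have a0: "0 \<le> a n j" using \<beta>(1)[of j] x1 by (simp add: aj)
        have "a n j \<le> 1 * x n ^ (h - 2)"
          unfolding aj using \<beta>[of j] x1 j by (intro mult_mono power_increasing) auto
        then have "(a n j + 1) * (r n)\<^sup>2 \<le> (x n ^ (h - 2) + 1) * (r n)\<^sup>2"
          by (intro mult_right_mono) auto
        then have small: "(a n j + 1) * (r n)\<^sup>2 \<le> 6 / 1000" using elim by (simp add: algebra_simps)
        have "\<P>(y in positions ({Suc j} \<times> {..<n}).
          real (card (neighbours {..<n} S (Suc j) (r n) y)) < a n (Suc j))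
          \<le> 2 * exp (- (9 / 100000 * a n j))"
          unfolding aSj by (rule growth_step[OF S a0 r small x1[unfolded x_def]])
        also have "\<dots> \<le> ?q n"
        proof -
          have "\<beta> (Suc h) * x n \<le> a n j"
            unfolding aj using xj \<beta>_mono[of j] \<beta>(1)[of j] x1 j by (intro mult_mono) auto
          then have "9 / 100000 * (\<beta> (Suc h) * x n) \<le> 9 / 100000 * a n j" by (rule mult_left_mono) simp
          then have "\<delta> * x n \<le> 9 / 100000 * a n j" by (simp only: \<delta>_def mult.assoc)
          then show ?thesis by simp
        qed
        finally show ?thesis .
      qed
      show ?case
      proof (rule measure_disconnected_le)
        fix u v assume uv: "u < n" "v < n" "u \<noteq> v"
        let ?I = "{1..h} \<times> {..<n}"
        let ?cs = "rev [1..<Suc h]"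
        interpret P: prob_space "positions ?I" by (rule unif.prob_space_power)
        have cs: "?cs \<in> rainbow_colours h" by (auto simp: rainbow_colours_def)
        have "P.prob {\<omega> \<in> space (positions ?I). \<forall>cs\<in>rainbow_colours h. v \<notin> reach {..<n} (r n) \<omega> u cs}
          \<le> P.prob {\<omega> \<in> space (positions ?I). v \<notin> reach {..<n} (r n) \<omega> u ?cs}"
        proof (rule P.finite_measure_mono)
          show "{\<omega> \<in> space (positions ?I). v \<notin> reach {..<n} (r n) \<omega> u ?cs} \<in> P.events"
            by (intro sets.sets_Collect_neg reach_positions_sets) (use uv in auto)
        qed (use cs in blast)
        also have "\<dots> \<le> real h * ?q n + exp (- (a n (h - 1) * (pi * (r n)\<^sup>2 / 4)))"
          by (rule measure_not_reach_le[where a = "a n"]) (use h uv r step in \<open>auto simp: a_def\<close>)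
        also have "a n (h - 1) * (pi * (r n)\<^sup>2 / 4) = \<beta> (h - 1) * (pi / 4) * ((r n)\<^sup>2 * x n ^ (h - 1))"
          using h by (simp add: a_def)
        also have "\<dots> = \<gamma> * ln (real n)" using crit'(5)[OF n(1)] by (simp add: \<gamma>_def)
        also have "exp (- (\<gamma> * ln (real n))) = real n powr - \<gamma>" using n by (simp add: powr_def)
        finally show "\<P>(\<omega> in rgg_space n h. \<forall>cs\<in>rainbow_colours h. v \<notin> reach {..<n} (r n) \<omega> u cs)
            \<le> real h * ?q n + real n powr - \<gamma>"
          unfolding rgg_space_eq .
      qed simp
    qed
  qed
  have "(\<lambda>n. (real n)\<^sup>2 * (real h * ?q n + real n powr - \<gamma>)) \<longlonglongrightarrow> 0"
  proof -
    have "(\<lambda>n. (real n)\<^sup>2 * real n powr - \<gamma>) \<longlonglongrightarrow> 0" using \<gamma> by real_asymp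
    then have "(\<lambda>n. 2 * real h * ((real n)\<^sup>2 * exp (- (\<delta> * x n))) + (real n)\<^sup>2 * real n powr - \<gamma>) \<longlonglongrightarrow> 2 * real h * 0 + 0"
      by (intro tendsto_add tendsto_mult_left crit'(6)[OF \<delta>])
    then show ?thesis by (simp add: algebra_simps)
  qed
  then have "?P \<longlonglongrightarrow> 0"
    by (rule tendsto_sandwich[OF always_eventually ev tendsto_const, rotated]) simp
  then show ?thesis by (simp only: r_def)
qed

lemma disconnected_tendsto_two_layers:
  assumes c: "0 < c" "c ^ 4 = 32 / pi ^ 3"
  shows "(\<lambda>n. \<P>(\<omega> in rgg_space n 2. \<not> rainbow_connected n 2 (critical_radius 2 c n) \<omega>)) \<longlonglongrightarrow> 0"
proof -
  define r where "r = critical_radius 2 c"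
  define B where "B = 32 / pi ^ 3"
  have B: "0 < B" by (simp add: B_def)
  note crit = critical_radius_pos[OF order_refl c(1)] critical_radius_tendsto[OF order_refl c(1)] critical_mean_last[OF order_refl c(1)]
  note crit' = crit[folded r_def]
  let ?P = "\<lambda>n. \<P>(\<omega> in rgg_space n 2. \<not> rainbow_connected n 2 (r n) \<omega>)"
  let ?f = "\<lambda>n. real n powr - (1/5) + 8 * sqrt (B * ln (real n) / real n) * real n powr (2/5)
     + 16 * (B * ln (real n) / real n) * real n powr (7/10)"
  have "\<forall>\<^sub>F n in at_top. ?P n \<le> (?f n)\<^sup>2"
  proof -
    have "\<forall>\<^sub>F n in at_top. r n < 1 / 2"
      by (rule order_tendstoD(2)[OF crit'(2)]) simp
    then show ?thesis using eventually_ge_at_top[of 150]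
    proof eventually_elim
      case (elim n)
      have n: "2 \<le> n" "150 \<le> n" using elim by simp_all
      have r: "0 \<le> r n" "r n \<le> 1 / 2" using crit'(1)[OF n(1)] elim by simp_all
      have r4: "((r n)\<^sup>2)\<^sup>2 = B * ln (real n) / real n"
        using crit'(3)[OF n(1)] c(2) n by (simp add: B_def field_simps power2_eq_square)
      then have r2: "(r n)\<^sup>2 = sqrt (B * ln (real n) / real n)"
        by (metis real_sqrt_unique zero_le_power2)
      have ln0: "0 \<le> ln (real n)" using n by simp
      let ?N = "(n - 2) div 2"
      have N: "49 / 100 * real n \<le> real ?N"
      proof -
        have "n - 2 \<le> 2 * ?N + 1" by simp
        then have "real (n - 2) \<le> real (2 * ?N + 1)" by (rule of_nat_mono)
        then show ?thesis using n by (simp add: of_nat_diff)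
      qed
      have Np: "49 / 10 * ln (real n) \<le> real ?N * (pi * (r n)\<^sup>2)\<^sup>2"
      proof -
        have "49 / 10 * ln (real n) \<le> 49 / 100 * (32 / pi) * ln (real n)"
          using ln0 pi_approx by (intro mult_right_mono) (simp_all add: field_simps)
        also have "\<dots> = 49 / 100 * real n * (pi\<^sup>2 * (B * ln (real n) / real n))"
          using n by (simp add: B_def power2_eq_square power3_eq_cube)
        also have "\<dots> \<le> real ?N * (pi\<^sup>2 * (B * ln (real n) / real n))"
          using N B ln0 by (intro mult_right_mono) auto
        finally show ?thesis unfolding power_mult_distrib r4 .
      qed
      have e: "real n * exp (- (real ?N * (pi * (r n)\<^sup>2)\<^sup>2 / d)) \<le> real n powr t" if "1 - 49 / (10 * d) \<le> t" "0 < d" for d t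
      proof -
        have "49 / 10 * ln (real n) / d \<le> real ?N * (pi * (r n)\<^sup>2)\<^sup>2 / d"
          using Np that by (intro divide_right_mono) auto
        then have "- (real ?N * (pi * (r n)\<^sup>2)\<^sup>2 / d) \<le> - (49 / (10 * d)) * ln (real n)" by simp
        then have "exp (- (real ?N * (pi * (r n)\<^sup>2)\<^sup>2 / d)) \<le> real n powr - (49 / (10 * d))"
          using n by (simp add: powr_def)
        then have "real n * exp (- (real ?N * (pi * (r n)\<^sup>2)\<^sup>2 / d)) \<le> real n powr 1 * real n powr - (49 / (10 * d))"
          using n by (simp add: mult_left_mono)
        also have "\<dots> = real n powr (1 - 49 / (10 * d))"
          using powr_add[of "real n" 1 "- (49 / (10 * d))"] by simp
        also have "\<dots> \<le> real n powr t" using that n by (intro powr_mono) auto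
        finally show ?thesis .
      qed
      have nb: "real n * no_common_bound (real ?N) (r n) \<le> ?f n"
      proof -
        have "real n * no_common_bound (real ?N) (r n) =
           real n * exp (- (real ?N * (pi * (r n)\<^sup>2)\<^sup>2 / 4))
           + 8 * (r n)\<^sup>2 * (real n * exp (- (real ?N * (pi * (r n)\<^sup>2)\<^sup>2 / 8)))
           + 16 * ((r n)\<^sup>2)\<^sup>2 * (real n * exp (- (real ?N * (pi * (r n)\<^sup>2)\<^sup>2 / 16)))"
          by (simp add: no_common_bound_def distrib_left)
        also have "\<dots> \<le> real n powr - (1/5) + 8 * (r n)\<^sup>2 * real n powr (2/5) + 16 * ((r n)\<^sup>2)\<^sup>2 * real n powr (7/10)"
          by (intro add_mono mult_left_mono e) auto
        also have "\<dots> = ?f n" unfolding r4 using r2 by simp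
        finally show ?thesis .
      qed
      have "?P n \<le> (real n)\<^sup>2 * (no_common_bound (real ?N) (r n))\<^sup>2"
        by (rule measure_disconnected_le) (use measure_pair_two_layers_le r in auto)
      also have "\<dots> = (real n * no_common_bound (real ?N) (r n))\<^sup>2" by (simp add: power_mult_distrib)
      also have "\<dots> \<le> (?f n)\<^sup>2"
        using nb no_common_bound_nonneg[of "real ?N" "r n"] by (intro power_mono) auto
      finally show ?case .
    qed
  qed
  moreover have "(\<lambda>n. (?f n)\<^sup>2) \<longlonglongrightarrow> 0"
  proof -
    have "?f \<longlonglongrightarrow> 0" using B by real_asymp
    then have "(\<lambda>n. (?f n)\<^sup>2) \<longlonglongrightarrow> 0\<^sup>2" by (rule tendsto_power)
    then show ?thesis by simp
  qed
  ultimately have "?P \<longlonglongrightarrow> 0"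
    by (rule tendsto_sandwich[OF always_eventually _ tendsto_const, rotated]) simp
  then show ?thesis by (simp only: r_def)
qed

section \<open>Disconnectedness below the critical radius\<close>

lemma card_rainbow_colours_le:
  assumes "1 \<le> h"
  shows "real (card (rainbow_colours h)) \<le> (real h + 1) * real h ^ h"
proof -
  have "card (rainbow_colours h) \<le> card {xs. set xs \<subseteq> {1..h} \<and> length xs \<le> h}"
  proof (rule card_mono)
    show "rainbow_colours h \<subseteq> {xs. set xs \<subseteq> {1..h} \<and> length xs \<le> h}"
    proof
      fix xs assume "xs \<in> rainbow_colours h"
      then show "xs \<in> {xs. set xs \<subseteq> {1..h} \<and> length xs \<le> h}"
        using rainbow_colours_length[of xs h] by (auto simp: rainbow_colours_def)
    qed
  qed (simp add: finite_lists_length_le)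
  also have "\<dots> = (\<Sum>i\<le>h. h ^ i)" by (simp add: card_lists_length_le)
  also have "\<dots> \<le> (\<Sum>i\<le>h. h ^ h)" using assms by (intro sum_mono power_increasing) auto
  also have "\<dots> = (h + 1) * h ^ h" by simp
  finally have "real (card (rainbow_colours h)) \<le> real ((h + 1) * h ^ h)" by (rule of_nat_mono)
  then show ?thesis by (simp add: algebra_simps)
qed

text \<open>This is the only place where the numerical value of the constant below which the graph is
  disconnected matters.\<close>

lemma subcritical_constant_small:
  assumes h: "2 \<le> h" and c: "c = 2 / (3 * pi) * (1 / (2 * pi)) ^ (h - 1)"
  shows "128 * (real h)\<^sup>2 * real (card (rainbow_colours h)) * 13 ^ (h - 1) * c ^ (2 * h) < 1"
proof -
  let ?y = "832 / 9 * (1 / 18 :: real) ^ h"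
  have hs: "h = Suc (h - 1)" using h by simp
  have "c = 4 / 3 * (1 / (2 * pi)) ^ Suc (h - 1)" unfolding c by simp
  then have "c = 4 / 3 * (1 / (2 * pi)) ^ h" using hs by simp
  also have "\<dots> \<le> 4 / 3 * (1 / 6) ^ h"
    using pi_gt3 by (intro mult_left_mono power_mono) (simp_all add: field_simps)
  finally have c_le: "c \<le> 4 / 3 * (1 / 6) ^ h" .
  have "0 \<le> c" unfolding c by simp
  then have "c ^ (2 * h) \<le> (4 / 3 * (1 / 6) ^ h) ^ (2 * h)" using c_le by (rule power_mono[rotated])
  also have "\<dots> = ((4 / 3 * (1 / 6) ^ h)\<^sup>2) ^ h" by (rule power_mult)
  also have "(4 / 3 * (1 / 6) ^ h)\<^sup>2 = 16 / 9 * (1 / 36 :: real) ^ h"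
    by (simp add: power_mult_distrib power2_eq_square power_divide power_mult_distrib[symmetric])
  finally have C: "c ^ (2 * h) \<le> (16 / 9 * (1 / 36) ^ h) ^ h" .
  have two: "real h \<le> 2 ^ (h - 1)" "real h + 1 \<le> 2 ^ h"
  proof -
    have "h \<le> 2 ^ (h - 1)" using h by (metis Suc_leI hs less_exp)
    then show "real h \<le> 2 ^ (h - 1)" by (metis of_nat_le_iff of_nat_numeral of_nat_power)
    have "h + 1 \<le> 2 ^ h" by (metis Suc_eq_plus1 Suc_leI less_exp)
    then have "real (h + 1) \<le> real (2 ^ h)" by (rule of_nat_mono)
    then show "real h + 1 \<le> 2 ^ h" by simp
  qed
  have "(real h)\<^sup>2 \<le> (2 ^ (h - 1))\<^sup>2" using two(1) by (intro power_mono) auto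
  also have "\<dots> = 4 ^ (h - 1)" by (simp add: power2_eq_square power_mult_distrib[symmetric])
  also have "\<dots> = 4 ^ h / 4" using hs by (metis nonzero_mult_div_cancel_left power_Suc zero_neq_numeral)
  finally have H2: "(real h)\<^sup>2 \<le> 4 ^ h / 4" .
  have "real (card (rainbow_colours h)) \<le> (real h + 1) * real h ^ h"
    using h by (intro card_rainbow_colours_le) simp
  also have "\<dots> \<le> 2 ^ h * (2 ^ (h - 1)) ^ h" using two by (intro mult_mono power_mono) auto
  also have "\<dots> = (2 * 2 ^ (h - 1)) ^ h" by (simp only: power_mult_distrib)
  also have "2 * (2::real) ^ (h - 1) = 2 ^ h" using hs by (metis power_Suc)
  finally have R: "real (card (rainbow_colours h)) \<le> (2 ^ h) ^ h" .
  have T: "(13::real) ^ (h - 1) = 13 ^ h / 13"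
    using hs by (metis nonzero_mult_div_cancel_left power_Suc zero_neq_numeral)
  have "128 * (real h)\<^sup>2 * real (card (rainbow_colours h)) * 13 ^ (h - 1) * c ^ (2 * h)
     \<le> 128 * (4 ^ h / 4) * (2 ^ h) ^ h * (13 ^ h / 13) * (16 / 9 * (1 / 36) ^ h) ^ h"
    unfolding T using H2 R C \<open>0 \<le> c\<close> by (intro mult_mono) auto
  also have "\<dots> = 128 / 52 * (4 * 2 ^ h * 13 * (16 / 9 * (1 / 36) ^ h)) ^ h"
    by (simp only: power_mult_distrib)
  also have "4 * 2 ^ h * 13 * (16 / 9 * (1 / 36) ^ h) = ?y"
    using power_mult_distrib[of "2::real" "1 / 36" h] by simp
  finally have bound: "128 * (real h)\<^sup>2 * real (card (rainbow_colours h)) * 13 ^ (h - 1) * c ^ (2 * h) \<le> 128 / 52 * ?y ^ h" .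
  have "?y \<le> 832 / 9 * (1 / 18) ^ 2"
    using h by (intro mult_left_mono power_decreasing) auto
  then have y: "?y \<le> 3 / 10" by (simp add: power2_eq_square)
  then have "?y ^ h \<le> (3 / 10) ^ h" by (intro power_mono) auto
  also have "\<dots> \<le> (3 / 10) ^ 2" using h by (intro power_decreasing) auto
  finally have "?y ^ h \<le> 9 / 100" by (simp add: power2_eq_square)
  then show ?thesis using bound by linarith
qed

lemma connected_tendsto_zero:
  assumes h: "2 \<le> h" and c: "0 < c"
    and small: "128 * (real h)\<^sup>2 * real (card (rainbow_colours h)) * 13 ^ (h - 1) * c ^ (2 * h) < 1"
  shows "(\<lambda>n. \<P>(\<omega> in rgg_space n h. rainbow_connected n h (critical_radius h c n) \<omega>)) \<longlonglongrightarrow> 0"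
proof -
  define r where "r = critical_radius h c"
  define x where "x n = real n * (r n)\<^sup>2" for n
  define D where "D = c ^ (2 * h)"
  define R where "R = real (card (rainbow_colours h))"
  define E where "E = 32 * R * 13 ^ (h - 1) * D"
  define e where "e = 1 / (4 * real h)"
  define L where "L n = nat \<lfloor>real n powr e\<rfloor>" for n :: nat
  note crit = critical_radius_pos[OF h c] critical_radius_tendsto[OF h c] critical_mean_last[OF h c]
    critical_mean_ge[OF h c] critical_mean_at_top[OF h c] square_exp_critical_mean[OF h c] critical_penultimate_eq[OF h c]
  note crit' = crit[folded r_def, folded x_def, folded D_def]
  have h0: "0 < real h" using h by simp
  have e: "0 < e" "e < 1" using h by (simp_all add: e_def)
  have D: "0 < D" using c by (simp add: D_def)
  have R: "0 \<le> R" "0 \<le> E" using D by (simp_all add: R_def E_def)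
  have E: "real h * E < e"
  proof -
    have "4 * real h * (real h * E) < 1"
      using small by (simp add: E_def R_def D_def power2_eq_square algebra_simps)
    then show ?thesis using h0 by (simp add: e_def field_simps)
  qed
  have E1: "E < 1 / real h"
  proof -
    have "1 * E \<le> real h * E" using h R by (intro mult_right_mono) auto
    moreover have "e \<le> 1 / real h" using h0 by (simp add: e_def field_simps)
    ultimately show ?thesis using E by linarith
  qed
  let ?P = "\<lambda>n. \<P>(\<omega> in rgg_space n h. rainbow_connected n h (r n) \<omega>)"
  let ?T1 = "\<lambda>n. 4 * 6 ^ (h - 2) * R * D * (ln (real n) * real n powr - (2 * e))"
  let ?T2 = "\<lambda>n. R * real h * ((real n)\<^sup>2 * exp (- (4 * x n)))"
  let ?T3 = "\<lambda>n. 64 * real h * exp 1 * D * (ln (real n) * real n powr (E - 1 / real h))"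
  let ?T4 = "\<lambda>n. exp (- ((real n powr e - 1) * ((exp (- 1) / 18) ^ h * real n powr (- (real h * E)))))"
  have "\<forall>\<^sub>F n in at_top. ?P n \<le> ?T1 n + ?T2 n + ?T3 n + ?T4 n"
  proof -
    have "\<forall>\<^sub>F n in at_top. r n < 1 / 12"
      by (rule order_tendstoD(2)[OF crit'(2)]) simp
    moreover have "\<forall>\<^sub>F n in at_top. 1 \<le> x n"
      using crit'(5) by (simp add: filterlim_at_top)
    ultimately show ?thesis using crit'(4) eventually_ge_at_top[of 3]
    proof eventually_elim
      case (elim n)
      have n: "2 \<le> n" "1 < real n" using elim by simp_all
      have r: "0 < r n" "r n \<le> 1 / 12" using crit'(1)[OF n(1)] elim by simp_all
      have x1: "1 \<le> x n" and xn: "real n powr (1 / real h) \<le> x n" using elim by simp_all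
      have ln0: "0 < ln (real n)" using n by simp
      define k where "k = nat \<lfloor>1 / (3 * r n)\<rfloor>"
      define M where "M = nat \<lceil>R * (13 * x n) ^ (h - 1)\<rceil>"
      define \<mu> where "\<mu> = (real k)\<^sup>2 * (1 - 1 / (real k)\<^sup>2) ^ M"
      define \<rho> where "\<rho> = exp (- 1) * real n powr - E"
      have L: "real (L n) \<le> real n powr e" "real n powr e - 1 \<le> real (L n)"
        unfolding L_def using of_int_floor_le[of "real n powr e"] real_of_int_floor_gt_diff_one[of "real n powr e"] by simp_all
      have Ln: "L n < n"
      proof -
        have "real n powr e < real n powr 1" using e n by (intro powr_less_mono) auto
        then have "real (L n) < real n" using L(1) n by simp
        then show ?thesis by simp
      qed
      have k: "real k \<le> 1 / (3 * r n)" "1 / (4 * r n) \<le> real k"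
      proof -
        have p: "0 \<le> 1 / (3 * r n)" using r by simp
        then show "real k \<le> 1 / (3 * r n)" unfolding k_def by simp
        have "1 \<le> 1 / (3 * r n) - 1 / (4 * r n)" using r by (simp add: field_simps)
        moreover have "real k = of_int \<lfloor>1 / (3 * r n)\<rfloor>" using p by (simp add: k_def)
        ultimately show "1 / (4 * r n) \<le> real k"
          using real_of_int_floor_gt_diff_one[of "1 / (3 * r n)"] by linarith
      qed
      have k3: "3 \<le> real k"
      proof -
        have "3 \<le> 1 / (4 * r n)" using r by (simp add: field_simps)
        then show ?thesis using k(2) by linarith
      qed
      have kr: "3 * real k * r n \<le> 1" using k(1) r by (simp add: field_simps)
      have k16: "1 / (16 * (r n)\<^sup>2) \<le> (real k)\<^sup>2"
      proof -
        have "(1 / (4 * r n))\<^sup>2 \<le> (real k)\<^sup>2" using k(2) r by (intro power_mono) auto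
        then show ?thesis by (simp add: power_divide power_mult_distrib)
      qed
      have K9: "9 \<le> (real k)\<^sup>2" using power_mono[OF k3, of 2] by simp
      have Kinv: "1 / (real k)\<^sup>2 \<le> 16 * (r n)\<^sup>2" "1 / (real k)\<^sup>2 \<le> 1 / 2"
      proof -
        show "1 / (real k)\<^sup>2 \<le> 16 * (r n)\<^sup>2"
        proof -
          have "0 < (real k)\<^sup>2" "0 < 1 / (16 * (r n)\<^sup>2)" using K9 r by (linarith, simp)
          then have "0 < (real k)\<^sup>2 * (1 / (16 * (r n)\<^sup>2))" by (rule mult_pos_pos)
          then have "1 / (real k)\<^sup>2 \<le> 1 / (1 / (16 * (r n)\<^sup>2))" by (intro divide_left_mono k16) auto
          then show ?thesis by simp
        qed
        show "1 / (real k)\<^sup>2 \<le> 1 / 2" using K9 by (intro frac_le) auto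
      qed
      have M: "R * (13 * x n) ^ (h - 1) \<le> real M" "real M \<le> R * (13 * x n) ^ (h - 1) + 1"
      proof -
        have "0 \<le> R * (13 * x n) ^ (h - 1)" using R x1 by simp
        then show "R * (13 * x n) ^ (h - 1) \<le> real M" "real M \<le> R * (13 * x n) ^ (h - 1) + 1"
          unfolding M_def using of_int_ceiling_le_add_one[of "R * (13 * x n) ^ (h - 1)"] by (simp_all add: real_nat_ceiling_ge)
      qed
      have hole: "\<rho> \<le> (1 - 1 / (real k)\<^sup>2) ^ M"
      proof -
        have "2 * (1 / (real k)\<^sup>2) * real M \<le> 32 * (r n)\<^sup>2 * (R * (13 * x n) ^ (h - 1) + 1)"
        proof (rule mult_mono)
          show "2 * (1 / (real k)\<^sup>2) \<le> 32 * (r n)\<^sup>2" using Kinv(1) by linarith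
        qed (use M(2) in auto)
        also have "\<dots> = E * ln (real n) + 32 * (r n)\<^sup>2"
        proof -
          have "32 * (r n)\<^sup>2 * (R * (13 * x n) ^ (h - 1)) = 32 * R * 13 ^ (h - 1) * ((r n)\<^sup>2 * x n ^ (h - 1))"
            by (simp only: power_mult_distrib mult_ac)
          also have "\<dots> = E * ln (real n)" unfolding crit'(3)[OF n(1)] by (simp add: E_def)
          finally show ?thesis by (simp add: distrib_left)
        qed
        also have "32 * (r n)\<^sup>2 \<le> 1"
          using power_mono[OF r(2), of 2] r by (simp add: power_divide)
        finally have le: "2 * (1 / (real k)\<^sup>2) * real M \<le> E * ln (real n) + 1" by simp
        have "\<rho> = exp (- (E * ln (real n) + 1))"
          using n by (simp add: \<rho>_def powr_def mult_exp_exp algebra_simps)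
        also have "\<dots> \<le> exp (- (2 * (1 / (real k)\<^sup>2) * real M))" using le by simp
        also have "\<dots> = exp (- 2 * (1 / (real k)\<^sup>2)) ^ M" by (simp add: exp_of_nat_mult[symmetric] algebra_simps)
        also have "\<dots> \<le> (1 - 1 / (real k)\<^sup>2) ^ M"
        proof (intro power_mono)
          have "exp (- 2 * y) \<le> 1 - y" if "0 \<le> y" "y \<le> 1 / 2" for y :: real
          proof -
            have "exp (- (2 * y)) \<le> 1 - 2 * y + (2 * y)\<^sup>2 / 2" by (rule exp_minus_le_quadratic) (use that in simp)
            also have "(2 * y)\<^sup>2 / 2 = 2 * y * y" by (simp add: power2_eq_square)
            also have "2 * y * y \<le> 1 * y" using that by (intro mult_right_mono) auto
            finally show ?thesis by simp
          qed
          from this[of "1 / (real k)\<^sup>2"] show "exp (- 2 * (1 / (real k)\<^sup>2)) \<le> 1 - 1 / (real k)\<^sup>2"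
            using Kinv(2) by simp
        qed simp
        finally show ?thesis .
      qed
      have \<rho>0: "0 < \<rho>" using n by (simp add: \<rho>_def)
      have "?P n \<le> (real (card {1..L n}))\<^sup>2 * real (card (rainbow_colours h)) * (4 * (r n)\<^sup>2 * (2 + 4 * (real n * (r n)\<^sup>2)) ^ (h - 2))
         + real (card (rainbow_colours h)) * (real h * exp (- (4 * (real n * (r n)\<^sup>2))))
         + real h * (4 / \<mu>) + exp (- (real (card {1..L n}) * (\<mu> / (18 * (real k)\<^sup>2)) ^ h))"
      proof (rule measure_connected_le[OF h _ _ _ _ _ kr _ \<mu>_def])
        show "{1..L n} \<subseteq> {1..<n}" using Ln by auto
        show "1 \<le> real n * (r n)\<^sup>2" using x1 by (simp add: x_def)
        show "real (card (rainbow_colours h)) * (13 * (real n * (r n)\<^sup>2)) ^ (h - 1) \<le> real M"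
          using M(1) by (simp add: R_def x_def)
      qed (use n r k3 in auto)
      then have "?P n \<le> (real (L n))\<^sup>2 * R * (4 * (r n)\<^sup>2 * (2 + 4 * x n) ^ (h - 2))
         + R * (real h * exp (- (4 * x n))) + real h * (4 / \<mu>) + exp (- (real (L n) * (\<mu> / (18 * (real k)\<^sup>2)) ^ h))"
        by (simp add: R_def x_def)
      also have "\<dots> \<le> ?T1 n + ?T2 n + ?T3 n + ?T4 n"
      proof (intro add_mono)
        have "4 * (r n)\<^sup>2 * (2 + 4 * x n) ^ (h - 2) \<le> 4 * (r n)\<^sup>2 * (6 * x n) ^ (h - 2)"
          using x1 by (intro mult_left_mono power_mono) auto
        also have "\<dots> = 4 * 6 ^ (h - 2) * ((r n)\<^sup>2 * x n ^ (h - 2))" by (simp only: power_mult_distrib mult_ac)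
        also have "\<dots> = 4 * 6 ^ (h - 2) * (D * (ln (real n) / x n))" using crit'(7)[OF n(1)] by simp
        also have "\<dots> \<le> 4 * 6 ^ (h - 2) * (D * (ln (real n) / real n powr (1 / real h)))"
          using xn ln0 D x1 n by (intro mult_left_mono divide_left_mono mult_pos_pos) auto
        finally have A: "4 * (r n)\<^sup>2 * (2 + 4 * x n) ^ (h - 2) \<le> 4 * 6 ^ (h - 2) * (D * (ln (real n) / real n powr (1 / real h)))" .
        have B: "(real (L n))\<^sup>2 \<le> real n powr (2 * e)"
        proof -
          have "(real (L n))\<^sup>2 \<le> (real n powr e)\<^sup>2" using L(1) by (intro power_mono) auto
          also have "\<dots> = real n powr (2 * e)" by (simp add: power2_eq_square powr_add[symmetric])
          finally show ?thesis .
        qed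
        have "(real (L n))\<^sup>2 * R * (4 * (r n)\<^sup>2 * (2 + 4 * x n) ^ (h - 2))
           \<le> real n powr (2 * e) * R * (4 * 6 ^ (h - 2) * (D * (ln (real n) / real n powr (1 / real h))))"
          by (rule mult_mono[OF mult_right_mono[OF B R(1)] A]) (use R x1 in auto)
        also have "\<dots> = 4 * 6 ^ (h - 2) * R * D * (ln (real n) * (real n powr (2 * e) / real n powr (1 / real h)))" by simp
        also have "real n powr (2 * e) / real n powr (1 / real h) = real n powr - (2 * e)"
        proof -
          have "2 * e - 1 / real h = - (2 * e)" using h0 by (simp add: e_def field_simps)
          then show ?thesis by (metis powr_diff)
        qed
        finally show "(real (L n))\<^sup>2 * R * (4 * (r n)\<^sup>2 * (2 + 4 * x n) ^ (h - 2)) \<le> ?T1 n" .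
        have "1 * exp (- (4 * x n)) \<le> (real n)\<^sup>2 * exp (- (4 * x n))"
          using n by (intro mult_right_mono) auto
        then have "R * real h * (1 * exp (- (4 * x n))) \<le> ?T2 n" using R by (intro mult_left_mono) auto
        then show "R * (real h * exp (- (4 * x n))) \<le> ?T2 n" by simp
        have mu: "\<rho> / (16 * (r n)\<^sup>2) \<le> \<mu>"
        proof -
          have "1 / (16 * (r n)\<^sup>2) * \<rho> \<le> \<mu>" unfolding \<mu>_def using k16 hole \<rho>0 by (intro mult_mono) auto
          then show ?thesis by simp
        qed
        have r2: "(r n)\<^sup>2 \<le> D * (ln (real n) / real n powr (1 / real h))"
        proof -
          have "(r n)\<^sup>2 * 1 \<le> (r n)\<^sup>2 * x n ^ (h - 2)" using x1 by (intro mult_left_mono one_le_power) auto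
          also have "\<dots> = D * (ln (real n) / x n)" using crit'(7)[OF n(1)] by simp
          also have "\<dots> \<le> D * (ln (real n) / real n powr (1 / real h))"
            using xn ln0 D x1 n by (intro mult_left_mono divide_left_mono mult_pos_pos) auto
          finally show ?thesis by simp
        qed
        have "4 / \<mu> \<le> 4 / (\<rho> / (16 * (r n)\<^sup>2))"
        proof -
          have "0 < \<rho> / (16 * (r n)\<^sup>2)" using \<rho>0 r by simp
          then show ?thesis using mu by (intro divide_left_mono mult_pos_pos) auto
        qed
        also have "\<dots> = 64 * (r n)\<^sup>2 / \<rho>" by simp
        also have "\<dots> \<le> 64 * (D * (ln (real n) / real n powr (1 / real h))) / \<rho>"
          using r2 \<rho>0 by (intro divide_right_mono mult_left_mono) auto
        also have "\<dots> = 64 * exp 1 * D * (ln (real n) * (real n powr E / real n powr (1 / real h)))"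
          using n by (simp add: \<rho>_def exp_minus powr_minus field_simps)
        also have "real n powr E / real n powr (1 / real h) = real n powr (E - 1 / real h)"
          by (simp add: powr_diff)
        finally have "real h * (4 / \<mu>) \<le> real h * (64 * exp 1 * D * (ln (real n) * real n powr (E - 1 / real h)))"
          by (rule mult_left_mono) simp
        then show "real h * (4 / \<mu>) \<le> ?T3 n" by (simp only: mult_ac)
        have "\<mu> / (18 * (real k)\<^sup>2) = (1 - 1 / (real k)\<^sup>2) ^ M / 18" using k3 by (simp add: \<mu>_def)
        then have "\<rho> / 18 \<le> \<mu> / (18 * (real k)\<^sup>2)" using hole by simp
        then have "(\<rho> / 18) ^ h \<le> (\<mu> / (18 * (real k)\<^sup>2)) ^ h" using \<rho>0 by (intro power_mono) auto
        moreover have "(\<rho> / 18) ^ h = (exp (- 1) / 18) ^ h * real n powr (- (real h * E))"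
        proof -
          have "(real n powr - E) ^ h = real n powr (- (real h * E))"
            using n by (simp add: powr_realpow[symmetric] powr_powr mult.commute)
          moreover have "\<rho> / 18 = exp (- 1) / 18 * real n powr - E" by (simp add: \<rho>_def)
          ultimately show ?thesis by (simp only: power_mult_distrib)
        qed
        ultimately have "(real n powr e - 1) * ((exp (- 1) / 18) ^ h * real n powr (- (real h * E))) \<le> real (L n) * (\<mu> / (18 * (real k)\<^sup>2)) ^ h"
          using L(2) by (intro mult_mono) auto
        then show "exp (- (real (L n) * (\<mu> / (18 * (real k)\<^sup>2)) ^ h)) \<le> ?T4 n" by simp
      qed
      finally show ?case .
    qed
  qed
  moreover have "(\<lambda>n. ?T1 n + ?T2 n + ?T3 n + ?T4 n) \<longlonglongrightarrow> 0"
  proof -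
    have "(\<lambda>n. ln (real n) * real n powr - (2 * e)) \<longlonglongrightarrow> 0" using e by real_asymp
    moreover define d where "d = 1 / real h - E"
    moreover have "(\<lambda>n. ln (real n) * real n powr - d) \<longlonglongrightarrow> 0"
    proof -
      have "0 < d" using E1 by (simp add: d_def)
      then show ?thesis by real_asymp
    qed
    moreover have "?T4 \<longlonglongrightarrow> 0"
    proof -
      define s where "s = real h * E"
      define C where "C = (exp (- 1) / 18 :: real) ^ h"
      have "0 \<le> s" "s < e" "0 < C" using R E by (simp_all add: s_def C_def)
      have "filterlim (\<lambda>n. C * (real n powr (e - s) - real n powr - s)) at_top at_top"
      proof (rule filterlim_at_top_mono)
        define t where "t = e - s"
        have "0 < t" using \<open>s < e\<close> by (simp add: t_def)
        then show "filterlim (\<lambda>n. C * (real n powr (e - s) - 1)) at_top at_top"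
          using \<open>0 < C\<close> unfolding t_def[symmetric] by real_asymp
        show "\<forall>\<^sub>F n in at_top. C * (real n powr (e - s) - 1) \<le> C * (real n powr (e - s) - real n powr - s)"
          using eventually_ge_at_top[of 1]
        proof eventually_elim
          case (elim n)
          then have "real n powr - s \<le> real n powr 0" using \<open>0 \<le> s\<close> by (intro powr_mono) auto
          then show ?case using elim \<open>0 < C\<close> by (intro mult_left_mono) auto
        qed
      qed
      moreover have "(real n powr e - 1) * (C * real n powr - s) = C * (real n powr (e - s) - real n powr - s)" for n
        by (simp add: powr_diff powr_minus divide_inverse algebra_simps)
      ultimately have "filterlim (\<lambda>n. (real n powr e - 1) * (C * real n powr - s)) at_top at_top" by (simp only:)
      then have "(\<lambda>n. exp (- ((real n powr e - 1) * (C * real n powr - s)))) \<longlonglongrightarrow> 0"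
        by (intro filterlim_compose[OF exp_at_bot] filterlim_compose[OF filterlim_uminus_at_bot_at_top])
      then show ?thesis by (simp only: s_def C_def)
    qed
    moreover have "(\<lambda>n. (real n)\<^sup>2 * exp (- (4 * x n))) \<longlonglongrightarrow> 0" by (rule crit'(6)) simp
    ultimately have "(\<lambda>n. ?T1 n + ?T2 n + ?T3 n + ?T4 n) \<longlonglongrightarrow> 4 * 6 ^ (h - 2) * R * D * 0 + R * real h * 0 + 64 * real h * exp 1 * D * 0 + 0"
      by (intro tendsto_add tendsto_mult_left) (simp_all add: d_def)
    then show ?thesis by simp
  qed
  ultimately have "?P \<longlonglongrightarrow> 0"
    by (rule tendsto_sandwich[OF always_eventually _ tendsto_const, rotated]) simp
  then show ?thesis by (simp only: r_def)
qed

lemma measure_connected_compl: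
  "\<P>(\<omega> in rgg_space n h. rainbow_connected n h r \<omega>)
    = 1 - \<P>(\<omega> in rgg_space n h. \<not> rainbow_connected n h r \<omega>)"
  "\<P>(\<omega> in rgg_space n h. \<not> rainbow_connected n h r \<omega>)
    = 1 - \<P>(\<omega> in rgg_space n h. rainbow_connected n h r \<omega>)"
proof -
  interpret P: prob_space "rgg_space n h" unfolding rgg_space_eq by (rule unif.prob_space_power)
  have "{\<omega> \<in> space (rgg_space n h). \<not> rainbow_connected n h r \<omega>}
      = space (rgg_space n h) - {\<omega> \<in> space (rgg_space n h). rainbow_connected n h r \<omega>}" by auto
  then show "\<P>(\<omega> in rgg_space n h. \<not> rainbow_connected n h r \<omega>)
    = 1 - \<P>(\<omega> in rgg_space n h. rainbow_connected n h r \<omega>)"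
    using P.prob_compl[OF rainbow_connected_sets] by simp
  then show "\<P>(\<omega> in rgg_space n h. rainbow_connected n h r \<omega>)
    = 1 - \<P>(\<omega> in rgg_space n h. \<not> rainbow_connected n h r \<omega>)"
    by simp
qed

lemma measure_connected_mono:
  assumes "r \<le> r'"
  shows "\<P>(\<omega> in rgg_space n h. rainbow_connected n h r \<omega>)
    \<le> \<P>(\<omega> in rgg_space n h. rainbow_connected n h r' \<omega>)"
proof -
  interpret P: prob_space "rgg_space n h" unfolding rgg_space_eq by (rule unif.prob_space_power)
  show ?thesis
    by (rule P.finite_measure_mono[OF _ rainbow_connected_sets]) (use rainbow_connected_mono[OF assms] in blast)
qed

lemma connected_tendsto_one:
  assumes h: "2 \<le> h" and c: "0 < c" "c ^ (2 * h) = 2 ^ (3 * h - 1) / pi ^ 3"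
  shows "(\<lambda>n. \<P>(\<omega> in rgg_space n h. rainbow_connected n h (critical_radius h c n) \<omega>)) \<longlonglongrightarrow> 1"
proof -
  have "(\<lambda>n. \<P>(\<omega> in rgg_space n h. \<not> rainbow_connected n h (critical_radius h c n) \<omega>)) \<longlonglongrightarrow> 0"
  proof (cases "h = 2")
    case True
    then show ?thesis using disconnected_tendsto_two_layers[of c] c by simp
  next
    case False
    then show ?thesis using disconnected_tendsto_many_layers[OF _ c] h by simp
  qed
  then have "(\<lambda>n. 1 - \<P>(\<omega> in rgg_space n h. \<not> rainbow_connected n h (critical_radius h c n) \<omega>)) \<longlonglongrightarrow> 1 - 0"
    by (rule tendsto_diff[OF tendsto_const])
  then show ?thesis by (simp only: measure_connected_compl(1) diff_zero)
qed

theorem theorem1: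
  fixes h :: nat
  assumes "h \<ge> 2"
  shows
    "(\<forall>(b::real) (r::nat \<Rightarrow> real).
        b > (2 ^ (2 + 3 * (h - 1)) / pi ^ 3) powr (1 / (2 * real h)) \<longrightarrow>
        (\<forall>\<^sub>F n in at_top. r n \<ge> b * (ln (real n) / real n ^ (h - 1)) powr (1 / (2 * real h))) \<longrightarrow>
        ((\<lambda>n. measure (rgg_space n h)
                 {bb \<in> space (rgg_space n h). rainbow_connected n h (r n) bb})
           \<longlonglongrightarrow> 1))
   \<and> (\<forall>(c::real) (r::nat \<Rightarrow> real).
        c < 2 / (3 * pi) * (1 / (2 * pi)) ^ (h - 1) \<longrightarrow>
        (\<forall>\<^sub>F n in at_top. r n \<le> c * (ln (real n) / real n ^ (h - 1)) powr (1 / (2 * real h))) \<longrightarrow>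
        ((\<lambda>n. measure (rgg_space n h)
                 {bb \<in> space (rgg_space n h). \<not> rainbow_connected n h (r n) bb})
           \<longlonglongrightarrow> 1))"
proof (intro conjI allI impI)
  fix b :: real and r :: "nat \<Rightarrow> real"
  define c where "c = (2 ^ (2 + 3 * (h - 1)) / pi ^ 3) powr (1 / (2 * real h))"
  assume b: "b > (2 ^ (2 + 3 * (h - 1)) / pi ^ 3) powr (1 / (2 * real h))"
    and r: "\<forall>\<^sub>F n in at_top. r n \<ge> b * (ln (real n) / real n ^ (h - 1)) powr (1 / (2 * real h))"
  have c0: "0 < c" by (simp add: c_def)
  have "c ^ (2 * h) = c powr real (2 * h)" by (rule powr_realpow[OF c0, symmetric])
  also have "\<dots> = 2 ^ (2 + 3 * (h - 1)) / pi ^ 3"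
    using assms by (simp add: c_def powr_powr)
  also have "2 + 3 * (h - 1) = 3 * h - 1" using assms by simp
  finally have c: "c ^ (2 * h) = 2 ^ (3 * h - 1) / pi ^ 3" .
  let ?P = "\<lambda>n r. \<P>(bb in rgg_space n h. rainbow_connected n h r bb)"
  show "(\<lambda>n. ?P n (r n)) \<longlonglongrightarrow> 1"
  proof (rule tendsto_sandwich[OF _ _ connected_tendsto_one[OF assms c0 c] tendsto_const])
    show "\<forall>\<^sub>F n in at_top. ?P n (critical_radius h c n) \<le> ?P n (r n)"
      using r
    proof eventually_elim
      case (elim n)
      have "critical_radius h c n \<le> b * (ln (real n) / real n ^ (h - 1)) powr (1 / (2 * real h))"
        unfolding critical_radius_def using b by (intro mult_right_mono) (simp_all add: c_def)
      then show ?case using elim by (intro measure_connected_mono) simp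
    qed
    show "\<forall>\<^sub>F n in at_top. ?P n (r n) \<le> 1"
      by (intro always_eventually allI prob_space.prob_le_1) (simp add: rgg_space_eq unif.prob_space_power)
  qed
next
  fix c :: real and r :: "nat \<Rightarrow> real"
  define d where "d = 2 / (3 * pi) * (1 / (2 * pi)) ^ (h - 1)"
  assume c: "c < 2 / (3 * pi) * (1 / (2 * pi)) ^ (h - 1)"
    and r: "\<forall>\<^sub>F n in at_top. r n \<le> c * (ln (real n) / real n ^ (h - 1)) powr (1 / (2 * real h))"
  have d0: "0 < d" by (simp add: d_def)
  let ?P = "\<lambda>n r. \<P>(bb in rgg_space n h. rainbow_connected n h r bb)"
  have "(\<lambda>n. ?P n (r n)) \<longlonglongrightarrow> 0"
  proof (rule tendsto_sandwich[OF _ _ tendsto_const connected_tendsto_zero[OF assms d0 subcritical_constant_small[OF assms d_def]]])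
    show "\<forall>\<^sub>F n in at_top. ?P n (r n) \<le> ?P n (critical_radius h d n)"
      using r
    proof eventually_elim
      case (elim n)
      have "c * (ln (real n) / real n ^ (h - 1)) powr (1 / (2 * real h)) \<le> critical_radius h d n"
        unfolding critical_radius_def using c by (intro mult_right_mono) (simp_all add: d_def)
      then show ?case using elim by (intro measure_connected_mono) simp
    qed
  qed simp
  then have "(\<lambda>n. 1 - ?P n (r n)) \<longlonglongrightarrow> 1 - 0" by (rule tendsto_diff[OF tendsto_const])
  then show "(\<lambda>n. \<P>(bb in rgg_space n h. \<not> rainbow_connected n h (r n) bb)) \<longlonglongrightarrow> 1"
    by (simp only: measure_connected_compl(2) diff_zero)
qed

end
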